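(* Let $(\alpha,\nu,P)$ be critical data with $\langle\chi^2,\nu_k\rangle<\infty$ for all $k$, and fix $p,N>0$. For $\xi\in\mathsf B^p_N$ let $\bar\mu^\xi$ be the third component of the fluid solution with initial state $\xi$, and let $\bar W^\xi(0)=e\langle\chi,\xi\rangle+eMP'Q\langle1,\xi\rangle$. Then $$\lim_{t\to\infty}\sup_{\xi\in\mathsf B^p_N}\mathbf d\big(\bar\mu^\xi(t),\Delta^\nu\bar W^\xi(0)\big)=0.$$
   Context: Notation. $e=(1,\dots,1)$; prime = transpose; $\chi(x)=x$; $I(x)=[x,\infty)$; $\langle g,\mu\rangle=\int g\,d\mu$ (componentwise for vectors); $|x|=\max_k|x_k|$; $\varphi(x)=1/x$ ($x>0$), $\varphi(0)=0$; $\mathcal M^K$ vectors of finite nonnegative Borel measures on $\mathbb R_+$, $\mathcal M^{c,K}$ those without atoms. $\mathbf d(\xi,\eta)=\max_k\boldsymbol\rho(\xi_k,\eta_k)$ with $\boldsymbol\rho$ the Lévy–Prokhorov metric $\inf\{\epsilon>0:\xi(B)\le\eta(B^\epsilon)+\epsilon,\eta(B)\le\xi(B^\epsilon)+\epsilon\ \forall\text{ closed }B\}$. $\mathsf B^p_N=\{\xi\in\mathcal M^{c,K}:|\langle1,\xi\rangle|\vee|\langle\chi,\xi\rangle|\vee|\langle\chi^{1+p},\xi\rangle|\le N\}$. Data. $\alpha\in\mathbb R^K_+$; $\nu_k$ Borel probability measures on $\mathbb R_+$, $\nu_k(\{0\})=0$, means $\beta_k$; $P$ nonnegative with spectral radius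 $<1$; $Q=(I-P')^{-1}$, $\lambda=Q\alpha$, $M=\mathrm{diag}(\beta_k)$, $\Lambda=\mathrm{diag}(\lambda_k)$, $M^{(2)}=\mathrm{diag}(\langle\chi^2,\nu_k\rangle)$; critical: $eM\lambda=1$. $\nu^e_k([0,x])=\beta_k^{-1}\int_0^x\nu_k(I(y))dy$. Lifting map: $\Delta^\nu w$ has $k$-th component $\frac{w\beta_k\lambda_k}{e(\frac12M^{(2)}+MP'QM)\lambda}\nu^e_k$. Fluid solution. For $\xi\in\mathcal M^{c,K}$, the (unique) fluid solution is the triple $(\bar A,\bar D,\bar\mu)$ of continuous functions, $\bar A,\bar D:\mathbb R_+\to\mathbb R^K_+$ componentwise nondecreasing, $\bar\mu:\mathbb R_+\to\mathcal M^K$, $\bar\mu(0)=\xi$, such that if $\xi\ne0$: $\bar A(t)=\alpha t+P'\bar D(t)$, $\langle1,\bar\mu(t)\rangle=\langle1,\xi\rangle+\bar A(t)-\bar D(t)$, $\bar\mu_k(t)(I(x))=\xi_k(I(x+\bar S(t)))+\int_0^t\nu_k(I(x+\bar S(s,t)))d\bar A_k(s)$ for all $x,t\ge0$, where $\bar S(t)=\int_0^t\varphi(\sum_k\langle1,\bar\mu_k(s)\rangle)ds$ and $\bar S(s,t)=\bar S(t)-\bar S(s)$; if $\xi=0$: $\bar A=\bar D=\lambda t$, $\bar\mu\equiv0$. *)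

theory Defs
  imports "HOL-Analysis.Analysis" "Jordan_Normal_Form.Spectral_Radius"
    "Jordan_Normal_Form.Gauss_Jordan_Elimination"
begin

text \<open>Components are indexed by k < K.  A "vector of measures" is a function
  nat => real measure, only the components k < K matter.  A measure on R_+ is
  represented as a Borel measure on the reals that puts no mass on the
  negative half-line.\<close>

definition is_meas :: "real measure \<Rightarrow> bool" where
  "is_meas M \<longleftrightarrow> sets M = sets borel \<and> finite_measure M \<and> emeasure M {..<0} = 0"

definition is_cmeas :: "real measure \<Rightarrow> bool" where
  "is_cmeas M \<longleftrightarrow> is_meas M \<and> (\<forall>x. emeasure M {x} = 0)"

definition mass :: "real measure \<Rightarrow> real" where
  "mass M = measure M (space M)"

definition phi :: "real \<Rightarrow> real" where
  "phi x = (if x > 0 then 1 / x else 0)"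

definition nbhd :: "real set \<Rightarrow> real \<Rightarrow> real set" where
  "nbhd B e = {y. \<exists>x\<in>B. dist x y < e}"

definition levy_prokhorov :: "real measure \<Rightarrow> real measure \<Rightarrow> real" where
  "levy_prokhorov M L = Inf {e. e > 0 \<and> (\<forall>B. closed B \<longrightarrow>
      measure M B \<le> measure L (nbhd B e) + e \<and> measure L B \<le> measure M (nbhd B e) + e)}"

definition dmeas :: "nat \<Rightarrow> (nat \<Rightarrow> real measure) \<Rightarrow> (nat \<Rightarrow> real measure) \<Rightarrow> real" where
  "dmeas K xi eta = Max ((\<lambda>k. levy_prokhorov (xi k) (eta k)) ` {..<K})"

definition beta :: "(nat \<Rightarrow> real measure) \<Rightarrow> nat \<Rightarrow> real" where
  "beta \<nu> k = integral\<^sup>L (\<nu> k) (\<lambda>x. x)"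

definition mom2 :: "(nat \<Rightarrow> real measure) \<Rightarrow> nat \<Rightarrow> real" where
  "mom2 \<nu> k = integral\<^sup>L (\<nu> k) (\<lambda>x. x ^ 2)"

definition Qmat :: "nat \<Rightarrow> real mat \<Rightarrow> real mat" where
  "Qmat K P = the (mat_inverse (1\<^sub>m K - transpose_mat P))"

definition lam :: "nat \<Rightarrow> real vec \<Rightarrow> real mat \<Rightarrow> real vec" where
  "lam K \<alpha> P = Qmat K P *\<^sub>v \<alpha>"

definition nu_e :: "(nat \<Rightarrow> real measure) \<Rightarrow> nat \<Rightarrow> real measure" where
  "nu_e \<nu> k = density lborel
     (\<lambda>y. ennreal (indicator {0..} y * measure (\<nu> k) {y..} / beta \<nu> k))"

definition lift_const :: "nat \<Rightarrow> real vec \<Rightarrow> real mat \<Rightarrow> (nat \<Rightarrow> real measure) \<Rightarrow> real" where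
  "lift_const K \<alpha> P \<nu> =
     (\<Sum>k<K. mom2 \<nu> k / 2 * lam K \<alpha> P $ k
        + beta \<nu> k * (\<Sum>j<K. (transpose_mat P * Qmat K P) $$ (k, j) * beta \<nu> j * lam K \<alpha> P $ j))"

definition lift :: "nat \<Rightarrow> real vec \<Rightarrow> real mat \<Rightarrow> (nat \<Rightarrow> real measure) \<Rightarrow> real
     \<Rightarrow> nat \<Rightarrow> real measure" where
  "lift K \<alpha> P \<nu> w k = scale_measure
     (ennreal (w * beta \<nu> k * lam K \<alpha> P $ k / lift_const K \<alpha> P \<nu>)) (nu_e \<nu> k)"

definition W0 :: "nat \<Rightarrow> real mat \<Rightarrow> (nat \<Rightarrow> real measure) \<Rightarrow> (nat \<Rightarrow> real measure) \<Rightarrow> real" where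
  "W0 K P \<nu> xi =
     (\<Sum>k<K. integral\<^sup>L (xi k) (\<lambda>x. x))
   + (\<Sum>k<K. beta \<nu> k * ((transpose_mat P * Qmat K P) *\<^sub>v vec K (\<lambda>j. mass (xi j))) $ k)"

definition Bpn :: "nat \<Rightarrow> real \<Rightarrow> real \<Rightarrow> (nat \<Rightarrow> real measure) set" where
  "Bpn K p N = {xi. (\<forall>k<K. is_cmeas (xi k))
      \<and> (\<forall>k<K. \<bar>mass (xi k)\<bar> \<le> N)
      \<and> (\<forall>k<K. (\<integral>\<^sup>+ x. ennreal x \<partial>xi k) \<le> ennreal N)
      \<and> (\<forall>k<K. (\<integral>\<^sup>+ x. ennreal (x powr (1 + p)) \<partial>xi k) \<le> ennreal N)}"

definition Sint :: "nat \<Rightarrow> (real \<Rightarrow> nat \<Rightarrow> real measure) \<Rightarrow> real \<Rightarrow> ennreal" where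
  "Sint K \<mu> t = (\<integral>\<^sup>+ s. indicator {0..t} s * ennreal (phi (\<Sum>k<K. mass (\<mu> s k))) \<partial>lborel)"

definition Sbar :: "nat \<Rightarrow> (real \<Rightarrow> nat \<Rightarrow> real measure) \<Rightarrow> real \<Rightarrow> real" where
  "Sbar K \<mu> t = enn2real (Sint K \<mu> t)"

text \<open>fluid solution with initial state xi.  Functions live on R_+ = {0..};
  values at negative times are irrelevant.  The Stieltjes integral dA_k is
  taken w.r.t. the Lebesgue--Stieltjes measure of s |-> A_k(max 0 s).\<close>
definition fluid_solution ::
  "nat \<Rightarrow> real vec \<Rightarrow> real mat \<Rightarrow> (nat \<Rightarrow> real measure) \<Rightarrow> (nat \<Rightarrow> real measure)
   \<Rightarrow> (real \<Rightarrow> nat \<Rightarrow> real) \<Rightarrow> (real \<Rightarrow> nat \<Rightarrow> real) \<Rightarrow> (real \<Rightarrow> nat \<Rightarrow> real measure) \<Rightarrow> bool" where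
  "fluid_solution K \<alpha> P \<nu> xi A D \<mu> \<longleftrightarrow>
     (\<forall>k<K. continuous_on {0..} (\<lambda>t. A t k) \<and> mono_on {0..} (\<lambda>t. A t k)
            \<and> continuous_on {0..} (\<lambda>t. D t k) \<and> mono_on {0..} (\<lambda>t. D t k)
            \<and> (\<forall>t\<ge>0. A t k \<ge> 0 \<and> D t k \<ge> 0))
   \<and> (\<forall>t\<ge>0. \<forall>k<K. is_meas (\<mu> t k))
   \<and> (\<forall>t\<ge>0. ((\<lambda>s. dmeas K (\<mu> s) (\<mu> t)) \<longlongrightarrow> 0) (at t within {0..}))
   \<and> (\<forall>k<K. \<mu> 0 k = xi k)
   \<and> (if (\<forall>k<K. xi k = null_measure borel)
      then (\<forall>t\<ge>0. \<forall>k<K. A t k = lam K \<alpha> P $ k * t \<and> D t k = lam K \<alpha> P $ k * t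
                        \<and> \<mu> t k = null_measure borel)
      else (\<forall>t\<ge>0. \<forall>k<K. A t k = \<alpha> $ k * t + (\<Sum>j<K. P $$ (j, k) * D t j))
         \<and> (\<forall>t\<ge>0. \<forall>k<K. mass (\<mu> t k) = mass (xi k) + A t k - D t k)
         \<and> (\<forall>t\<ge>0. Sint K \<mu> t < \<infinity>)
         \<and> (\<forall>t\<ge>0. \<forall>x\<ge>0. \<forall>k<K.
              measure (\<mu> t k) {x..} =
                measure (xi k) {x + Sbar K \<mu> t..}
              + (LINT s:{0..t}|interval_measure (\<lambda>s. A (max 0 s) k).
                   measure (\<nu> k) {x + (Sbar K \<mu> t - Sbar K \<mu> s)..})))"

end

theory Submission
  imports Defs "HOL-Probability.Probability"
begin

text \<open>In the time scale u = S(t), in which every job is served at unit rate, the fluid equations become linear.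
  Testing the arrival streams against the solution r of the dual system r = f + P (\<nu> * r) eliminates the
  classes: the total mass Z satisfies a scalar renewal equation Z = g + h * Z whose kernel h is a
  probability density (criticality) with mean the constant in the lifting map, and whose forcing g
  has integral W(0). The mass of class k beyond x is likewise a convolution of Z with a kernel of
  integral \<lambda>_k \<beta>_k \<nu>^e_k([x, \<infinity>)).

  The renewal theorem is proved uniformly over the initial states. If the deviation of Z from
  W(0) / mean is close to its asymptotic supremum M at some late time u, then h \<ge> c on (0, \<delta>] forces it to
  be close to M on average over a long window before u; since the convolution of Z with the
  tail of h is the conserved workload, M = 0. Since S'(t) = 1 / Z, a bound on Z makes S(t) tend to
  infinity uniformly.\<close>

section \<open>Matrices with spectral radius below one\<close>

text \<open>Uniformity in the initial state does not come from compactness: the asymptotic supremum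
  is taken over all states and all late times together, so a near-maximal pair (state, time) exists,
  and the constants that propagate smallness backwards depend on the kernel alone. The state enters
  only through the forcing, which must be bounded, vanish at infinity and have small tail integrals
  uniformly; this rests on the bounds on mass, mean and moment of order 1 + p. The second moments of
  the service laws make the mean of the kernel finite.

  Two circularities shape the middle part. The change of clock needs positive total mass, and a
  first zero is excluded by identities for the path before it. The renewal equation holds only on
  the range of S, which is all of [0, \<infinity>) only once Z is bounded; the a priori bound is
  therefore proved on arbitrary finite horizons with a constant free of the horizon.

  For the distance it suffices to compare tails at finitely many grid points, because the limits
  have uniformly small tails.\<close>

primrec iterate_ones :: "nat \<Rightarrow> real mat \<Rightarrow> nat \<Rightarrow> nat \<Rightarrow> real" where
  "iterate_ones K P 0 l = 1"
| "iterate_ones K P (Suc n) l = (\<Sum>j<K. P $$ (l, j) * iterate_ones K P n j)"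

text \<open>An eigenvector of the scaled matrix is one of \<open>B\<close> with eigenvalue
  multiplied by \<open>r\<close>. Scaling turns the uniform bound on powers of a matrix of spectral
  radius below one into the geometric rate \<open>r ^ n\<close>.\<close>

lemma spectral_radius_smult_less:
  fixes B :: "complex mat"
  assumes B: "B \<in> carrier_mat K K" and K: "0 < K" and r: "0 < r" and sr: "spectral_radius B < r"
  shows "spectral_radius (complex_of_real (1 / r) \<cdot>\<^sub>m B) < 1"
proof -
  let ?A = "complex_of_real (1 / r) \<cdot>\<^sub>m B"
  have A: "?A \<in> carrier_mat K K" using B by simp
  obtain k where k: "k \<in> spectrum ?A" "spectral_radius ?A = norm k"
    using spectral_radius_mem_max(1)[OF A K] by auto
  then obtain v where v: "v \<in> carrier_vec K" "v \<noteq> 0\<^sub>v K" "?A *\<^sub>v v = k \<cdot>\<^sub>v v"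
    using A unfolding spectrum_def eigenvalue_def eigenvector_def by auto
  have "B *\<^sub>v v = complex_of_real r \<cdot>\<^sub>v (complex_of_real (1 / r) \<cdot>\<^sub>v (B *\<^sub>v v))"
    using r by (simp add: smult_smult_assoc)
  also have "complex_of_real (1 / r) \<cdot>\<^sub>v (B *\<^sub>v v) = ?A *\<^sub>v v"
    using v(1) B by (intro eq_vecI) (auto simp: scalar_prod_def sum_distrib_left mult_ac)
  also have "\<dots> = k \<cdot>\<^sub>v v" by (rule v(3))
  finally have "B *\<^sub>v v = (complex_of_real r * k) \<cdot>\<^sub>v v"
    by (simp add: smult_smult_assoc)
  then have "complex_of_real r * k \<in> spectrum B"
    using v B unfolding spectrum_def eigenvalue_def eigenvector_def by auto
  then have "norm (complex_of_real r * k) \<le> spectral_radius B"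
    using spectral_radius_mem_max(2)[OF B K] by blast
  then have "r * norm k \<le> spectral_radius B" using r by (simp add: norm_mult)
  then have "r * norm k < r * 1" using sr by linarith
  then have "norm k < 1" using r mult_less_cancel_left_pos by blast
  then show ?thesis using k(2) by simp
qed

lemma pow_mat_mult_vec_commute:
  fixes A :: "'a :: semiring_1 mat"
  assumes A: "A \<in> carrier_mat K K" and v: "v \<in> carrier_vec K"
  shows "A ^\<^sub>m Suc n *\<^sub>v v = A *\<^sub>v (A ^\<^sub>m n *\<^sub>v v)"
proof -
  have "A ^\<^sub>m n * A = A * A ^\<^sub>m n"
  proof (induction n)
    case (Suc n)
    have "A ^\<^sub>m Suc n * A = (A * A ^\<^sub>m n) * A" using Suc by simp
    also have "\<dots> = A * (A ^\<^sub>m n * A)" using A by (intro assoc_mult_mat[of _ K K _ K _ K]) auto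
    finally show ?case by simp
  qed (use A in auto)
  then show ?thesis using A v by (simp add: assoc_mult_mat_vec[of _ K K _ K])
qed

lemma summable_iterate_ones:
  assumes P: "P \<in> carrier_mat K K" "\<forall>i<K. \<forall>j<K. P $$ (i, j) \<ge> 0"
    and sr: "spectral_radius (map_mat complex_of_real P) < 1" and l: "l < K"
  shows "summable (\<lambda>n. iterate_ones K P n l)"
proof -
  have K: "0 < K" using l by simp
  let ?B = "map_mat complex_of_real P"
  have B: "?B \<in> carrier_mat K K" using P by simp
  \<comment> \<open>Any number strictly between the spectral radius and 1 would do; the
    \<open>max\<close> keeps it positive, so that dividing by \<open>r\<close> is
    legitimate.\<close>
  define r where "r = (max 0 (spectral_radius ?B) + 1) / 2"
  have r: "0 < r" "r < 1" "spectral_radius ?B < r" using sr by (auto simp: r_def field_simps max_def)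
  let ?A = "complex_of_real (1 / r) \<cdot>\<^sub>m ?B"
  have A: "?A \<in> carrier_mat K K" using B by simp
  obtain c where c: "\<And>k. norm_bound (?A ^\<^sub>m k) c"
    using spectral_radius_jnf_norm_bound_less_1_upper_triangular[OF A
        spectral_radius_smult_less[OF B K r(1,3)]] by blast
  let ?v = "vec K (\<lambda>_. 1 :: complex)"
  \<comment> \<open>The row sums of P^n, divided by \<open>r ^ n\<close>, are the entries of a power
    of the scaled matrix applied to the all-ones vector, and those powers are bounded by
    \<open>c\<close>.\<close>
  have it: "?A ^\<^sub>m n *\<^sub>v ?v = vec K (\<lambda>l. complex_of_real (iterate_ones K P n l / r ^ n))" for n
  proof (induction n)
    case 0
    show ?case using P by (auto simp: one_mult_mat_vec[of _ K])
  next
    case (Suc n)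
    have "?A ^\<^sub>m Suc n *\<^sub>v ?v = ?A *\<^sub>v vec K (\<lambda>l. complex_of_real (iterate_ones K P n l / r ^ n))"
      using pow_mat_mult_vec_commute[OF A, of ?v n] Suc by simp
    also have "\<dots> = vec K (\<lambda>l. complex_of_real (iterate_ones K P (Suc n) l / r ^ Suc n))"
      using P(1) by (intro eq_vecI) (auto simp: scalar_prod_def sum_divide_distrib of_real_sum
          atLeast0LessThan mult_ac intro!: sum.cong)
    finally show ?case .
  qed
  have nn: "iterate_ones K P n l \<ge> 0" if "l < K" for n l
    using that by (induction n arbitrary: l) (auto intro!: sum_nonneg mult_nonneg_nonneg simp: P(2))
  have bd: "iterate_ones K P n l \<le> (real K * c) * r ^ n" for n
  proof -
    have car: "?A ^\<^sub>m n \<in> carrier_mat K K" using A by simp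
    have "complex_of_real (iterate_ones K P n l / r ^ n) = (?A ^\<^sub>m n *\<^sub>v ?v) $ l"
      using it l by simp
    also have "\<dots> = (\<Sum>j<K. (?A ^\<^sub>m n) $$ (l, j))"
      using l carrier_matD[OF car]
      by (subst index_mult_mat_vec) (auto simp: scalar_prod_def atLeast0LessThan intro!: sum.cong)
    finally have "norm (complex_of_real (iterate_ones K P n l / r ^ n)) \<le> (\<Sum>j<K. norm ((?A ^\<^sub>m n) $$ (l, j)))"
      by (metis norm_sum)
    also have "\<dots> \<le> (\<Sum>j<K. c)"
      using c[of n] l unfolding norm_bound_def carrier_matD[OF car] by (intro sum_mono) simp
    finally show ?thesis using r nn[OF l, of n] by (simp add: norm_divide norm_power field_simps)
  qed
  show ?thesis
    by (rule summable_comparison_test[of _ "\<lambda>n. (real K * c) * r ^ n"])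
       (use bd nn l r in \<open>auto intro!: summable_mult summable_geometric\<close>)
qed

text \<open>The Neumann series of P applied to the all-ones vector, that is (I - P)^{-1} 1,
  satisfies the equation once its zeroth term is split off. The excess 1 in every component is what
  the later comparison arguments use.\<close>

lemma exists_supersolution:
  assumes P: "P \<in> carrier_mat K K" "\<forall>i<K. \<forall>j<K. P $$ (i, j) \<ge> 0"
    and sr: "spectral_radius (map_mat complex_of_real P) < 1"
  obtains w where "\<And>l. l < K \<Longrightarrow> 0 \<le> w l" "\<And>l. l < K \<Longrightarrow> (\<Sum>j<K. P $$ (l, j) * w j) + 1 = w l"
proof
  define w where "w l = (\<Sum>n. iterate_ones K P n l)" for l
  note s = summable_iterate_ones[OF P sr]
  have nn: "iterate_ones K P n l \<ge> 0" if "l < K" for n l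
    using that by (induction n arbitrary: l) (auto intro!: sum_nonneg mult_nonneg_nonneg simp: P(2))
  show "0 \<le> w l" if "l < K" for l
    unfolding w_def using s nn that by (intro suminf_nonneg) auto
  show "(\<Sum>j<K. P $$ (l, j) * w j) + 1 = w l" if l: "l < K" for l
  proof -
    have "w l = (\<Sum>n. iterate_ones K P (Suc n) l) + iterate_ones K P 0 l"
      unfolding w_def using suminf_split_head[OF s[OF l]] by simp
    also have "(\<Sum>n. iterate_ones K P (Suc n) l) = (\<Sum>j<K. P $$ (l, j) * w j)"
    proof -
      have "(\<Sum>n. iterate_ones K P (Suc n) l) = (\<Sum>j<K. \<Sum>n. P $$ (l, j) * iterate_ones K P n j)"
        unfolding iterate_ones.simps using s by (intro suminf_sum summable_mult) auto
      also have "\<dots> = (\<Sum>j<K. P $$ (l, j) * w j)"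
        unfolding w_def using s by (intro sum.cong suminf_mult) auto
      finally show ?thesis .
    qed
    finally show ?thesis by simp
  qed
qed

text \<open>If (I - P') v = 0, then |v| \<le> P' |v| componentwise; pairing with \<open>w\<close>
  and using P w = w - 1 gives \<Sum> |v| \<le> 0. Hence the determinant is nonzero and the option
  inside \<open>Qmat\<close> is not \<open>None\<close>.\<close>

lemma Qmat_right_inverse:
  assumes P: "P \<in> carrier_mat K K" "\<forall>i<K. \<forall>j<K. P $$ (i, j) \<ge> 0"
    and w: "\<And>l. l < K \<Longrightarrow> 0 \<le> w l" "\<And>l. l < K \<Longrightarrow> (\<Sum>j<K. P $$ (l, j) * w j) + 1 = w l"
  shows "Qmat K P \<in> carrier_mat K K" "(1\<^sub>m K - transpose_mat P) * Qmat K P = 1\<^sub>m K"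
proof -
  let ?M = "1\<^sub>m K - transpose_mat P"
  have M: "?M \<in> carrier_mat K K" using P(1) by (intro minus_carrier_mat) simp
  have "det ?M \<noteq> 0"
  proof
    assume "det ?M = 0"
    then obtain v where v: "v \<in> carrier_vec K" "v \<noteq> 0\<^sub>v K" "?M *\<^sub>v v = 0\<^sub>v K"
      using det_0_iff_vec_prod_zero_field[OF M] by blast
    have fix_v: "v $ k = (\<Sum>j<K. P $$ (j, k) * v $ j)" if "k < K" for k
    proof -
      have "(?M *\<^sub>v v) $ k = (\<Sum>j<K. ((if k = j then 1 else 0) - P $$ (j, k)) * v $ j)"
        using that v(1) P(1) by (auto simp: scalar_prod_def atLeast0LessThan intro!: sum.cong)
      also have "\<dots> = (\<Sum>j<K. (if k = j then v $ j else 0)) - (\<Sum>j<K. P $$ (j, k) * v $ j)"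
        unfolding sum_subtractf[symmetric] by (intro sum.cong) (auto simp: algebra_simps)
      also have "\<dots> = v $ k - (\<Sum>j<K. P $$ (j, k) * v $ j)" using that by (simp add: sum.delta')
      finally show ?thesis using v(3) that by simp
    qed
    have "(\<Sum>k<K. w k * \<bar>v $ k\<bar>) \<le> (\<Sum>k<K. w k * (\<Sum>j<K. P $$ (j, k) * \<bar>v $ j\<bar>))"
    proof (intro sum_mono mult_left_mono)
      fix k assume k: "k \<in> {..<K}"
      have "\<bar>v $ k\<bar> \<le> (\<Sum>j<K. \<bar>P $$ (j, k) * v $ j\<bar>)"
        using fix_v[of k] k by (metis lessThan_iff sum_abs)
      then show "\<bar>v $ k\<bar> \<le> (\<Sum>j<K. P $$ (j, k) * \<bar>v $ j\<bar>)" using k P(2) by (simp add: abs_mult)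
    qed (use w in auto)
    also have "\<dots> = (\<Sum>j<K. (\<Sum>k<K. P $$ (j, k) * w k) * \<bar>v $ j\<bar>)"
      unfolding sum_distrib_left sum_distrib_right by (subst sum.swap) (simp add: mult_ac)
    also have "\<dots> = (\<Sum>j<K. (w j - 1) * \<bar>v $ j\<bar>)"
    proof (intro sum.cong refl arg_cong2[where f="(*)"])
      fix j assume "j \<in> {..<K}"
      then show "(\<Sum>k<K. P $$ (j, k) * w k) = w j - 1" using w(2)[of j] by simp
    qed
    finally have "(\<Sum>j<K. \<bar>v $ j\<bar>) \<le> 0" by (simp add: algebra_simps sum_subtractf)
    then have "(\<Sum>j<K. \<bar>v $ j\<bar>) = 0" by (simp add: sum_nonneg order_antisym)
    then have "\<forall>j<K. v $ j = 0" by (simp add: sum_nonneg_eq_0_iff)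
    then show False using v(1,2) by (auto intro!: eq_vecI)
  qed
  then have "?M \<in> Units (ring_mat TYPE(real) K ())" by (rule det_non_zero_imp_unit[OF M])
  then obtain B where B: "mat_inverse ?M = Some B"
    using mat_inverse(1)[OF M, of "()"] by (cases "mat_inverse ?M") auto
  show "Qmat K P \<in> carrier_mat K K" "?M * Qmat K P = 1\<^sub>m K"
    using mat_inverse(2)[OF M B] B by (auto simp: Qmat_def)
qed

lemma Qmat_mult_vec_eq:
  assumes P: "P \<in> carrier_mat K K" and Q: "Qmat K P \<in> carrier_mat K K"
    "(1\<^sub>m K - transpose_mat P) * Qmat K P = 1\<^sub>m K"
    and v: "v \<in> carrier_vec K" and k: "k < K"
  shows "(Qmat K P *\<^sub>v v) $ k = v $ k + (\<Sum>j<K. P $$ (j, k) * (Qmat K P *\<^sub>v v) $ j)"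
proof -
  let ?q = "Qmat K P *\<^sub>v v"
  have q: "?q \<in> carrier_vec K" using Q v by simp
  have "(1\<^sub>m K - transpose_mat P) *\<^sub>v ?q = v"
    using assoc_mult_mat_vec[of "1\<^sub>m K - transpose_mat P" K K "Qmat K P" K v] P Q v
    by (simp add: minus_carrier_mat)
  then have "v $ k = ((1\<^sub>m K - transpose_mat P) *\<^sub>v ?q) $ k" by simp
  also have "\<dots> = (\<Sum>j<K. ((if k = j then 1 else 0) - P $$ (j, k)) * ?q $ j)"
    using k q P(1) Q(1) by (auto simp: scalar_prod_def atLeast0LessThan intro!: sum.cong)
  also have "\<dots> = (\<Sum>j<K. (if k = j then ?q $ j else 0)) - (\<Sum>j<K. P $$ (j, k) * ?q $ j)"
    unfolding sum_subtractf[symmetric] by (intro sum.cong) (auto simp: algebra_simps)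
  also have "\<dots> = ?q $ k - (\<Sum>j<K. P $$ (j, k) * ?q $ j)" using k by (simp add: sum.delta')
  finally show ?thesis by simp
qed

text \<open>With q = Q v one has v = q - P' q, so pairing v with P R gives the pairing of q with P
  (R - P R) = P b. This identifies the initial workload and the lifting constant, both written with
  P' Q, with the quantities \<open>R\<close> that the dual system produces.\<close>

lemma transpose_Qmat_duality:
  assumes P: "P \<in> carrier_mat K K" and Q: "Qmat K P \<in> carrier_mat K K"
    "(1\<^sub>m K - transpose_mat P) * Qmat K P = 1\<^sub>m K"
    and v: "v \<in> carrier_vec K"
    and R: "\<And>l. l < K \<Longrightarrow> R l = b l + (\<Sum>j<K. P $$ (l, j) * R j)"
  shows "(\<Sum>k<K. b k * ((transpose_mat P * Qmat K P) *\<^sub>v v) $ k) =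
         (\<Sum>k<K. v $ k * (\<Sum>j<K. P $$ (k, j) * R j))"
proof -
  let ?q = "Qmat K P *\<^sub>v v"
  let ?PR = "\<lambda>k. \<Sum>j<K. P $$ (k, j) * R j"
  have q: "?q \<in> carrier_vec K" using Q v by simp
  have "(transpose_mat P * Qmat K P) *\<^sub>v v = transpose_mat P *\<^sub>v ?q"
    using assoc_mult_mat_vec[of "transpose_mat P" K K "Qmat K P" K v] P Q v by simp
  then have e: "((transpose_mat P * Qmat K P) *\<^sub>v v) $ k = (\<Sum>j<K. P $$ (j, k) * ?q $ j)" if "k < K" for k
    using that q P Q(1) by (auto simp: scalar_prod_def atLeast0LessThan intro!: sum.cong)
  have "(\<Sum>k<K. v $ k * ?PR k) = (\<Sum>k<K. (?q $ k - (\<Sum>j<K. P $$ (j, k) * ?q $ j)) * ?PR k)"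
  proof (intro sum.cong refl arg_cong2[where f="(*)"])
    fix k assume "k \<in> {..<K}"
    then show "v $ k = ?q $ k - (\<Sum>j<K. P $$ (j, k) * ?q $ j)"
      using Qmat_mult_vec_eq[OF P Q v, of k] by simp
  qed
  also have "\<dots> = (\<Sum>k<K. ?q $ k * ?PR k) - (\<Sum>j<K. ?q $ j * (\<Sum>k<K. P $$ (j, k) * ?PR k))"
  proof -
    have "(\<Sum>k<K. (\<Sum>j<K. P $$ (j, k) * ?q $ j) * x k) = (\<Sum>j<K. ?q $ j * (\<Sum>k<K. P $$ (j, k) * x k))" for x
      unfolding sum_distrib_right sum_distrib_left by (subst sum.swap) (simp add: mult_ac)
    then show ?thesis by (simp only: left_diff_distrib sum_subtractf)
  qed
  also have "\<dots> = (\<Sum>j<K. ?q $ j * (\<Sum>k<K. P $$ (j, k) * (R k - ?PR k)))"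
    unfolding sum_subtractf[symmetric] by (intro sum.cong) (auto simp: algebra_simps sum_subtractf)
  also have "\<dots> = (\<Sum>j<K. ?q $ j * (\<Sum>k<K. P $$ (j, k) * b k))"
  proof (intro sum.cong refl arg_cong2[where f="(*)"])
    fix k assume "k \<in> {..<K}"
    then show "R k - ?PR k = b k" using R[of k] by simp
  qed
  also have "\<dots> = (\<Sum>k<K. b k * (\<Sum>j<K. P $$ (j, k) * ?q $ j))"
    unfolding sum_distrib_left by (subst sum.swap) (simp add: mult_ac)
  finally show ?thesis using e by simp
qed

lemma lam_eq:
  assumes P: "P \<in> carrier_mat K K" and Q: "Qmat K P \<in> carrier_mat K K"
    "(1\<^sub>m K - transpose_mat P) * Qmat K P = 1\<^sub>m K"
    and alpha: "\<alpha> \<in> carrier_vec K" and k: "k < K"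
  shows "lam K \<alpha> P $ k = \<alpha> $ k + (\<Sum>j<K. P $$ (j, k) * lam K \<alpha> P $ j)"
  using Qmat_mult_vec_eq[OF assms] by (simp add: lam_def)

text \<open>\<open>lam'\<close> solves the traffic equation with P', \<open>R\<close> the dual
  equation with P; both sides equal \<lambda> R - \<lambda> P R. Integrals of dual solutions
  weighted by external rates thus become source integrals weighted by total arrival rates.\<close>

lemma alpha_lam_duality:
  assumes lam: "\<And>k. k < K \<Longrightarrow> lam' k = \<alpha>' k + (\<Sum>j<K. p j k * lam' j)"
    and R: "\<And>l. l < K \<Longrightarrow> R l = F l + (\<Sum>j<K. p l j * R j)"
  shows "(\<Sum>l<K. \<alpha>' l * R l) = (\<Sum>l<K. lam' l * F l :: real)"
proof -
  have "(\<Sum>l<K. \<alpha>' l * R l) = (\<Sum>l<K. lam' l * R l) - (\<Sum>l<K. (\<Sum>j<K. p j l * lam' j) * R l)"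
    unfolding sum_subtractf[symmetric]
  proof (intro sum.cong refl)
    fix l assume "l \<in> {..<K}"
    then have "\<alpha>' l = lam' l - (\<Sum>j<K. p j l * lam' j)" using lam[of l] by simp
    then show "\<alpha>' l * R l = lam' l * R l - (\<Sum>j<K. p j l * lam' j) * R l"
      by (simp only: left_diff_distrib)
  qed
  also have "(\<Sum>l<K. (\<Sum>j<K. p j l * lam' j) * R l) = (\<Sum>j<K. lam' j * (\<Sum>l<K. p j l * R l))"
    unfolding sum_distrib_left sum_distrib_right by (subst sum.swap) (simp add: mult_ac)
  also have "(\<Sum>l<K. lam' l * R l) - (\<Sum>j<K. lam' j * (\<Sum>l<K. p j l * R l)) = (\<Sum>l<K. lam' l * F l)"
    unfolding sum_subtractf[symmetric]
  proof (intro sum.cong refl)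
    fix l assume "l \<in> {..<K}"
    then have "F l = R l - (\<Sum>j<K. p l j * R j)" using R[of l] by simp
    then show "lam' l * R l - lam' l * (\<Sum>j<K. p l j * R j) = lam' l * F l"
      by (simp only: right_diff_distrib)
  qed
  finally show ?thesis .
qed

section \<open>A uniform renewal theorem\<close>

lemma nn_integral_lborel_reflect:
  fixes f :: "real \<Rightarrow> ennreal"
  assumes [measurable]: "f \<in> borel_measurable borel"
  shows "(\<integral>\<^sup>+x. f (u - x) \<partial>lborel) = (\<integral>\<^sup>+x. f x \<partial>lborel)"
  using nn_integral_real_affine[of f "-1" u] by simp

lemma nn_integral_lborel_shift:
  fixes f :: "real \<Rightarrow> ennreal"
  assumes [measurable]: "f \<in> borel_measurable borel"
  shows "(\<integral>\<^sup>+x. f (x - u) \<partial>lborel) = (\<integral>\<^sup>+x. f x \<partial>lborel)"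
  using nn_integral_real_affine[of f 1 "-u"] by (simp add: algebra_simps)

text \<open>If \<open>f u\<close> is small, the hypothesis bounds the average of \<open>f\<close> on
  [u - \<delta>, u], hence \<open>f\<close> is small at some point \<open>u1\<close> of the left
  half of that interval, and the argument restarts there. A step moves back by at least \<delta>/2
  and at most \<delta>: the former gives the length of the window, the latter the room
  \<open>real j * \<delta>\<close> required after \<open>T1\<close>. The constant is quantified
  before \<open>f\<close>, so it serves every solution at once.\<close>

lemma chain_of_small_averages:
  fixes c \<delta> :: real
  assumes c: "0 < c" and \<delta>: "0 < \<delta>"
  shows "\<exists>\<kappa>\<ge>0. \<forall>f T1 \<epsilon> u e. f \<in> borel_measurable borel \<longrightarrow> 0 < \<epsilon> \<longrightarrow> 0 \<le> e \<longrightarrow>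
     (\<forall>v\<ge>T1. ennreal c * (\<integral>\<^sup>+x\<in>{v - \<delta>..v}. ennreal (f x) \<partial>lborel) \<le> ennreal (f v + \<epsilon>)) \<longrightarrow>
     T1 + real j * \<delta> \<le> u \<longrightarrow> f u \<le> e \<longrightarrow>
     (\<integral>\<^sup>+x\<in>{u - real j * \<delta> / 2<..u}. ennreal (f x) \<partial>lborel) \<le> ennreal (\<kappa> * (e + \<epsilon>))"
proof (induction j)
  case 0
  show ?case by (intro exI[of _ 0]) auto
next
  case (Suc j)
  then obtain \<kappa> where \<kappa>: "0 \<le> \<kappa>" and IH: "\<And>f T1 \<epsilon> u e. f \<in> borel_measurable borel \<Longrightarrow> 0 < \<epsilon> \<Longrightarrow> 0 \<le> e \<Longrightarrow>
     (\<forall>v\<ge>T1. ennreal c * (\<integral>\<^sup>+x\<in>{v - \<delta>..v}. ennreal (f x) \<partial>lborel) \<le> ennreal (f v + \<epsilon>)) \<Longrightarrow>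
     T1 + real j * \<delta> \<le> u \<Longrightarrow> f u \<le> e \<Longrightarrow>
     (\<integral>\<^sup>+x\<in>{u - real j * \<delta> / 2<..u}. ennreal (f x) \<partial>lborel) \<le> ennreal (\<kappa> * (e + \<epsilon>))"
    by blast
  \<comment> \<open>\<open>1 / c\<close> pays for [u - \<delta>, u]; the rest is the induction
    constant at \<open>u1\<close>, with error level
    \<open>4 / (\<delta> * c) * (e + \<epsilon>)\<close> in place of \<open>e\<close>.\<close>
  let ?\<kappa> = "1 / c + \<kappa> * (4 / (\<delta> * c) + 1)"
  have "(\<integral>\<^sup>+x\<in>{u - real (Suc j) * \<delta> / 2<..u}. ennreal (f x) \<partial>lborel) \<le> ennreal (?\<kappa> * (e + \<epsilon>))"
    if f[measurable]: "f \<in> borel_measurable borel" and \<epsilon>: "0 < \<epsilon>" and e: "0 \<le> e"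
      and step: "\<forall>v\<ge>T1. ennreal c * (\<integral>\<^sup>+x\<in>{v - \<delta>..v}. ennreal (f x) \<partial>lborel) \<le> ennreal (f v + \<epsilon>)"
      and u: "T1 + real (Suc j) * \<delta> \<le> u" and fu: "f u \<le> e" for f T1 \<epsilon> u e
  proof -
    have uT: "T1 \<le> u" using u \<delta> by (smt (verit) mult_nonneg_nonneg of_nat_0_le_iff)
    have "ennreal c * (\<integral>\<^sup>+x\<in>{u - \<delta>..u}. ennreal (f x) \<partial>lborel) \<le> ennreal (e + \<epsilon>)"
      using step uT fu by (meson add_right_mono ennreal_leI order_trans)
    then have "ennreal (1 / c) * (ennreal c * (\<integral>\<^sup>+x\<in>{u - \<delta>..u}. ennreal (f x) \<partial>lborel))
        \<le> ennreal (1 / c) * ennreal (e + \<epsilon>)"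
      by (rule mult_left_mono) simp
    then have first: "(\<integral>\<^sup>+x\<in>{u - \<delta>..u}. ennreal (f x) \<partial>lborel) \<le> ennreal ((e + \<epsilon>) / c)"
      using c e \<epsilon> by (simp add: mult.assoc[symmetric] ennreal_mult[symmetric] del: ennreal_plus)
    \<comment> \<open>Twice the level that \<open>first\<close> allows on average over an interval
      of length \<delta>/2, so \<open>f > e1\<close> on that whole half is contradictory.\<close>
    define e1 where "e1 = 4 / (\<delta> * c) * (e + \<epsilon>)"
    have e1: "0 < e1" using c \<delta> e \<epsilon> by (simp add: e1_def)
    have "\<exists>u1. u - \<delta> \<le> u1 \<and> u1 \<le> u - \<delta> / 2 \<and> f u1 \<le> e1"
    proof (rule ccontr)
      assume "\<not> ?thesis"
      then have gt: "e1 < f x" if "x \<in> {u - \<delta>..u - \<delta> / 2}" for x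
        using that by force
      have "ennreal (e1 * (\<delta> / 2)) = (\<integral>\<^sup>+x\<in>{u - \<delta>..u - \<delta> / 2}. ennreal e1 \<partial>lborel)"
        using \<delta> e1 by (simp add: nn_integral_cmult ennreal_mult[symmetric])
      also have "\<dots> \<le> (\<integral>\<^sup>+x\<in>{u - \<delta>..u}. ennreal (f x) \<partial>lborel)"
        using gt \<delta> by (intro nn_integral_mono) (force split: split_indicator intro!: ennreal_leI)
      finally have "ennreal (e1 * (\<delta> / 2)) \<le> ennreal ((e + \<epsilon>) / c)" using first by order
      then have "e1 * (\<delta> / 2) \<le> (e + \<epsilon>) / c" using e \<epsilon> c by (simp add: ennreal_le_iff)
      moreover have "e1 * (\<delta> / 2) = 2 * ((e + \<epsilon>) / c)" using \<delta> c by (simp add: e1_def field_simps)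
      moreover have "0 < (e + \<epsilon>) / c" using e \<epsilon> c by simp
      ultimately show False by linarith
    qed
    then obtain u1 where u1: "u - \<delta> \<le> u1" "u1 \<le> u - \<delta> / 2" "f u1 \<le> e1" by blast
    have "T1 + real j * \<delta> \<le> u1" using u u1 by (simp add: algebra_simps)
    then have second: "(\<integral>\<^sup>+x\<in>{u1 - real j * \<delta> / 2<..u1}. ennreal (f x) \<partial>lborel) \<le> ennreal (\<kappa> * (e1 + \<epsilon>))"
      using IH[OF f \<epsilon> _ step _ u1(3)] e1 by simp
    have "(\<integral>\<^sup>+x\<in>{u - real (Suc j) * \<delta> / 2<..u}. ennreal (f x) \<partial>lborel)
        \<le> (\<integral>\<^sup>+x. ennreal (f x) * indicator {u - \<delta>..u} x
             + ennreal (f x) * indicator {u1 - real j * \<delta> / 2<..u1} x \<partial>lborel)"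
      using u1 by (intro nn_integral_mono) (auto split: split_indicator simp: algebra_simps add_divide_distrib)
    also have "\<dots> = (\<integral>\<^sup>+x\<in>{u - \<delta>..u}. ennreal (f x) \<partial>lborel)
        + (\<integral>\<^sup>+x\<in>{u1 - real j * \<delta> / 2<..u1}. ennreal (f x) \<partial>lborel)"
      by (intro nn_integral_add) auto
    also have "\<dots> \<le> ennreal ((e + \<epsilon>) / c) + ennreal (\<kappa> * (e1 + \<epsilon>))"
      by (intro add_mono first second)
    also have "\<dots> = ennreal ((e + \<epsilon>) / c + \<kappa> * (e1 + \<epsilon>))"
      using e \<epsilon> c \<kappa> e1 by (intro ennreal_plus[symmetric]) auto
    also have "\<dots> \<le> ennreal (?\<kappa> * (e + \<epsilon>))"
    proof (rule ennreal_leI)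
      have "\<kappa> * (e1 + \<epsilon>) \<le> \<kappa> * (e1 + (e + \<epsilon>))" using \<kappa> e by (intro mult_left_mono) auto
      then show "(e + \<epsilon>) / c + \<kappa> * (e1 + \<epsilon>) \<le> ?\<kappa> * (e + \<epsilon>)" by (simp add: e1_def algebra_simps)
    qed
    finally show ?thesis .
  qed
  moreover have "0 \<le> ?\<kappa>" using c \<delta> \<kappa> by simp
  ultimately show ?case by blast
qed

lemma integrable_tail_small:
  fixes f :: "real \<Rightarrow> real"
  assumes f: "integrable lborel f" and e: "0 < e"
  obtains R where "0 \<le> R" "\<And>R'. R \<le> R' \<Longrightarrow> \<bar>LINT x|lborel. f x * indicator {R'<..} x\<bar> \<le> e"
proof -
  have [measurable]: "f \<in> borel_measurable borel" using f by auto
  have "((\<lambda>y. LINT x|lborel. f x * indicator {y<..} x) \<longlongrightarrow> (LINT x|(lborel :: real measure). (0::real))) at_top"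
  proof (rule tendsto_at_topI_sequentially)
    fix X :: "nat \<Rightarrow> real" assume X: "filterlim X at_top sequentially"
    show "(\<lambda>n. LINT x|lborel. f x * indicator {X n<..} x) \<longlonglongrightarrow> (LINT x|(lborel :: real measure). (0::real))"
    proof (rule integral_dominated_convergence[where w="\<lambda>x. \<bar>f x\<bar>"])
      show "AE x in lborel. (\<lambda>n. f x * indicator {X n<..} x) \<longlonglongrightarrow> 0"
      proof (intro AE_I2)
        fix x
        have "\<forall>\<^sub>F n in sequentially. x \<le> X n" using X by (auto simp: filterlim_at_top)
        then have "\<forall>\<^sub>F n in sequentially. f x * indicator {X n<..} x = 0"
          by (rule eventually_mono) (auto split: split_indicator)
        then show "(\<lambda>n. f x * indicator {X n<..} x) \<longlonglongrightarrow> 0" by (rule tendsto_eventually)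
      qed
    qed (use f in \<open>auto split: split_indicator\<close>)
  qed
  then have "\<forall>\<^sub>F y in at_top. \<bar>LINT x|lborel. f x * indicator {y<..} x\<bar> < e"
    using e by (auto simp: tendsto_iff dist_real_def)
  then obtain R where "\<And>R'. R \<le> R' \<Longrightarrow> \<bar>LINT x|lborel. f x * indicator {R'<..} x\<bar> < e"
    by (auto simp: eventually_at_top_linorder)
  then show thesis by (intro that[of "max 0 R"]) (auto intro: less_imp_le)
qed

lemma mult_le_of_abs_le_divide:
  fixes a b x :: real
  assumes "0 < b" "\<bar>x\<bar> \<le> a / b"
  shows "b * x \<le> a"
proof -
  have "x \<le> a / b" using assms by linarith
  then show ?thesis using assms(1) by (simp add: field_simps)
qed

text \<open>The lower bound \<open>c\<close> on (0, \<delta>] excludes lattice behaviour and drives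
  the backward propagation of small deviations; the upper bound \<open>H\<close> limits the mass
  near 0, so that at least half of the kernel lies beyond a fixed length. Extension by zero to the
  left makes convolutions over the whole line causal.\<close>

locale renewal_kernel =
  fixes h :: "real \<Rightarrow> real" and c \<delta> H m :: real
  assumes h_meas[measurable]: "h \<in> borel_measurable borel"
    and h_nonneg: "\<And>x. 0 \<le> h x"
    and h_zero: "\<And>x. x \<le> 0 \<Longrightarrow> h x = 0"
    and h_mass: "(\<integral>\<^sup>+x. ennreal (h x) \<partial>lborel) = 1"
    and c_pos: "0 < c" and \<delta>_pos: "0 < \<delta>"
    and h_lower: "\<And>x. 0 < x \<Longrightarrow> x \<le> \<delta> \<Longrightarrow> c \<le> h x"
    and h_upper: "\<And>x. h x \<le> H"
    and h_moment: "(\<integral>\<^sup>+x. ennreal (x * h x) \<partial>lborel) = ennreal m" and m_nonneg: "0 \<le> m"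
begin

section \<open>Tail of the kernel and conservation of work\<close>

definition tail :: "real \<Rightarrow> real" where
  "tail x = enn2real (\<integral>\<^sup>+y. ennreal (h y) * indicator {x<..} y \<partial>lborel)"

lemma h_integrable: "integrable lborel h" and h_integral: "(LINT x|lborel. h x) = 1"
proof -
  show "integrable lborel h"
    using h_mass by (intro integrableI_nn_integral_finite[where x=1]) (auto simp: h_nonneg)
  show "(LINT x|lborel. h x) = 1"
    by (subst integral_eq_nn_integral) (auto simp: h_mass h_nonneg)
qed

lemma ennreal_tail: "ennreal (tail x) = (\<integral>\<^sup>+y. ennreal (h y) * indicator {x<..} y \<partial>lborel)"
proof -
  have "(\<integral>\<^sup>+y. ennreal (h y) * indicator {x<..} y \<partial>lborel) \<le> (\<integral>\<^sup>+y. ennreal (h y) \<partial>lborel)"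
    by (intro nn_integral_mono) (auto split: split_indicator)
  then show ?thesis unfolding tail_def h_mass
    by (intro ennreal_enn2real) (auto simp: less_top[symmetric] top_unique)
qed

lemma tail_nonneg: "0 \<le> tail x" by (simp add: tail_def)

lemma tail_le_1: "tail x \<le> 1"
proof -
  have "ennreal (tail x) \<le> (\<integral>\<^sup>+y. ennreal (h y) \<partial>lborel)" unfolding ennreal_tail
    by (intro nn_integral_mono) (auto split: split_indicator)
  then show ?thesis by (simp add: h_mass ennreal_le_1)
qed

lemma tail_antimono: "x \<le> y \<Longrightarrow> tail y \<le> tail x"
proof -
  assume "x \<le> y"
  then have "ennreal (tail y) \<le> ennreal (tail x)" unfolding ennreal_tail
    by (intro nn_integral_mono) (auto split: split_indicator)
  then show ?thesis by (simp add: tail_nonneg)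
qed

lemma tail_meas[measurable]: "tail \<in> borel_measurable borel"
proof -
  have "mono (\<lambda>x. - tail x)" by (auto intro!: monoI tail_antimono)
  then have "(\<lambda>x. - (- tail x)) \<in> borel_measurable borel"
    by (intro borel_measurable_uminus borel_measurable_mono)
  then show ?thesis by simp
qed

lemma ennreal_one_minus_tail:
  "ennreal (1 - tail x) = (\<integral>\<^sup>+y. ennreal (h y) * indicator {..x} y \<partial>lborel)"
proof -
  have "1 = (\<integral>\<^sup>+y. ennreal (h y) * indicator {..x} y + ennreal (h y) * indicator {x<..} y \<partial>lborel)"
    unfolding h_mass[symmetric] by (intro nn_integral_cong) (auto split: split_indicator)
  also have "\<dots> = (\<integral>\<^sup>+y. ennreal (h y) * indicator {..x} y \<partial>lborel) + ennreal (tail x)"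
    unfolding ennreal_tail by (intro nn_integral_add) auto
  finally have "(\<integral>\<^sup>+y. ennreal (h y) * indicator {..x} y \<partial>lborel) = 1 - ennreal (tail x)"
    by (metis ennreal_add_diff_cancel_right ennreal_neq_top)
  then show ?thesis by (simp add: ennreal_minus tail_nonneg flip: ennreal_1)
qed

lemma H_pos: "0 < H"
  using c_pos \<delta>_pos h_lower[of \<delta>] h_upper[of \<delta>] by linarith

lemma one_minus_tail_le: "0 \<le> x \<Longrightarrow> 1 - tail x \<le> H * x"
proof -
  assume x: "0 \<le> x"
  have "ennreal (1 - tail x) \<le> (\<integral>\<^sup>+y. ennreal H * indicator {0..x} y \<partial>lborel)"
    unfolding ennreal_one_minus_tail
    by (intro nn_integral_mono) (auto split: split_indicator intro!: ennreal_leI h_upper simp: h_zero)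
  also have "\<dots> = ennreal (H * x)" using x H_pos by (simp add: nn_integral_cmult ennreal_mult)
  finally show ?thesis using x H_pos by (simp add: ennreal_le_iff)
qed

lemma tail_markov: "x * tail x \<le> m" if "0 \<le> x"
proof -
  have "ennreal (x * tail x) = (\<integral>\<^sup>+y. ennreal x * (ennreal (h y) * indicator {x<..} y) \<partial>lborel)"
    using that by (simp add: ennreal_mult tail_nonneg ennreal_tail nn_integral_cmult)
  also have "\<dots> \<le> (\<integral>\<^sup>+y. ennreal (y * h y) \<partial>lborel)"
    using that h_nonneg by (intro nn_integral_mono)
      (auto split: split_indicator simp: ennreal_mult[symmetric] intro!: ennreal_leI mult_right_mono)
  finally show ?thesis unfolding h_moment by (simp add: m_nonneg)
qed

text \<open>\<open>tail\<close> equals 1 on the negative half line; after the cut it is integrable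
  with integral \<open>m\<close>, so that \<open>tailp x / m\<close> is the stationary excess
  density of the kernel.\<close>

definition tailp :: "real \<Rightarrow> real" where "tailp x = tail x * indicator {0<..} x"

lemma tailp_meas[measurable]: "tailp \<in> borel_measurable borel" unfolding tailp_def by measurable

lemma tailp_bounds: "0 \<le> tailp x" "tailp x \<le> 1"
  by (simp_all add: tailp_def tail_nonneg tail_le_1 indicator_def)

lemma tailp_mass: "(\<integral>\<^sup>+x. ennreal (tailp x) \<partial>lborel) = ennreal m"
proof -
  have "(\<integral>\<^sup>+x. ennreal (tailp x) \<partial>lborel)
      = (\<integral>\<^sup>+x. \<integral>\<^sup>+y. ennreal (h y) * indicator {x<..} y * indicator {0<..} x \<partial>lborel \<partial>lborel)"
    unfolding tailp_def
    by (intro nn_integral_cong) (auto simp: ennreal_tail split: split_indicator)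
  also have "\<dots> = (\<integral>\<^sup>+y. \<integral>\<^sup>+x. ennreal (h y) * indicator {x<..} y * indicator {0<..} x \<partial>lborel \<partial>lborel)"
    by (rule lborel_pair.Fubini') (simp add: split_beta' indicator_def of_bool_def)
  also have "\<dots> = (\<integral>\<^sup>+y. ennreal (y * h y) \<partial>lborel)"
  proof (intro nn_integral_cong)
    fix y :: real
    have "(\<integral>\<^sup>+x. ennreal (h y) * indicator {x<..} y * indicator {0<..} x \<partial>lborel)
        = (\<integral>\<^sup>+x. ennreal (h y) * indicator {0<..<y} x \<partial>lborel)"
      by (intro nn_integral_cong) (auto split: split_indicator)
    also have "\<dots> = ennreal (y * h y)"
      using h_zero[of y] h_nonneg[of y] by (cases "0 \<le> y") (auto simp: nn_integral_cmult ennreal_mult[symmetric] mult.commute)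
    finally show "(\<integral>\<^sup>+x. ennreal (h y) * indicator {x<..} y * indicator {0<..} x \<partial>lborel) = ennreal (y * h y)" .
  qed
  finally show ?thesis by (simp add: h_moment)
qed

lemma tailp_integrable: "integrable lborel tailp" and tailp_integral: "(LINT x|lborel. tailp x) = m"
proof -
  show "integrable lborel tailp"
    using tailp_mass by (intro integrableI_nn_integral_finite[where x=m]) (auto simp: tailp_bounds m_nonneg)
  show "(LINT x|lborel. tailp x) = m"
    by (subst integral_eq_nn_integral) (auto simp: tailp_mass tailp_bounds m_nonneg)
qed

lemma m_pos: "0 < m"
proof -
  have "ennreal (c * (\<delta> / 2) * (\<delta> / 2)) = (\<integral>\<^sup>+x. ennreal (c * (\<delta> / 2)) * indicator {\<delta> / 2..\<delta>} x \<partial>lborel)"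
    using c_pos \<delta>_pos by (simp add: nn_integral_cmult flip: ennreal_mult)
  also have "\<dots> \<le> (\<integral>\<^sup>+x. ennreal (x * h x) \<partial>lborel)"
  proof (intro nn_integral_mono)
    fix x :: real
    have "c * (\<delta> / 2) \<le> x * h x" if "x \<in> {\<delta> / 2..\<delta>}"
      using mult_mono[of "\<delta> / 2" x c "h x"] h_lower[of x] that \<delta>_pos c_pos by (simp add: mult.commute)
    then show "ennreal (c * (\<delta> / 2)) * indicator {\<delta> / 2..\<delta>} x \<le> ennreal (x * h x)"
      by (auto split: split_indicator intro!: ennreal_leI)
  qed
  finally have "c * (\<delta> / 2) * (\<delta> / 2) \<le> m" unfolding h_moment using m_nonneg by simp
  moreover have "0 < c * (\<delta> / 2) * (\<delta> / 2)" using c_pos \<delta>_pos by simp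
  ultimately show ?thesis by linarith
qed

text \<open>Integrating the renewal equation up to \<open>u\<close> and exchanging the integrals
  puts the weight \<open>1 - tail (u - v)\<close> on \<open>Z\<close>; subtracting this from the
  integral of \<open>Z\<close> leaves the weight \<open>tail (u - v)\<close>. In queueing terms it
  is conservation of work. \<open>fin\<close> is what permits the subtraction in
  \<open>ennreal\<close>.\<close>

lemma tail_conservation:
  assumes [measurable]: "Z \<in> borel_measurable borel" "g \<in> borel_measurable borel"
    and Z: "\<And>v. 0 \<le> Z v"
    and fin: "(\<integral>\<^sup>+v\<in>{..u}. ennreal (Z v) \<partial>lborel) < \<infinity>"
    and eq: "\<And>v. v \<le> u \<Longrightarrow> ennreal (Z v) = ennreal (g v) + (\<integral>\<^sup>+x. ennreal (h (v - x) * Z x) \<partial>lborel)"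
  shows "(\<integral>\<^sup>+v\<in>{..u}. ennreal (tail (u - v) * Z v) \<partial>lborel) = (\<integral>\<^sup>+v\<in>{..u}. ennreal (g v) \<partial>lborel)"
proof -
  let ?B = "\<integral>\<^sup>+v\<in>{..u}. ennreal ((1 - tail (u - v)) * Z v) \<partial>lborel"
  have "(\<integral>\<^sup>+v\<in>{..u}. ennreal (Z v) \<partial>lborel)
      = (\<integral>\<^sup>+v. ennreal (g v) * indicator {..u} v
          + (\<integral>\<^sup>+x. ennreal (h (v - x) * Z x) * indicator {..u} v \<partial>lborel) \<partial>lborel)"
    by (intro nn_integral_cong) (auto simp: eq split: split_indicator)
  also have "\<dots> = (\<integral>\<^sup>+v\<in>{..u}. ennreal (g v) \<partial>lborel)
      + (\<integral>\<^sup>+v. \<integral>\<^sup>+x. ennreal (h (v - x) * Z x) * indicator {..u} v \<partial>lborel \<partial>lborel)"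
    by (intro nn_integral_add) measurable
  also have "(\<integral>\<^sup>+v. \<integral>\<^sup>+x. ennreal (h (v - x) * Z x) * indicator {..u} v \<partial>lborel \<partial>lborel)
      = (\<integral>\<^sup>+x. \<integral>\<^sup>+v. ennreal (h (v - x) * Z x) * indicator {..u} v \<partial>lborel \<partial>lborel)"
    by (rule lborel_pair.Fubini') simp
  also have "\<dots> = ?B"
  proof (intro nn_integral_cong)
    fix x :: real
    have "(\<integral>\<^sup>+v. ennreal (h (v - x) * Z x) * indicator {..u} v \<partial>lborel)
        = (\<integral>\<^sup>+v. ennreal (Z x) * (ennreal (h (v - x)) * indicator {..u - x} (v - x)) \<partial>lborel)"
      using h_nonneg Z by (intro nn_integral_cong) (auto simp: ennreal_mult mult.commute split: split_indicator)
    also have "\<dots> = ennreal (Z x) * (\<integral>\<^sup>+v. (ennreal (h (v - x)) * indicator {..u - x} (v - x)) \<partial>lborel)"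
      by (intro nn_integral_cmult) measurable
    also have "(\<integral>\<^sup>+v. (ennreal (h (v - x)) * indicator {..u - x} (v - x)) \<partial>lborel) = ennreal (1 - tail (u - x))"
      unfolding ennreal_one_minus_tail
      by (rule nn_integral_lborel_shift[of "\<lambda>v. ennreal (h v) * indicator {..u - x} v"]) measurable
    finally have *: "(\<integral>\<^sup>+v. ennreal (h (v - x) * Z x) * indicator {..u} v \<partial>lborel) = ennreal ((1 - tail (u - x)) * Z x)"
      using Z tail_le_1 by (simp add: ennreal_mult mult.commute)
    \<comment> \<open>Beyond \<open>u\<close> the weight is not positive and \<open>ennreal\<close>
      sends it to 0, so the indicator of \<open>{..u}\<close> may be added.\<close>
    have "1 - tail (u - x) \<le> 0" if "u < x"
    proof -
      have "ennreal (1 - tail (u - x)) = (\<integral>\<^sup>+y. 0 \<partial>(lborel :: real measure))"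
        unfolding ennreal_one_minus_tail using that
        by (intro nn_integral_cong) (auto simp: h_zero split: split_indicator)
      then show ?thesis by (simp add: ennreal_eq_0_iff)
    qed
    then have "(1 - tail (u - x)) * Z x \<le> 0" if "u < x"
      using that Z mult_nonpos_nonneg by blast
    then show "(\<integral>\<^sup>+v. ennreal (h (v - x) * Z x) * indicator {..u} v \<partial>lborel)
        = ennreal ((1 - tail (u - x)) * Z x) * indicator {..u} x"
      unfolding * by (auto split: split_indicator simp: ennreal_neg)
  qed
  finally have 1: "(\<integral>\<^sup>+v\<in>{..u}. ennreal (Z v) \<partial>lborel) = (\<integral>\<^sup>+v\<in>{..u}. ennreal (g v) \<partial>lborel) + ?B" .
  have "(\<integral>\<^sup>+v\<in>{..u}. ennreal (Z v) \<partial>lborel)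
     = (\<integral>\<^sup>+v. ennreal (tail (u - v) * Z v) * indicator {..u} v
          + ennreal ((1 - tail (u - v)) * Z v) * indicator {..u} v \<partial>lborel)"
  proof (intro nn_integral_cong)
    fix v
    have "ennreal (Z v) = ennreal (tail (u - v) * Z v + (1 - tail (u - v)) * Z v)" by (simp add: algebra_simps)
    also have "\<dots> = ennreal (tail (u - v) * Z v) + ennreal ((1 - tail (u - v)) * Z v)"
      using Z tail_nonneg tail_le_1 by (intro ennreal_plus) auto
    finally show "ennreal (Z v) * indicator {..u} v = ennreal (tail (u - v) * Z v) * indicator {..u} v
          + ennreal ((1 - tail (u - v)) * Z v) * indicator {..u} v"
      by (simp only: distrib_right)
  qed
  also have "\<dots> = (\<integral>\<^sup>+v\<in>{..u}. ennreal (tail (u - v) * Z v) \<partial>lborel) + ?B"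
    by (intro nn_integral_add) measurable
  finally have 2: "(\<integral>\<^sup>+v\<in>{..u}. ennreal (Z v) \<partial>lborel) = (\<integral>\<^sup>+v\<in>{..u}. ennreal (tail (u - v) * Z v) \<partial>lborel) + ?B" .
  have "?B \<noteq> top_class.top" using fin 1 by (metis add_top ennreal_add_eq_top infinity_ennreal_def less_irrefl)
  moreover have "?B + (\<integral>\<^sup>+v\<in>{..u}. ennreal (tail (u - v) * Z v) \<partial>lborel) = ?B + (\<integral>\<^sup>+v\<in>{..u}. ennreal (g v) \<partial>lborel)"
    unfolding add.commute[of ?B] 1[symmetric] 2[symmetric] ..
  ultimately show ?thesis unfolding ennreal_add_left_cancel infinity_ennreal_def by blast
qed

section \<open>A bound on solutions that is free of the horizon\<close>

definition window :: real where "window = 1 / (2 * H)"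

lemma window_pos: "0 < window" using H_pos by (simp add: window_def)

lemma tail_window: "x \<le> window \<Longrightarrow> 1 / 2 \<le> tail x"
proof -
  assume "x \<le> window"
  then have "tail window \<le> tail x" by (rule tail_antimono)
  moreover have "1 - tail window \<le> H * window" using window_pos by (intro one_minus_tail_le) simp
  moreover have "H * window = 1 / 2" using H_pos by (simp add: window_def)
  ultimately show ?thesis by linarith
qed

text \<open>On a window of length \<open>1 / (2 * H)\<close> behind \<open>u\<close> the tail is
  still at least 1/2, so the conserved work bounds the integral of \<open>Z\<close> there by
  \<open>2 * W\<close>; consecutive windows add up. The equation is asked only up to
  \<open>U\<close>, since a fluid path provides it at first only on the range of its clock.\<close>

lemma window_integral_le:
  assumes [measurable]: "Z \<in> borel_measurable borel" "g \<in> borel_measurable borel"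
    and Z: "\<And>v. 0 \<le> Z v"
    and fin: "(\<integral>\<^sup>+v\<in>{..U}. ennreal (Z v) \<partial>lborel) < \<infinity>"
    and eq: "\<And>v. v \<le> U \<Longrightarrow> ennreal (Z v) = ennreal (g v) + (\<integral>\<^sup>+x. ennreal (h (v - x) * Z x) \<partial>lborel)"
    and W: "(\<integral>\<^sup>+v. ennreal (g v) \<partial>lborel) \<le> ennreal W" "0 \<le> W" and u: "u \<le> U"
  shows "(\<integral>\<^sup>+v\<in>{u - real n * window<..u}. ennreal (Z v) \<partial>lborel) \<le> ennreal (real n * (2 * W))"
  using u
proof (induction n arbitrary: u)
  case (Suc n)
  have "(\<integral>\<^sup>+v\<in>{..u}. ennreal (Z v) \<partial>lborel) \<le> (\<integral>\<^sup>+v\<in>{..U}. ennreal (Z v) \<partial>lborel)"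
    using Suc.prems by (intro nn_integral_mono) (auto split: split_indicator)
  then have fin': "(\<integral>\<^sup>+v\<in>{..u}. ennreal (Z v) \<partial>lborel) < \<infinity>" using fin by order
  have "(\<integral>\<^sup>+v\<in>{u - window<..u}. ennreal (Z v) \<partial>lborel)
      \<le> (\<integral>\<^sup>+v. ennreal 2 * (ennreal (tail (u - v) * Z v) * indicator {..u} v) \<partial>lborel)"
  proof (intro nn_integral_mono)
    fix v
    have "Z v \<le> 2 * (tail (u - v) * Z v)" if "u - window < v" "v \<le> u"
      using mult_right_mono[OF tail_window[of "u - v"] Z[of v]] that by simp
    then show "ennreal (Z v) * indicator {u - window<..u} v \<le> ennreal 2 * (ennreal (tail (u - v) * Z v) * indicator {..u} v)"
      using Z tail_nonneg by (auto split: split_indicator simp: ennreal_mult[symmetric] simp del: ennreal_numeral intro!: ennreal_leI)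
  qed
  also have "\<dots> = ennreal 2 * (\<integral>\<^sup>+v\<in>{..u}. ennreal (g v) \<partial>lborel)"
    using Suc.prems by (subst nn_integral_cmult) (auto simp: tail_conservation[OF _ _ Z fin' eq])
  also have "\<dots> \<le> ennreal 2 * ennreal W"
    by (intro mult_left_mono order_trans[OF nn_integral_mono W(1)]) (auto split: split_indicator)
  also have "\<dots> = ennreal (2 * W)" using W by (simp add: ennreal_mult)
  finally have first: "(\<integral>\<^sup>+v\<in>{u - window<..u}. ennreal (Z v) \<partial>lborel) \<le> ennreal (2 * W)" .
  have second: "(\<integral>\<^sup>+v\<in>{u - window - real n * window<..u - window}. ennreal (Z v) \<partial>lborel) \<le> ennreal (real n * (2 * W))"
    using Suc.prems window_pos by (intro Suc.IH) simp
  have "(\<integral>\<^sup>+v\<in>{u - real (Suc n) * window<..u}. ennreal (Z v) \<partial>lborel)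
     \<le> (\<integral>\<^sup>+v. ennreal (Z v) * indicator {u - window<..u} v
          + ennreal (Z v) * indicator {u - window - real n * window<..u - window} v \<partial>lborel)"
    by (intro nn_integral_mono) (auto split: split_indicator simp: algebra_simps)
  also have "\<dots> = (\<integral>\<^sup>+v\<in>{u - window<..u}. ennreal (Z v) \<partial>lborel)
     + (\<integral>\<^sup>+v\<in>{u - window - real n * window<..u - window}. ennreal (Z v) \<partial>lborel)"
    by (intro nn_integral_add) auto
  also have "\<dots> \<le> ennreal (2 * W) + ennreal (real n * (2 * W))" by (intro add_mono first second)
  also have "\<dots> = ennreal (2 * W + real n * (2 * W))" using W by (intro ennreal_plus[symmetric]) auto
  finally show ?case by (simp add: algebra_simps)
qed simp

definition sol_bound :: "real \<Rightarrow> real \<Rightarrow> real" where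
  "sol_bound C W = 2 * (C + H * (real (Suc (nat \<lceil>(2 * m + 1) / window\<rceil>)) * (2 * W)))"

lemma solution_le_sol_bound:
  assumes Zm[measurable]: "Z \<in> borel_measurable borel" "g \<in> borel_measurable borel"
    and Z: "\<And>v. 0 \<le> Z v" "\<And>v. v < 0 \<Longrightarrow> Z v = 0"
    and bdd: "\<And>v. v \<le> U \<Longrightarrow> Z v \<le> B"
    and eq: "\<And>v. v \<le> U \<Longrightarrow> ennreal (Z v) = ennreal (g v) + (\<integral>\<^sup>+x. ennreal (h (v - x) * Z x) \<partial>lborel)"
    and W: "(\<integral>\<^sup>+v. ennreal (g v) \<partial>lborel) \<le> ennreal W" "0 \<le> W"
    and g: "\<And>v. v \<le> U \<Longrightarrow> g v \<le> C" and C: "0 \<le> C" and u: "u \<le> U"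
  shows "Z u \<le> sol_bound C W"
proof -
  define s where "s = Sup (Z ` {..U})"
  have bddZ: "bdd_above (Z ` {..U})" using bdd by (intro bdd_aboveI2[of _ _ B]) auto
  have s: "Z v \<le> s" if "v \<le> U" for v
    unfolding s_def using that by (intro cSup_upper bddZ) auto
  have s0: "0 \<le> s" using s[OF u] Z(1)[of u] by linarith
  have "(\<integral>\<^sup>+v\<in>{..U}. ennreal (Z v) \<partial>lborel) \<le> (\<integral>\<^sup>+v. ennreal s * indicator {0..U} v \<partial>lborel)"
    using s Z(2) by (intro nn_integral_mono) (auto split: split_indicator intro!: ennreal_leI simp: not_le)
  also have "\<dots> < \<infinity>" by (simp add: nn_integral_cmult emeasure_lborel_Icc_eq ennreal_mult_less_top)
  finally have fin: "(\<integral>\<^sup>+v\<in>{..U}. ennreal (Z v) \<partial>lborel) < \<infinity>" .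
  \<comment> \<open>Markov's inequality gives \<open>tail L \<le> m / L\<close>, which is below 1/2
    for this length; \<open>n\<close> windows cover it.\<close>
  define L where "L = 2 * m + 1"
  define n where "n = Suc (nat \<lceil>L / window\<rceil>)"
  have L: "0 < L" using m_nonneg by (simp add: L_def)
  have nL: "L < real n * window"
    using window_pos real_nat_ceiling_ge[of "L / window"] by (simp add: n_def field_simps)
  have tL: "tail L \<le> 1 / 2"
  proof -
    have "L * tail L \<le> L * (1 / 2)" using tail_markov[OF less_imp_le[OF L]] by (simp add: L_def)
    then show ?thesis using L mult_le_cancel_left_pos by blast
  qed
  have le: "Z u \<le> C + H * (real n * (2 * W)) + s / 2" if u: "u \<le> U" for u
  proof -
    have "(\<integral>\<^sup>+x. ennreal (h (u - x) * Z x) \<partial>lborel)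
        \<le> (\<integral>\<^sup>+x. ennreal H * (ennreal (Z x) * indicator {u - real n * window<..u} x)
              + ennreal s * (ennreal (h (u - x)) * indicator {L<..} (u - x)) \<partial>lborel)"
    proof (intro nn_integral_mono)
      fix x
      consider "u < x" | "x \<le> u" "u - real n * window < x" | "x \<le> u - real n * window" by linarith
      then show "ennreal (h (u - x) * Z x) \<le> ennreal H * (ennreal (Z x) * indicator {u - real n * window<..u} x)
              + ennreal s * (ennreal (h (u - x)) * indicator {L<..} (u - x))"
      proof cases
        case 1
        then show ?thesis by (simp add: h_zero)
      next
        case 2
        have "h (u - x) * Z x \<le> H * Z x" using Z h_upper by (intro mult_right_mono) auto
        then have "ennreal (h (u - x) * Z x) \<le> ennreal H * ennreal (Z x)"
          using Z H_pos by (simp add: ennreal_leI flip: ennreal_mult)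
        with 2 show ?thesis by (auto intro: add_increasing2)
      next
        case 3
        then have xu: "x \<le> u" "L < u - x" using nL L by linarith+
        have "h (u - x) * Z x \<le> s * h (u - x)"
          using s[of x] xu u h_nonneg[of "u - x"] by (simp add: mult.commute[of _ "Z x"] mult_right_mono)
        then have "ennreal (h (u - x) * Z x) \<le> ennreal s * ennreal (h (u - x))"
          using s0 h_nonneg by (simp add: ennreal_leI flip: ennreal_mult)
        with xu show ?thesis by (auto intro: add_increasing)
      qed
    qed
    also have "\<dots> = ennreal H * (\<integral>\<^sup>+x\<in>{u - real n * window<..u}. ennreal (Z x) \<partial>lborel)
        + ennreal s * (\<integral>\<^sup>+x. ennreal (h (u - x)) * indicator {L<..} (u - x) \<partial>lborel)"
      by (subst nn_integral_add) (auto simp: nn_integral_cmult)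
    also have "(\<integral>\<^sup>+x. ennreal (h (u - x)) * indicator {L<..} (u - x) \<partial>lborel) = ennreal (tail L)"
      unfolding ennreal_tail
      by (rule nn_integral_lborel_reflect[of "\<lambda>y. ennreal (h y) * indicator {L<..} y"]) measurable
    also have "ennreal H * (\<integral>\<^sup>+x\<in>{u - real n * window<..u}. ennreal (Z x) \<partial>lborel) + ennreal s * ennreal (tail L)
        \<le> ennreal H * ennreal (real n * (2 * W)) + ennreal s * ennreal (1 / 2)"
      using window_integral_le[OF Zm Z(1) fin eq W u] tL
      by (intro add_mono mult_left_mono ennreal_leI) auto
    also have "\<dots> = ennreal (H * (real n * (2 * W)) + s * (1 / 2))"
    proof -
      have "ennreal H * ennreal (real n * (2 * W)) = ennreal (H * (real n * (2 * W)))"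
        using H_pos W by (intro ennreal_mult[symmetric]) auto
      moreover have "ennreal s * ennreal (1 / 2) = ennreal (s * (1 / 2))"
        using s0 by (intro ennreal_mult[symmetric]) auto
      moreover have "ennreal (H * (real n * (2 * W)) + s * (1 / 2)) = ennreal (H * (real n * (2 * W))) + ennreal (s * (1 / 2))"
        using H_pos W s0 by (intro ennreal_plus) auto
      ultimately show ?thesis by (simp only:)
    qed
    finally have "ennreal (Z u) \<le> ennreal C + ennreal (H * (real n * (2 * W)) + s * (1 / 2))"
      unfolding eq[OF u] using g[OF u] by (intro add_mono ennreal_leI) auto
    also have "\<dots> = ennreal (C + (H * (real n * (2 * W)) + s * (1 / 2)))"
      using H_pos W s0 C by (intro ennreal_plus[symmetric]) auto
    finally show ?thesis
      using H_pos W s0 C by (subst (asm) ennreal_le_iff) auto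
  qed
  have "s \<le> C + H * (real n * (2 * W)) + s / 2"
    by (subst s_def, rule cSup_least) (use le u in auto)
  then have "s \<le> sol_bound C W" by (simp add: sol_bound_def n_def L_def)
  then show ?thesis using s[OF u] by linarith
qed

text \<open>The two signs of \<open>\<sigma>\<close> split convergence into two one-sided bounds,
  each governed by one asymptotic supremum \<open>M\<close> over all members and late times. Were
  \<open>M\<close> positive, the deviation of some member would be near \<open>M\<close> on average
  over a long window, and its integral against \<open>tailp\<close>, which conservation of work
  forces to be small, would be near \<open>M * m\<close>.\<close>

lemma deviation_eventually_le:
  fixes Z g :: "'i \<Rightarrow> real \<Rightarrow> real" and W :: "'i \<Rightarrow> real" and \<sigma> :: real
  assumes Zm[measurable]: "\<And>i. i \<in> I \<Longrightarrow> Z i \<in> borel_measurable borel"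
    and gm[measurable]: "\<And>i. i \<in> I \<Longrightarrow> g i \<in> borel_measurable borel"
    and Z: "\<And>i v. i \<in> I \<Longrightarrow> 0 \<le> Z i v" "\<And>i v. i \<in> I \<Longrightarrow> Z i v \<le> B" "\<And>i v. i \<in> I \<Longrightarrow> v < 0 \<Longrightarrow> Z i v = 0"
    and g: "\<And>i v. i \<in> I \<Longrightarrow> 0 \<le> g i v"
    and eq: "\<And>i v. i \<in> I \<Longrightarrow> ennreal (Z i v) = ennreal (g i v) + (\<integral>\<^sup>+x. ennreal (h (v - x) * Z i x) \<partial>lborel)"
    and W: "\<And>i. i \<in> I \<Longrightarrow> (\<integral>\<^sup>+v. ennreal (g i v) \<partial>lborel) = ennreal (W i)" "\<And>i. i \<in> I \<Longrightarrow> 0 \<le> W i"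
      "\<And>i. i \<in> I \<Longrightarrow> W i \<le> Wb"
    and g_small: "\<And>e. 0 < e \<Longrightarrow> \<exists>T. \<forall>i\<in>I. \<forall>u\<ge>T. g i u \<le> e"
    and g_tail: "\<And>e. 0 < e \<Longrightarrow> \<exists>T. \<forall>i\<in>I. \<forall>u\<ge>T. (\<integral>\<^sup>+v\<in>{u<..}. ennreal (g i v) \<partial>lborel) \<le> ennreal e"
    and \<sigma>: "\<bar>\<sigma>\<bar> = 1" and e: "0 < e"
  shows "\<exists>T. \<forall>i\<in>I. \<forall>u\<ge>T. \<sigma> * (Z i u - W i / m) \<le> e"
proof (cases "I = {}")
  case False
  define y where "y i u = Z i u - W i / m" for i u
  define B' where "B' = B + Wb / m"
  have ym[measurable]: "y i \<in> borel_measurable borel" if "i \<in> I" for i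
    unfolding y_def using that by measurable
  have yb: "\<bar>\<sigma> * y i u\<bar> \<le> B'" if "i \<in> I" for i u
  proof -
    have "0 \<le> W i / m" "W i / m \<le> Wb / m" using W that m_pos by (auto simp: divide_right_mono)
    then show ?thesis
      using Z(1,2)[OF that, of u] by (simp add: abs_mult \<sigma> y_def B'_def)
  qed
  have B'0: "0 \<le> B'" using yb False by (meson abs_ge_zero all_not_in_conv order_trans)
  have int_hy: "integrable lborel (\<lambda>x. h x * f (u - x))"
    if [measurable]: "f \<in> borel_measurable borel" and "\<And>x. \<bar>f x\<bar> \<le> C" for f u C
    by (rule Bochner_Integration.integrable_bound[of lborel "\<lambda>x. C * h x"])
       (use that h_nonneg in \<open>auto simp: h_integrable abs_mult mult.commute[of "h _"] intro!: mult_right_mono order_trans[OF _ abs_ge_self] AE_I2\<close>)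
  have int_ty: "integrable lborel (\<lambda>x. tailp x * f (u - x))"
    if [measurable]: "f \<in> borel_measurable borel" and "\<And>x. \<bar>f x\<bar> \<le> C" for f u C
    by (rule Bochner_Integration.integrable_bound[of lborel "\<lambda>x. C * tailp x"])
       (use that tailp_bounds in \<open>auto simp: tailp_integrable abs_mult mult.commute[of "tailp _"] intro!: mult_right_mono order_trans[OF _ abs_ge_self] AE_I2\<close>)
  have Zeq: "Z i u = g i u + (LINT x|lborel. h x * Z i (u - x))" if i: "i \<in> I" for i u
  proof -
    note [measurable] = Zm[OF i]
    have int: "integrable lborel (\<lambda>x. h x * Z i (u - x))"
      using Z i by (intro int_hy[where C=B]) auto
    have "(\<integral>\<^sup>+x. ennreal (h (u - x) * Z i x) \<partial>lborel) = (\<integral>\<^sup>+x. ennreal (h (u - (u - x)) * Z i (u - x)) \<partial>lborel)"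
      by (rule nn_integral_lborel_reflect[of "\<lambda>x. ennreal (h (u - x) * Z i x)", symmetric]) measurable
    also have "\<dots> = ennreal (LINT x|lborel. h x * Z i (u - x))"
      using int Z(1)[OF i] h_nonneg by (subst nn_integral_eq_integral) auto
    finally have "ennreal (Z i u) = ennreal (g i u + (LINT x|lborel. h x * Z i (u - x)))"
      unfolding eq[OF i, of u] using g[OF i] Z(1)[OF i] h_nonneg by (simp add: ennreal_plus integral_nonneg_AE)
    then show ?thesis
      using g[OF i] Z(1)[OF i] h_nonneg by (subst (asm) ennreal_inj) (auto intro!: add_nonneg_nonneg integral_nonneg_AE)
  qed
  have cons: "(LINT x|lborel. tailp x * Z i (u - x)) + enn2real (\<integral>\<^sup>+v\<in>{u<..}. ennreal (g i v) \<partial>lborel) = W i"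
    if i: "i \<in> I" and u: "0 \<le> u" for i u
  proof -
    note [measurable] = Zm[OF i] gm[OF i]
    have "(\<integral>\<^sup>+v\<in>{..u}. ennreal (Z i v) \<partial>lborel) \<le> (\<integral>\<^sup>+v. ennreal B * indicator {0..u} v \<partial>lborel)"
      using Z i by (intro nn_integral_mono) (auto split: split_indicator intro!: ennreal_leI simp: not_le)
    also have "\<dots> < \<infinity>" by (simp add: nn_integral_cmult emeasure_lborel_Icc_eq ennreal_mult_less_top)
    finally have fin: "(\<integral>\<^sup>+v\<in>{..u}. ennreal (Z i v) \<partial>lborel) < \<infinity>" .
    have int: "integrable lborel (\<lambda>x. tailp x * Z i (u - x))"
      using Z i by (intro int_ty[where C=B]) auto
    have "ennreal (LINT x|lborel. tailp x * Z i (u - x)) = (\<integral>\<^sup>+x. ennreal (tailp x * Z i (u - x)) \<partial>lborel)"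
      using int Z(1)[OF i] tailp_bounds by (subst nn_integral_eq_integral) auto
    also have "\<dots> = (\<integral>\<^sup>+x. ennreal (tailp (u - x) * Z i (u - (u - x))) \<partial>lborel)"
      by (rule nn_integral_lborel_reflect[of "\<lambda>x. ennreal (tailp x * Z i (u - x))", symmetric]) measurable
    also have "\<dots> = (\<integral>\<^sup>+v\<in>{..u}. ennreal (tail (u - v) * Z i v) \<partial>lborel)"
    proof (intro nn_integral_cong_AE)
      show "AE v in lborel. ennreal (tailp (u - v) * Z i (u - (u - v))) = ennreal (tail (u - v) * Z i v) * indicator {..u} v"
        using AE_lborel_singleton[of u] by eventually_elim (auto simp: tailp_def split: split_indicator)
    qed
    also have "\<dots> = (\<integral>\<^sup>+v\<in>{..u}. ennreal (g i v) \<partial>lborel)"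
      by (rule tail_conservation[OF _ _ Z(1)[OF i] fin eq[OF i]]) auto
    finally have 1: "ennreal (LINT x|lborel. tailp x * Z i (u - x)) = (\<integral>\<^sup>+v\<in>{..u}. ennreal (g i v) \<partial>lborel)" .
    have "(\<integral>\<^sup>+v\<in>{..u}. ennreal (g i v) \<partial>lborel) + (\<integral>\<^sup>+v\<in>{u<..}. ennreal (g i v) \<partial>lborel)
        = (\<integral>\<^sup>+v. ennreal (g i v) * indicator {..u} v + ennreal (g i v) * indicator {u<..} v \<partial>lborel)"
      by (intro nn_integral_add[symmetric]) auto
    also have "\<dots> = ennreal (W i)"
      unfolding W(1)[OF i, symmetric] by (intro nn_integral_cong) (auto split: split_indicator)
    finally have 2: "(\<integral>\<^sup>+v\<in>{..u}. ennreal (g i v) \<partial>lborel) + (\<integral>\<^sup>+v\<in>{u<..}. ennreal (g i v) \<partial>lborel) = ennreal (W i)" .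
    have "(\<integral>\<^sup>+v\<in>{u<..}. ennreal (g i v) \<partial>lborel) \<le> ennreal (W i)"
      unfolding 2[symmetric] by (rule add_increasing) auto
    then have "(\<integral>\<^sup>+v\<in>{u<..}. ennreal (g i v) \<partial>lborel) \<noteq> top_class.top"
      by (rule neq_top_trans[rotated]) simp
    then obtain r where r: "0 \<le> r" "(\<integral>\<^sup>+v\<in>{u<..}. ennreal (g i v) \<partial>lborel) = ennreal r"
      by (cases "\<integral>\<^sup>+v\<in>{u<..}. ennreal (g i v) \<partial>lborel") auto
    have nn: "0 \<le> (LINT x|lborel. tailp x * Z i (u - x))"
      using Z(1)[OF i] tailp_bounds by (intro integral_nonneg_AE) auto
    have "ennreal ((LINT x|lborel. tailp x * Z i (u - x)) + r) = ennreal (W i)"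
      using 1 2 r nn by (simp add: ennreal_plus)
    then show ?thesis using r nn W(2)[OF i] by (subst (asm) ennreal_inj) auto
  qed
  \<comment> \<open>The set ranges over all members at once; this is where uniformity in
    \<open>i\<close> is built in.\<close>
  define V where "V T = {\<sigma> * y i u |i u. i \<in> I \<and> T \<le> u}" for T
  have V_ne: "V T \<noteq> {}" for T using False by (auto simp: V_def)
  have V_bdd: "bdd_above (V T)" for T
    using yb by (intro bdd_aboveI[of _ B']) (auto simp: V_def dest: abs_le_D1)
  have V_low: "- B' \<le> Sup (V T)" for T
  proof -
    obtain i where i: "i \<in> I" using False by blast
    have "- B' \<le> \<sigma> * y i T" using yb[OF i, of T] by linarith
    also have "\<dots> \<le> Sup (V T)" using i by (intro cSup_upper V_bdd) (auto simp: V_def)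
    finally show ?thesis .
  qed
  define M where "M = (INF T. Sup (V T))"
  have M_bdd: "bdd_below (range (\<lambda>T. Sup (V T)))" using V_low by (intro bdd_belowI2) auto
  have M_le: "M \<le> Sup (V T)" for T unfolding M_def by (intro cINF_lower M_bdd) auto
  have M_abs: "\<bar>M\<bar> \<le> B'"
  proof -
    have "M \<le> B'" using M_le[of 0] cSup_least[OF V_ne, of 0 B'] yb
      by (fastforce simp: V_def dest: abs_le_D1)
    moreover have "- B' \<le> M" unfolding M_def using V_low by (intro cINF_greatest) auto
    ultimately show ?thesis by linarith
  qed
  \<comment> \<open>\<open>M * m\<close> is what the constant \<open>M\<close> integrates to against
    \<open>tailp\<close>. It is compared with the integral of \<open>\<sigma> * y i\<close>, which
    conservation reduces to a late part of the forcing.\<close>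
  have key: "M * m \<le> 3 * e1" if e1: "0 < e1" for e1
  proof -
    define Bf where "Bf = 2 * B' + 1"
    have Bf: "0 < Bf" using B'0 by (simp add: Bf_def)
    obtain R where R: "0 \<le> R" "\<And>R'. R \<le> R' \<Longrightarrow> \<bar>LINT x|lborel. tailp x * indicator {R'<..} x\<bar> \<le> e1 / Bf"
      using integrable_tail_small[OF tailp_integrable, of "e1 / Bf"] e1 Bf by auto
    \<comment> \<open>Enough backward steps of length \<delta>/2 to cover the range \<open>R\<close>
      outside which \<open>tailp\<close> is negligible.\<close>
    obtain j :: nat where j: "R / (\<delta> / 2) \<le> real j" using real_arch_simple by blast
    define R' where "R' = real j * \<delta> / 2"
    have R': "R \<le> R'" using j \<delta>_pos by (simp add: R'_def field_simps)
    obtain \<kappa> where \<kappa>: "0 \<le> \<kappa>" and chain: "\<And>f T1 \<epsilon> u e. f \<in> borel_measurable borel \<Longrightarrow> 0 < \<epsilon> \<Longrightarrow> 0 \<le> e \<Longrightarrow>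
     (\<And>v. v\<ge>T1 \<Longrightarrow> ennreal c * (\<integral>\<^sup>+x\<in>{v - \<delta>..v}. ennreal (f x) \<partial>lborel) \<le> ennreal (f v + \<epsilon>)) \<Longrightarrow>
     T1 + real j * \<delta> \<le> u \<Longrightarrow> f u \<le> e \<Longrightarrow>
     (\<integral>\<^sup>+x\<in>{u - real j * \<delta> / 2<..u}. ennreal (f x) \<partial>lborel) \<le> ennreal (\<kappa> * (e + \<epsilon>))"
      using chain_of_small_averages[OF c_pos \<delta>_pos, of j] by blast
    \<comment> \<open>Chosen after \<kappa>, so that starting at level \<open>2 * \<epsilon>\<close>
      the chained bound is \<open>3 * \<kappa> * \<epsilon> \<le> e1\<close>; the cap 1 is accounted
      for in \<open>Bf\<close>.\<close>
    define \<epsilon> where "\<epsilon> = min 1 (e1 / (3 * \<kappa> + 1))"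
    have \<epsilon>: "0 < \<epsilon>" "\<epsilon> \<le> 1" using e1 \<kappa> by (auto simp: \<epsilon>_def)
    have \<kappa>\<epsilon>: "\<kappa> * (2 * \<epsilon> + \<epsilon>) \<le> e1"
    proof -
      have "\<epsilon> \<le> e1 / (3 * \<kappa> + 1)" by (simp add: \<epsilon>_def)
      then have "\<epsilon> * (3 * \<kappa> + 1) \<le> e1" using \<kappa> by (simp add: pos_le_divide_eq)
      then show ?thesis using \<epsilon> by (simp add: algebra_simps)
    qed
    have "M < M + \<epsilon>" using \<epsilon> by simp
    then obtain T0 where T0: "Sup (V T0) < M + \<epsilon>"
      unfolding M_def using cINF_less_iff[OF _ M_bdd] by blast
    obtain Tg where Tg: "\<And>i u. i \<in> I \<Longrightarrow> Tg \<le> u \<Longrightarrow> g i u \<le> \<epsilon> / 2"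
      using g_small[of "\<epsilon> / 2"] \<epsilon> by auto
    obtain Tt where Tt: "\<And>i u. i \<in> I \<Longrightarrow> Tt \<le> u \<Longrightarrow> (\<integral>\<^sup>+v\<in>{u<..}. ennreal (g i v) \<partial>lborel) \<le> ennreal e1"
      using g_tail[OF e1] by auto
    obtain Th where Th: "0 \<le> Th" "\<And>R'. Th \<le> R' \<Longrightarrow> \<bar>LINT x|lborel. h x * indicator {R'<..} x\<bar> \<le> \<epsilon> / 2 / Bf"
      using integrable_tail_small[OF h_integrable, of "\<epsilon> / 2 / Bf"] \<epsilon> Bf by auto
    \<comment> \<open>After \<open>T1\<close> the forcing is at most \<open>\<epsilon> / 2\<close>,
      windows of length \<delta> stay where \<open>f\<close> is nonnegative, and the kernel mass
      reaching back before \<open>T0\<close> is negligible. \<open>T2\<close> adds the room for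
      \<open>j\<close> steps.\<close>
    define T1 where "T1 = max (max 0 Tg) (max (T0 + \<delta>) (T0 + Th))"
    define T2 where "T2 = max (T1 + real j * \<delta>) (max (max 0 Tt) (T0 + R'))"
    have "M - \<epsilon> < Sup (V T2)" using M_le[of T2] \<epsilon> by linarith
    then obtain i u where i: "i \<in> I" and u: "T2 \<le> u" and yu: "M - \<epsilon> < \<sigma> * y i u"
      using less_cSup_iff[OF V_ne V_bdd] by (auto simp: V_def)
    note [measurable] = ym[OF i]
    \<comment> \<open>The gap below \<open>M + \<epsilon>\<close>: nonnegative after
      \<open>T0\<close>, at most \<open>2 * \<epsilon>\<close> at \<open>u\<close>, and again a
      solution of a renewal equation, because constants are invariant under a kernel of mass
      one.\<close>
    define f where "f v = M + \<epsilon> - \<sigma> * y i v" for v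
    have fm[measurable]: "f \<in> borel_measurable borel" unfolding f_def by measurable
    have fb: "\<bar>f v\<bar> \<le> Bf" for v
      using yb[OF i, of v] M_abs \<epsilon> unfolding f_def Bf_def by linarith
    have f0: "0 \<le> f v" if "T0 \<le> v" for v
    proof -
      have "\<sigma> * y i v \<le> Sup (V T0)" using that i by (intro cSup_upper V_bdd) (auto simp: V_def)
      then show ?thesis using T0 by (simp add: f_def)
    qed
    have int_f: "integrable lborel (\<lambda>x. h x * f (v - x))" for v
      using fb by (intro int_hy) auto
    have int_tf: "integrable lborel (\<lambda>x. tailp x * f (v - x))" for v
      using fb by (intro int_ty) auto
    have int_Z: "integrable lborel (\<lambda>x. h x * Z i (v - x))" "integrable lborel (\<lambda>x. tailp x * Z i (v - x))" for v
      using Z[OF i] Zm[OF i] by (auto intro!: int_hy[where C=B] int_ty[where C=B])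
    define k where "k = M + \<epsilon> + \<sigma> * (W i / m)"
    have f_Z: "f v = k - \<sigma> * Z i v" for v by (simp add: f_def y_def k_def algebra_simps)
    have f_eq: "f v = - \<sigma> * g i v + (LINT x|lborel. h x * f (v - x))" for v
    proof -
      have "(LINT x|lborel. h x * f (v - x)) = (LINT x|lborel. k * h x - \<sigma> * (h x * Z i (v - x)))"
        by (intro Bochner_Integration.integral_cong) (auto simp: f_Z algebra_simps)
      also have "\<dots> = k - \<sigma> * (LINT x|lborel. h x * Z i (v - x))"
        using int_Z h_integrable by (simp add: h_integral)
      finally show ?thesis using Zeq[OF i, of v] by (simp add: f_Z algebra_simps)
    qed
    have tf_eq: "(LINT x|lborel. tailp x * f (u - x)) =
        (M + \<epsilon>) * m + \<sigma> * enn2real (\<integral>\<^sup>+v\<in>{u<..}. ennreal (g i v) \<partial>lborel)"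
    proof -
      have "(LINT x|lborel. tailp x * f (u - x)) = (LINT x|lborel. k * tailp x - \<sigma> * (tailp x * Z i (u - x)))"
        by (intro Bochner_Integration.integral_cong) (auto simp: f_Z algebra_simps)
      also have "\<dots> = k * m - \<sigma> * (LINT x|lborel. tailp x * Z i (u - x))"
        using int_Z tailp_integrable by (simp add: tailp_integral)
      also have "(LINT x|lborel. tailp x * Z i (u - x)) = W i - enn2real (\<integral>\<^sup>+v\<in>{u<..}. ennreal (g i v) \<partial>lborel)"
        using cons[OF i, of u] u by (simp add: T2_def)
      finally show ?thesis using m_pos by (simp add: k_def algebra_simps)
    qed
    \<comment> \<open>Replacing the kernel by \<open>c\<close> on (0, \<delta>] uses that
      \<open>f\<close> is nonnegative there; the lags beyond \<open>v - T0\<close>, where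
      \<open>f\<close> may be negative, cost at most \<open>Bf\<close> times a small kernel
      tail.\<close>
    have step: "ennreal c * (\<integral>\<^sup>+x\<in>{v - \<delta>..v}. ennreal (f x) \<partial>lborel) \<le> ennreal (f v + \<epsilon>)" if v: "T1 \<le> v" for v
    proof -
      have vT: "0 \<le> v" "Tg \<le> v" "T0 \<le> v - \<delta>" "Th \<le> v - T0" using v by (auto simp: T1_def)
      have intI: "integrable lborel (\<lambda>x. indicator {0..\<delta>} x * f (v - x))"
        by (rule Bochner_Integration.integrable_bound[of lborel "\<lambda>x. Bf * indicator {0..\<delta>} x"])
           (use fb Bf in \<open>auto split: split_indicator simp: emeasure_lborel_Icc_eq\<close>)
      have intT: "integrable lborel (\<lambda>x. h x * indicator {v - T0<..} x)"
        by (rule Bochner_Integration.integrable_bound[OF h_integrable]) (auto split: split_indicator)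
      have "(LINT x|lborel. c * (indicator {0..\<delta>} x * f (v - x)) - Bf * (h x * indicator {v - T0<..} x))
          \<le> (LINT x|lborel. h x * f (v - x))"
      proof (intro integral_mono_AE)
        show "AE x in lborel. c * (indicator {0..\<delta>} x * f (v - x)) - Bf * (h x * indicator {v - T0<..} x) \<le> h x * f (v - x)"
          using AE_lborel_singleton[of 0]
        proof eventually_elim
          fix x :: real assume "x \<noteq> 0"
          then consider "x < 0" | "0 < x" "x \<le> \<delta>" | "\<delta> < x" "x \<le> v - T0" | "\<delta> < x" "v - T0 < x" by linarith
          then show "c * (indicator {0..\<delta>} x * f (v - x)) - Bf * (h x * indicator {v - T0<..} x) \<le> h x * f (v - x)"
          proof cases
            case 1
            then show ?thesis using vT \<delta>_pos by (simp add: h_zero)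
          next
            case 2
            then have "c * f (v - x) \<le> h x * f (v - x)" using vT by (intro mult_right_mono h_lower f0) auto
            moreover have "0 \<le> Bf * (h x * indicator {v - T0<..} x)" using Bf h_nonneg by simp
            ultimately show ?thesis using 2 by simp
          next
            case 3
            then show ?thesis using vT \<delta>_pos by (simp add: h_nonneg f0)
          next
            case 4
            have "- (Bf * h x) \<le> h x * f (v - x)"
              using mult_left_mono[OF fb[of "v - x", THEN abs_le_D2] h_nonneg[of x]] by (simp add: mult.commute)
            with 4 show ?thesis using \<delta>_pos by simp
          qed
        qed
      qed (use intI intT int_f in auto)
      then have "c * (LINT x|lborel. indicator {0..\<delta>} x * f (v - x)) \<le>
          (LINT x|lborel. h x * f (v - x)) + Bf * (LINT x|lborel. h x * indicator {v - T0<..} x)"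
        using intI intT by simp
      also have "Bf * (LINT x|lborel. h x * indicator {v - T0<..} x) \<le> \<epsilon> / 2"
        by (rule mult_le_of_abs_le_divide[OF Bf Th(2)[OF vT(4)]])
      also have "(LINT x|lborel. h x * f (v - x)) \<le> f v + \<epsilon> / 2"
      proof -
        have "\<bar>\<sigma> * g i v\<bar> \<le> \<epsilon> / 2" using Tg[OF i vT(2)] g[OF i, of v] by (simp add: abs_mult \<sigma>)
        then show ?thesis using f_eq[of v] by linarith
      qed
      finally have le: "c * (LINT x|lborel. indicator {0..\<delta>} x * f (v - x)) \<le> f v + \<epsilon>" by simp
      have "(\<integral>\<^sup>+x\<in>{v - \<delta>..v}. ennreal (f x) \<partial>lborel) = (\<integral>\<^sup>+x. ennreal (f (v - x)) * indicator {v - \<delta>..v} (v - x) \<partial>lborel)"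
        by (rule nn_integral_lborel_reflect[of "\<lambda>x. ennreal (f x) * indicator {v - \<delta>..v} x", symmetric]) measurable
      also have "\<dots> = (\<integral>\<^sup>+x. ennreal (indicator {0..\<delta>} x * f (v - x)) \<partial>lborel)"
        by (intro nn_integral_cong) (auto split: split_indicator)
      also have "\<dots> = ennreal (LINT x|lborel. indicator {0..\<delta>} x * f (v - x))"
        using intI vT by (intro nn_integral_eq_integral) (auto split: split_indicator intro!: f0)
      finally show ?thesis using le c_pos by (simp add: ennreal_leI flip: ennreal_mult')
    qed
    have "f u \<le> 2 * \<epsilon>" using yu by (simp add: f_def)
    then have small: "(\<integral>\<^sup>+x\<in>{u - R'<..u}. ennreal (f x) \<partial>lborel) \<le> ennreal e1"
      using chain[of f \<epsilon> "2 * \<epsilon>" T1 u, OF fm \<epsilon>(1) _ step] u \<epsilon> \<kappa>\<epsilon>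
      by (force simp: T2_def R'_def intro: order_trans ennreal_leI)
    have intR: "integrable lborel (\<lambda>x. indicator {0..<R'} x * f (u - x))"
      by (rule Bochner_Integration.integrable_bound[of lborel "\<lambda>x. Bf * indicator {0..R'} x"])
         (use fb Bf in \<open>auto split: split_indicator simp: emeasure_lborel_Icc_eq\<close>)
    have uT: "T0 \<le> u - R'" using u by (simp add: T2_def)
    have intT: "integrable lborel (\<lambda>x. tailp x * indicator {R'<..} x)"
      by (rule Bochner_Integration.integrable_bound[OF tailp_integrable]) (auto split: split_indicator)
    \<comment> \<open>Near lags: \<open>tailp \<le> 1\<close> and the chained bound. Far lags:
      \<open>f\<close> is at most \<open>Bf\<close> and the tail of \<open>tailp\<close> is
      small.\<close>
    have "(LINT x|lborel. tailp x * f (u - x)) \<le>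
        (LINT x|lborel. indicator {0..<R'} x * f (u - x) + Bf * (tailp x * indicator {R'<..} x))"
    proof (intro integral_mono_AE)
      show "AE x in lborel. tailp x * f (u - x) \<le> indicator {0..<R'} x * f (u - x) + Bf * (tailp x * indicator {R'<..} x)"
        using AE_lborel_singleton[of R'] AE_lborel_singleton[of 0]
      proof eventually_elim
        fix x :: real assume "x \<noteq> R'" "x \<noteq> 0"
        moreover have "0 \<le> R'" using R' R by linarith
        ultimately consider "x < 0" | "0 < x" "x < R'" | "0 < x" "R' < x" by linarith
        then show "tailp x * f (u - x) \<le> indicator {0..<R'} x * f (u - x) + Bf * (tailp x * indicator {R'<..} x)"
        proof cases
          case 1
          then show ?thesis using \<open>0 \<le> R'\<close> by (simp add: tailp_def)
        next
          case 2
          have "tailp x * f (u - x) \<le> 1 * f (u - x)"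
            using 2 uT by (intro mult_right_mono tailp_bounds f0) auto
          with 2 show ?thesis by simp
        next
          case 3
          have "tailp x * f (u - x) \<le> tailp x * Bf"
            using fb[of "u - x"] by (intro mult_left_mono tailp_bounds) auto
          with 3 show ?thesis by (simp add: mult.commute)
        qed
      qed
    qed (use intR intT int_tf in auto)
    also have "\<dots> = (LINT x|lborel. indicator {0..<R'} x * f (u - x)) + Bf * (LINT x|lborel. tailp x * indicator {R'<..} x)"
      using intR intT by simp
    also have "Bf * (LINT x|lborel. tailp x * indicator {R'<..} x) \<le> e1"
      by (rule mult_le_of_abs_le_divide[OF Bf R(2)[OF R']])
    also have "(LINT x|lborel. indicator {0..<R'} x * f (u - x)) \<le> e1"
    proof -
      have "ennreal (LINT x|lborel. indicator {0..<R'} x * f (u - x)) = (\<integral>\<^sup>+x. ennreal (indicator {0..<R'} x * f (u - x)) \<partial>lborel)"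
        using intR uT by (intro nn_integral_eq_integral[symmetric]) (auto split: split_indicator intro!: f0)
      also have "\<dots> = (\<integral>\<^sup>+x. ennreal (f (u - x)) * indicator {u - R'<..u} (u - x) \<partial>lborel)"
        by (intro nn_integral_cong) (auto split: split_indicator)
      also have "\<dots> = (\<integral>\<^sup>+x\<in>{u - R'<..u}. ennreal (f x) \<partial>lborel)"
        by (rule nn_integral_lborel_reflect[of "\<lambda>x. ennreal (f x) * indicator {u - R'<..u} x"]) measurable
      finally show ?thesis using small e1 ennreal_le_iff[of e1] by (metis less_imp_le)
    qed
    finally have "(M + \<epsilon>) * m + \<sigma> * enn2real (\<integral>\<^sup>+v\<in>{u<..}. ennreal (g i v) \<partial>lborel) \<le> 2 * e1"
      using tf_eq by simp
    moreover have "\<bar>\<sigma> * enn2real (\<integral>\<^sup>+v\<in>{u<..}. ennreal (g i v) \<partial>lborel)\<bar> \<le> e1"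
      using enn2real_mono[OF Tt[OF i, of u]] u e1 by (simp add: abs_mult \<sigma> T2_def)
    moreover have "0 \<le> \<epsilon> * m" using \<epsilon> m_pos by simp
    ultimately show ?thesis by (simp add: algebra_simps)
  qed
  have "M * m \<le> 0"
  proof (rule ccontr)
    assume "\<not> M * m \<le> 0"
    \<comment> \<open>With this choice \<open>key\<close> says
      \<open>M * m \<le> M * m / 2\<close>.\<close>
    then show False using key[of "M * m / 6"] by simp
  qed
  then have "M \<le> 0" using m_pos by (simp add: mult_le_0_iff)
  then have "M < e" using e by simp
  then obtain T where T: "Sup (V T) < e"
    unfolding M_def using cINF_less_iff[OF _ M_bdd] by blast
  show ?thesis
  proof (intro exI ballI allI impI)
    fix i u assume "i \<in> I" "T \<le> u"
    then have "\<sigma> * y i u \<le> Sup (V T)" by (intro cSup_upper V_bdd) (auto simp: V_def)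
    then show "\<sigma> * (Z i u - W i / m) \<le> e" using T by (simp add: y_def)
  qed
qed simp

end

section \<open>The resolvent of the routing and service convolution\<close>

lemma mult_sum_SUP_ennreal:
  fixes f :: "nat \<Rightarrow> nat \<Rightarrow> ennreal"
  assumes "\<And>j. j < K \<Longrightarrow> incseq (\<lambda>n. f n j)" and "\<And>j. j < K \<Longrightarrow> c j < top_class.top"
  shows "(\<Sum>j<K. c j * (SUP n. f n j)) = (SUP n. \<Sum>j<K. c j * f n j)"
proof -
  have "(\<lambda>n. \<Sum>j<K. c j * f n j) \<longlonglongrightarrow> (\<Sum>j<K. c j * (SUP n. f n j))"
    using assms by (intro tendsto_sum ennreal_tendsto_cmult LIMSEQ_SUP) auto
  moreover have "(\<lambda>n. \<Sum>j<K. c j * f n j) \<longlonglongrightarrow> (SUP n. \<Sum>j<K. c j * f n j)"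
    using assms by (intro LIMSEQ_SUP) (auto simp: incseq_def intro!: sum_mono mult_left_mono)
  ultimately show ?thesis by (rule LIMSEQ_unique)
qed

lemma nn_integral_add_weighted_sum:
  assumes "f \<in> borel_measurable M" "\<And>j. j < K \<Longrightarrow> g j \<in> borel_measurable M"
    and "\<And>j. j < K \<Longrightarrow> (\<integral>\<^sup>+x. g j x \<partial>M) = G j"
  shows "(\<integral>\<^sup>+x. f x + (\<Sum>j<K. c j * g j x) \<partial>M) = (\<integral>\<^sup>+x. f x \<partial>M) + (\<Sum>j<K::nat. c j * G j)"
proof -
  have "(\<integral>\<^sup>+x. f x + (\<Sum>j<K. c j * g j x) \<partial>M) = (\<integral>\<^sup>+x. f x \<partial>M) + (\<integral>\<^sup>+x. (\<Sum>j<K. c j * g j x) \<partial>M)"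
    using assms by (intro nn_integral_add borel_measurable_sum borel_measurable_times) auto
  also have "(\<integral>\<^sup>+x. (\<Sum>j<K. c j * g j x) \<partial>M) = (\<Sum>j<K. \<integral>\<^sup>+x. c j * g j x \<partial>M)"
    using assms by (intro nn_integral_sum borel_measurable_times) auto
  also have "\<dots> = (\<Sum>j<K. c j * G j)"
    using assms by (intro sum.cong) (auto simp: nn_integral_cmult)
  finally show ?thesis .
qed

text \<open>The vector w solves w = 1 + P w, so its multiples are supersolutions of every system
  r = f + P (\<nu> * r) with bounded f; all finiteness below is obtained by comparing iterates with it.\<close>

locale feedback =
  fixes K :: nat and p :: "nat \<Rightarrow> nat \<Rightarrow> real" and \<nu> :: "nat \<Rightarrow> real measure" and w :: "nat \<Rightarrow> real"
  assumes p_nonneg: "\<And>l j. l < K \<Longrightarrow> j < K \<Longrightarrow> 0 \<le> p l j"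
    and w_nonneg: "\<And>l. l < K \<Longrightarrow> 0 \<le> w l"
    and w_super: "\<And>l. l < K \<Longrightarrow> (\<Sum>j<K. p l j * w j) + 1 = w l"
    and nu_prob: "\<And>l. l < K \<Longrightarrow> prob_space (\<nu> l)"
    and nu_sets[measurable_cong]: "\<And>l. l < K \<Longrightarrow> sets (\<nu> l) = sets borel"
    and nu_pos: "\<And>l. l < K \<Longrightarrow> AE y in \<nu> l. 0 < y"
begin

primrec iter :: "(nat \<Rightarrow> real \<Rightarrow> ennreal) \<Rightarrow> nat \<Rightarrow> nat \<Rightarrow> real \<Rightarrow> ennreal" where
  "iter f 0 l x = 0"
| "iter f (Suc n) l x = f l x + (\<Sum>j<K. ennreal (p l j) * (\<integral>\<^sup>+y. iter f n j (x - y) \<partial>\<nu> l))"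

text \<open>The monotone limit of the Picard iterates exists in \<open>ennreal\<close> before
  anything is known to be finite; the bounds below are shown for the iterates and passed to the
  supremum.\<close>

definition res :: "(nat \<Rightarrow> real \<Rightarrow> ennreal) \<Rightarrow> nat \<Rightarrow> real \<Rightarrow> ennreal" where
  "res f l x = (SUP n. iter f n l x)"

lemma ennreal_w_super:
  assumes "l < K" shows "ennreal 1 + (\<Sum>j<K. ennreal (p l j) * ennreal (w j)) = ennreal (w l)"
proof -
  have "(\<Sum>j<K. ennreal (p l j) * ennreal (w j)) = ennreal (\<Sum>j<K. p l j * w j)"
    using assms p_nonneg w_nonneg by (subst sum_ennreal[symmetric]) (auto simp: ennreal_mult)
  moreover have "ennreal (1 + (\<Sum>j<K. p l j * w j)) = ennreal 1 + ennreal (\<Sum>j<K. p l j * w j)"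
    using assms p_nonneg w_nonneg by (intro ennreal_plus) (auto intro!: sum_nonneg)
  ultimately show ?thesis
    using w_super[OF assms] by (simp only: add.commute)
qed

lemma supersolution_step:
  assumes "l < K" "a \<le> C" "\<And>j. j < K \<Longrightarrow> b j \<le> C * ennreal (w j)"
  shows "a + (\<Sum>j<K. ennreal (p l j) * b j) \<le> C * ennreal (w l)"
proof -
  have "a + (\<Sum>j<K. ennreal (p l j) * b j) \<le> C + (\<Sum>j<K. ennreal (p l j) * (C * ennreal (w j)))"
    using assms by (intro add_mono sum_mono mult_left_mono) auto
  also have "\<dots> = C * (ennreal 1 + (\<Sum>j<K. ennreal (p l j) * ennreal (w j)))"
    by (simp add: distrib_left sum_distrib_left mult_ac)
  finally show ?thesis by (simp only: ennreal_w_super[OF assms(1)])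
qed

section \<open>Equation, bounds and total mass of the resolvent\<close>

context
  fixes f :: "nat \<Rightarrow> real \<Rightarrow> ennreal"
  assumes f_meas[measurable]: "\<And>l. l < K \<Longrightarrow> f l \<in> borel_measurable borel"
begin

lemma nn_integral_nu_shift_meas:
  assumes l: "l < K" and [measurable]: "g \<in> borel_measurable borel"
  shows "(\<lambda>x. \<integral>\<^sup>+y. g (x - y) \<partial>\<nu> l) \<in> borel_measurable borel"
proof -
  interpret prob_space "\<nu> l" by (rule nu_prob[OF l])
  note [measurable_cong] = nu_sets[OF l]
  show ?thesis by (rule borel_measurable_nn_integral) measurable
qed

lemma iter_meas: "l < K \<Longrightarrow> iter f n l \<in> borel_measurable borel"
proof (induction n arbitrary: l)
  case (Suc n)
  note [measurable] = nn_integral_nu_shift_meas[OF Suc.prems Suc.IH]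
  have [measurable]: "f l \<in> borel_measurable borel" using Suc.prems by measurable
  show ?case unfolding iter.simps using Suc.prems
    by (intro borel_measurable_add borel_measurable_sum borel_measurable_times) auto
next
  case 0
  have "iter f 0 l = (\<lambda>_. 0)" by auto
  then show ?case by simp
qed

lemma iter_Suc_mono: "iter f n l x \<le> iter f (Suc n) l x"
proof (induction n arbitrary: l x)
  case (Suc n)
  show ?case unfolding iter.simps(2)[of f "Suc n"] iter.simps(2)[of f n l x]
    using Suc by (intro add_left_mono sum_mono mult_left_mono nn_integral_mono) auto
qed simp

lemma iter_incseq: "incseq (\<lambda>n. iter f n l x)"
  by (intro incseq_SucI iter_Suc_mono)

lemma res_meas: "l < K \<Longrightarrow> res f l \<in> borel_measurable borel"
  unfolding res_def using iter_meas by (intro borel_measurable_SUP) auto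

lemma SUP_iter_Suc: "(SUP n. iter f (Suc n) l x) = res f l x"
proof (rule antisym)
  show "res f l x \<le> (SUP n. iter f (Suc n) l x)"
    unfolding res_def by (intro SUP_mono) (use iter_Suc_mono in auto)
qed (auto simp: res_def intro: SUP_upper intro!: SUP_least simp del: iter.simps)

lemma nn_integral_res:
  assumes "l < K" and [measurable]: "sets M = sets borel"
    "g \<in> measurable M borel" and "c \<in> borel_measurable M"
  shows "(\<integral>\<^sup>+y. c y * res f l (g y) \<partial>M) = (SUP n. \<integral>\<^sup>+y. c y * iter f n l (g y) \<partial>M)"
proof -
  note [measurable] = iter_meas[OF assms(1)] assms(4)
  have "(\<integral>\<^sup>+y. c y * res f l (g y) \<partial>M) = (\<integral>\<^sup>+y. (SUP n. c y * iter f n l (g y)) \<partial>M)"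
    unfolding res_def by (simp add: SUP_mult_left_ennreal)
  also have "\<dots> = (SUP n. \<integral>\<^sup>+y. c y * iter f n l (g y) \<partial>M)"
    using iter_incseq by (intro nn_integral_monotone_convergence_SUP)
      (auto simp: incseq_def le_fun_def intro!: mult_left_mono)
  finally show ?thesis .
qed

lemma res_eq:
  assumes l: "l < K"
  shows "res f l x = f l x + (\<Sum>j<K. ennreal (p l j) * (\<integral>\<^sup>+y. res f j (x - y) \<partial>\<nu> l))"
proof -
  note [measurable_cong] = nu_sets[OF l]
  have "(\<integral>\<^sup>+y. res f j (x - y) \<partial>\<nu> l) = (SUP n. \<integral>\<^sup>+y. iter f n j (x - y) \<partial>\<nu> l)" if "j < K" for j
    using nn_integral_res[OF that, of "\<nu> l" "\<lambda>y. x - y" "\<lambda>_. 1"] nu_sets[OF l] by simp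
  then have "(\<Sum>j<K. ennreal (p l j) * (\<integral>\<^sup>+y. res f j (x - y) \<partial>\<nu> l))
      = (\<Sum>j<K. ennreal (p l j) * (SUP n. \<integral>\<^sup>+y. iter f n j (x - y) \<partial>\<nu> l))" by simp
  also have "\<dots> = (SUP n. \<Sum>j<K. ennreal (p l j) * (\<integral>\<^sup>+y. iter f n j (x - y) \<partial>\<nu> l))"
    using iter_incseq by (intro mult_sum_SUP_ennreal) (auto simp: incseq_def intro!: nn_integral_mono)
  finally have "f l x + (\<Sum>j<K. ennreal (p l j) * (\<integral>\<^sup>+y. res f j (x - y) \<partial>\<nu> l))
      = (SUP n. iter f (Suc n) l x)" by (simp add: ennreal_SUP_add_right)
  then show ?thesis by (simp add: SUP_iter_Suc del: iter.simps)
qed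

lemma f_le_res: "l < K \<Longrightarrow> f l x \<le> res f l x"
  by (subst res_eq) auto

text \<open>Services are almost surely positive, so at \<open>x \<le> 0\<close> the convolution only
  sees arguments that are again nonpositive.\<close>

lemma res_zero:
  assumes f0: "\<And>l x. l < K \<Longrightarrow> x \<le> 0 \<Longrightarrow> f l x = 0" and l: "l < K" and x: "x \<le> 0"
  shows "res f l x = 0"
proof -
  have "iter f n l x = 0" for n using l x
  proof (induction n arbitrary: l x)
    case (Suc n)
    have "(\<integral>\<^sup>+y. iter f n j (x - y) \<partial>\<nu> l) = (\<integral>\<^sup>+y. 0 \<partial>\<nu> l)" if "j < K" for j
      using nu_pos[OF Suc.prems(1)] Suc.IH[OF that] Suc.prems by (intro nn_integral_cong_AE) (auto elim!: eventually_mono)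
    then show ?case using f0 Suc.prems by simp
  qed simp
  then show ?thesis by (simp add: res_def)
qed

lemma res_le:
  assumes "\<And>l x. l < K \<Longrightarrow> f l x \<le> C" and "l < K"
  shows "res f l x \<le> C * ennreal (w l)"
proof -
  have "iter f n l x \<le> C * ennreal (w l)" for n using assms(2)
  proof (induction n arbitrary: l x)
    case (Suc n)
    interpret prob_space "\<nu> l" by (rule nu_prob[OF Suc.prems])
    have "(\<integral>\<^sup>+y. iter f n j (x - y) \<partial>\<nu> l) \<le> C * ennreal (w j)" if "j < K" for j
      using nn_integral_mono[of "\<nu> l" "\<lambda>y. iter f n j (x - y)" "\<lambda>_. C * ennreal (w j)"] Suc.IH[OF that]
      by (simp add: emeasure_space_1)
    then show ?case unfolding iter.simps using assms(1) Suc.prems by (intro supersolution_step) auto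
  qed simp
  then show ?thesis unfolding res_def by (intro SUP_least)
qed

lemma nn_integral_nu_shift:
  assumes l: "l < K" and g[measurable]: "g \<in> borel_measurable borel"
  shows "(\<integral>\<^sup>+x. \<integral>\<^sup>+y. g (x - y) \<partial>\<nu> l \<partial>lborel) = (\<integral>\<^sup>+x. g x \<partial>lborel)"
proof -
  interpret prob_space "\<nu> l" by (rule nu_prob[OF l])
  interpret pair_sigma_finite "\<nu> l" lborel ..
  note [measurable_cong] = nu_sets[OF l]
  have "(\<integral>\<^sup>+x. \<integral>\<^sup>+y. g (x - y) \<partial>\<nu> l \<partial>lborel) = (\<integral>\<^sup>+y. \<integral>\<^sup>+x. g (x - y) \<partial>lborel \<partial>\<nu> l)"
    by (rule Fubini') measurable
  also have "\<dots> = (\<integral>\<^sup>+x. g x \<partial>lborel)"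
    using nn_integral_lborel_shift[OF g] by (simp add: emeasure_space_1)
  finally show ?thesis .
qed

lemma iter_mass_Suc:
  assumes l: "l < K"
  shows "(\<integral>\<^sup>+x. iter f (Suc n) l x \<partial>lborel)
    = (\<integral>\<^sup>+x. f l x \<partial>lborel) + (\<Sum>j<K. ennreal (p l j) * (\<integral>\<^sup>+x. iter f n j x \<partial>lborel))"
proof -
  note [measurable] = nn_integral_nu_shift_meas[OF l iter_meas]
  have [measurable]: "f l \<in> borel_measurable borel" using l by measurable
  show ?thesis unfolding iter.simps
    using l by (intro nn_integral_add_weighted_sum nn_integral_nu_shift) (auto intro: iter_meas)
qed

lemma res_mass:
  assumes l: "l < K"
  shows "(\<integral>\<^sup>+x. res f l x \<partial>lborel)
    = (\<integral>\<^sup>+x. f l x \<partial>lborel) + (\<Sum>j<K. ennreal (p l j) * (\<integral>\<^sup>+x. res f j x \<partial>lborel))"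
proof -
  have eq: "res f l = (\<lambda>x. f l x + (\<Sum>j<K. ennreal (p l j) * (\<integral>\<^sup>+y. res f j (x - y) \<partial>\<nu> l)))"
    using res_eq[OF l] by auto
  note [measurable] = nn_integral_nu_shift_meas[OF l res_meas]
  have [measurable]: "f l \<in> borel_measurable borel" using l by measurable
  show ?thesis
    using l by (subst eq, intro nn_integral_add_weighted_sum nn_integral_nu_shift) (auto intro: res_meas)
qed

text \<open>Infinite values may satisfy the linear relation \<open>res_mass\<close> as well;
  finiteness is read off the iterates, whose masses stay below a multiple of
  \<open>w\<close>.\<close>

lemma res_mass_le:
  assumes F: "\<And>l. l < K \<Longrightarrow> (\<integral>\<^sup>+x. f l x \<partial>lborel) \<le> C" and l: "l < K"
  shows "(\<integral>\<^sup>+x. res f l x \<partial>lborel) \<le> C * ennreal (w l)"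
proof -
  have "(\<integral>\<^sup>+x. iter f n l x \<partial>lborel) \<le> C * ennreal (w l)" for n using l
  proof (induction n arbitrary: l)
    case (Suc n)
    show ?case unfolding iter_mass_Suc[OF Suc.prems] using F Suc by (intro supersolution_step) auto
  next
    case 0
    have "iter f 0 l = (\<lambda>_. 0)" by auto
    then show ?case by simp
  qed
  moreover have "(\<integral>\<^sup>+x. res f l x \<partial>lborel) = (SUP n. \<integral>\<^sup>+x. iter f n l x \<partial>lborel)"
    using nn_integral_res[OF l, of lborel "\<lambda>x. x" "\<lambda>_. 1"] by simp
  ultimately show ?thesis by (simp add: SUP_least)
qed

text \<open>The weight x is additive along the convolution, so the first moments of the resolvent
  satisfy the same linear system with the extra source \<beta> P R.\<close>

lemma nn_integral_nu_shift_weighted: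
  assumes l: "l < K" and g[measurable]: "g \<in> borel_measurable borel" and g0: "\<And>x. x \<le> 0 \<Longrightarrow> g x = 0"
  shows "(\<integral>\<^sup>+x. ennreal x * (\<integral>\<^sup>+y. g (x - y) \<partial>\<nu> l) \<partial>lborel)
    = (\<integral>\<^sup>+x. ennreal x * g x \<partial>lborel) + (\<integral>\<^sup>+y. ennreal y \<partial>\<nu> l) * (\<integral>\<^sup>+x. g x \<partial>lborel)"
proof -
  interpret prob_space "\<nu> l" by (rule nu_prob[OF l])
  interpret pair_sigma_finite "\<nu> l" lborel ..
  note [measurable_cong] = nu_sets[OF l]
  have "(\<integral>\<^sup>+x. ennreal x * (\<integral>\<^sup>+y. g (x - y) \<partial>\<nu> l) \<partial>lborel) = (\<integral>\<^sup>+x. \<integral>\<^sup>+y. ennreal x * g (x - y) \<partial>\<nu> l \<partial>lborel)"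
    by (intro nn_integral_cong nn_integral_cmult[symmetric]) measurable
  also have "\<dots> = (\<integral>\<^sup>+y. \<integral>\<^sup>+x. ennreal x * g (x - y) \<partial>lborel \<partial>\<nu> l)"
    by (rule Fubini') measurable
  also have "\<dots> = (\<integral>\<^sup>+y. ((\<integral>\<^sup>+x. ennreal x * g x \<partial>lborel) + ennreal y * (\<integral>\<^sup>+x. g x \<partial>lborel)) \<partial>\<nu> l)"
  proof (rule nn_integral_cong_AE)
    show "AE y in \<nu> l. (\<integral>\<^sup>+x. ennreal x * g (x - y) \<partial>lborel)
        = (\<integral>\<^sup>+x. ennreal x * g x \<partial>lborel) + ennreal y * (\<integral>\<^sup>+x. g x \<partial>lborel)"
      using nu_pos[OF l]
    proof eventually_elim
      fix y :: real assume y: "0 < y"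
      have "(\<integral>\<^sup>+x. ennreal x * g (x - y) \<partial>lborel) = (\<integral>\<^sup>+x. ennreal (x - y + y) * g (x - y) \<partial>lborel)" by simp
      also have "\<dots> = (\<integral>\<^sup>+x. ennreal (x + y) * g x \<partial>lborel)"
        by (rule nn_integral_lborel_shift[of "\<lambda>x. ennreal (x + y) * g x"]) measurable
      also have "\<dots> = (\<integral>\<^sup>+x. ennreal x * g x + ennreal y * g x \<partial>lborel)"
      proof (intro nn_integral_cong)
        fix x :: real
        show "ennreal (x + y) * g x = ennreal x * g x + ennreal y * g x"
          using y by (cases "x \<le> 0") (auto simp: g0 ennreal_plus distrib_right)
      qed
      also have "\<dots> = (\<integral>\<^sup>+x. ennreal x * g x \<partial>lborel) + ennreal y * (\<integral>\<^sup>+x. g x \<partial>lborel)"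
        by (subst nn_integral_add) (auto simp: nn_integral_cmult)
      finally show "(\<integral>\<^sup>+x. ennreal x * g (x - y) \<partial>lborel)
        = (\<integral>\<^sup>+x. ennreal x * g x \<partial>lborel) + ennreal y * (\<integral>\<^sup>+x. g x \<partial>lborel)" .
    qed
  qed
  also have "\<dots> = (\<integral>\<^sup>+x. ennreal x * g x \<partial>lborel) + (\<integral>\<^sup>+y. ennreal y \<partial>\<nu> l) * (\<integral>\<^sup>+x. g x \<partial>lborel)"
    by (subst nn_integral_add) (auto simp: nn_integral_multc emeasure_space_1)
  finally show ?thesis .
qed

section \<open>First moments and pointwise decay of the resolvent\<close>

context
  assumes f0: "\<And>l x. l < K \<Longrightarrow> x \<le> 0 \<Longrightarrow> f l x = 0"
begin

lemma iter_zero: "l < K \<Longrightarrow> x \<le> 0 \<Longrightarrow> iter f n l x = 0"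
  using res_zero[OF f0] SUP_upper[of n UNIV "\<lambda>n. iter f n l x"] by (simp add: res_def)

lemma res_moment:
  assumes l: "l < K"
  shows "(\<integral>\<^sup>+x. ennreal x * res f l x \<partial>lborel)
    = (\<integral>\<^sup>+x. ennreal x * f l x \<partial>lborel)
      + (\<Sum>j<K. ennreal (p l j) * ((\<integral>\<^sup>+x. ennreal x * res f j x \<partial>lborel)
          + (\<integral>\<^sup>+y. ennreal y \<partial>\<nu> l) * (\<integral>\<^sup>+x. res f j x \<partial>lborel)))"
proof -
  have eq: "ennreal x * res f l x = ennreal x * f l x
      + (\<Sum>j<K. ennreal (p l j) * (ennreal x * (\<integral>\<^sup>+y. res f j (x - y) \<partial>\<nu> l)))" for x
    using res_eq[OF l, of x] by (simp add: distrib_left sum_distrib_left mult_ac)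
  note [measurable] = nn_integral_nu_shift_meas[OF l res_meas]
  have [measurable]: "f l \<in> borel_measurable borel" using l by measurable
  show ?thesis unfolding eq
    using l res_zero[OF f0] by (intro nn_integral_add_weighted_sum nn_integral_nu_shift_weighted) (auto intro: res_meas)
qed

lemma iter_moment_Suc:
  assumes l: "l < K"
  shows "(\<integral>\<^sup>+x. ennreal x * iter f (Suc n) l x \<partial>lborel)
    = (\<integral>\<^sup>+x. ennreal x * f l x \<partial>lborel)
      + (\<Sum>j<K. ennreal (p l j) * ((\<integral>\<^sup>+x. ennreal x * iter f n j x \<partial>lborel)
          + (\<integral>\<^sup>+y. ennreal y \<partial>\<nu> l) * (\<integral>\<^sup>+x. iter f n j x \<partial>lborel)))"
proof -
  have eq: "ennreal x * iter f (Suc n) l x = ennreal x * f l x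
      + (\<Sum>j<K. ennreal (p l j) * (ennreal x * (\<integral>\<^sup>+y. iter f n j (x - y) \<partial>\<nu> l)))" for x
    by (simp add: distrib_left sum_distrib_left mult_ac)
  note [measurable] = nn_integral_nu_shift_meas[OF l iter_meas]
  have [measurable]: "f l \<in> borel_measurable borel" using l by measurable
  show ?thesis unfolding eq
    using l iter_zero by (intro nn_integral_add_weighted_sum nn_integral_nu_shift_weighted) (auto intro: iter_meas)
qed

text \<open>Besides the moment of \<open>f\<close>, each iteration adds \<beta> P times the masses
  of the iterates. These are already bounded, so the extra term joins the source and the comparison
  with \<open>w\<close> applies.\<close>

lemma res_moment_finite:
  assumes F: "\<And>l. l < K \<Longrightarrow> (\<integral>\<^sup>+x. f l x \<partial>lborel) \<le> ennreal C"
    and F1: "\<And>l. l < K \<Longrightarrow> (\<integral>\<^sup>+x. ennreal x * f l x \<partial>lborel) \<le> ennreal C"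
    and b: "\<And>l. l < K \<Longrightarrow> (\<integral>\<^sup>+y. ennreal y \<partial>\<nu> l) \<le> ennreal b" and l: "l < K"
  shows "(\<integral>\<^sup>+x. ennreal x * res f l x \<partial>lborel) < \<infinity>"
proof -
  \<comment> \<open>Summing over \<open>l\<close> as well gives one constant for all rows.\<close>
  define C1 where "C1 = ennreal C + (\<Sum>l<K. \<Sum>j<K. ennreal (p l j) * (ennreal b * (ennreal C * ennreal (w j))))"
  have C1: "C1 < \<infinity>" by (simp add: C1_def ennreal_mult_less_top)
  have im: "(\<integral>\<^sup>+x. iter f n j x \<partial>lborel) \<le> ennreal C * ennreal (w j)" if "j < K" for n j
  proof -
    have "(\<integral>\<^sup>+x. iter f n j x \<partial>lborel) \<le> (\<integral>\<^sup>+x. res f j x \<partial>lborel)"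
      unfolding res_def by (intro nn_integral_mono SUP_upper) auto
    also have "\<dots> \<le> ennreal C * ennreal (w j)" by (rule res_mass_le[OF F that])
    finally show ?thesis .
  qed
  have "(\<integral>\<^sup>+x. ennreal x * iter f n l x \<partial>lborel) \<le> C1 * ennreal (w l)" for n using l
  proof (induction n arbitrary: l)
    case (Suc n)
    have "(\<integral>\<^sup>+x. ennreal x * iter f (Suc n) l x \<partial>lborel)
        = ((\<integral>\<^sup>+x. ennreal x * f l x \<partial>lborel) + (\<Sum>j<K. ennreal (p l j) * ((\<integral>\<^sup>+y. ennreal y \<partial>\<nu> l) * (\<integral>\<^sup>+x. iter f n j x \<partial>lborel))))
          + (\<Sum>j<K. ennreal (p l j) * (\<integral>\<^sup>+x. ennreal x * iter f n j x \<partial>lborel))"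
      unfolding iter_moment_Suc[OF Suc.prems] by (simp add: distrib_left sum.distrib add_ac)
    also have "\<dots> \<le> C1 * ennreal (w l)"
    proof (intro supersolution_step Suc)
      have "(\<Sum>j<K. ennreal (p l j) * ((\<integral>\<^sup>+y. ennreal y \<partial>\<nu> l) * (\<integral>\<^sup>+x. iter f n j x \<partial>lborel)))
          \<le> (\<Sum>j<K. ennreal (p l j) * (ennreal b * (ennreal C * ennreal (w j))))"
        using b Suc.prems im by (intro sum_mono mult_left_mono mult_mono) auto
      also have "\<dots> \<le> (\<Sum>l<K. \<Sum>j<K. ennreal (p l j) * (ennreal b * (ennreal C * ennreal (w j))))"
        using Suc.prems by (intro member_le_sum) auto
      finally show "(\<integral>\<^sup>+x. ennreal x * f l x \<partial>lborel) + (\<Sum>j<K. ennreal (p l j) * ((\<integral>\<^sup>+y. ennreal y \<partial>\<nu> l) * (\<integral>\<^sup>+x. iter f n j x \<partial>lborel))) \<le> C1"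
        unfolding C1_def using F1 Suc.prems by (intro add_mono) auto
    qed
    finally show ?case .
  qed simp
  moreover have "(\<integral>\<^sup>+x. ennreal x * res f l x \<partial>lborel) = (SUP n. \<integral>\<^sup>+x. ennreal x * iter f n l x \<partial>lborel)"
    using nn_integral_res[OF l, of lborel "\<lambda>x. x" ennreal] by simp
  ultimately have "(\<integral>\<^sup>+x. ennreal x * res f l x \<partial>lborel) \<le> C1 * ennreal (w l)" by (simp add: SUP_least)
  also have "\<dots> < \<infinity>" using C1 by (simp add: ennreal_mult_less_top)
  finally show ?thesis .
qed

text \<open>Pointwise analogue of the moment bound: under the convolution the weight splits as x =
  (x - y) + y, the first part reproducing the weighted iterate and the second giving the mean
  service time as a source. The outcome is decay of order 1/x.\<close>

lemma res_decay:
  assumes F: "\<And>l x. l < K \<Longrightarrow> f l x \<le> 1"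
    and F1: "\<And>l x. l < K \<Longrightarrow> ennreal x * f l x \<le> ennreal b"
    and b: "\<And>l. l < K \<Longrightarrow> (\<integral>\<^sup>+y. ennreal y \<partial>\<nu> l) \<le> ennreal b"
  obtains C :: real where "0 \<le> C" "\<And>l x. l < K \<Longrightarrow> ennreal x * res f l x \<le> ennreal C"
proof -
  define C1 where "C1 = ennreal b + (\<Sum>l<K. \<Sum>j<K. ennreal (p l j) * (ennreal b * ennreal (w j)))"
  have C1: "C1 < \<infinity>" by (simp add: C1_def ennreal_mult_less_top)
  have im: "iter f n j x \<le> ennreal (w j)" if "j < K" for n j x
  proof -
    have "iter f n j x \<le> res f j x" unfolding res_def by (intro SUP_upper) auto
    also have "\<dots> \<le> 1 * ennreal (w j)" by (rule res_le[OF F that])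
    finally show ?thesis by simp
  qed
  have it: "ennreal x * iter f n l x \<le> C1 * ennreal (w l)" if "l < K" for n l x using that
  proof (induction n arbitrary: l x)
    case (Suc n)
    interpret prob_space "\<nu> l" by (rule nu_prob[OF Suc.prems])
    note [measurable_cong] = nu_sets[OF Suc.prems]
    have conv: "ennreal x * (\<integral>\<^sup>+y. iter f n j (x - y) \<partial>\<nu> l) \<le> C1 * ennreal (w j) + ennreal b * ennreal (w j)"
      if j: "j < K" for j
    proof -
      note [measurable] = iter_meas[OF j]
      have "ennreal x * (\<integral>\<^sup>+y. iter f n j (x - y) \<partial>\<nu> l) = (\<integral>\<^sup>+y. ennreal x * iter f n j (x - y) \<partial>\<nu> l)"
        by (intro nn_integral_cmult[symmetric]) measurable
      also have "\<dots> \<le> (\<integral>\<^sup>+y. C1 * ennreal (w j) + ennreal y * ennreal (w j) \<partial>\<nu> l)"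
      proof (rule nn_integral_mono_AE)
        show "AE y in \<nu> l. ennreal x * iter f n j (x - y) \<le> C1 * ennreal (w j) + ennreal y * ennreal (w j)"
          using nu_pos[OF Suc.prems]
        proof eventually_elim
          fix y :: real assume y: "0 < y"
          \<comment> \<open>\<open>ennreal (x - y)\<close> truncates negative numbers, so the weight
            is split only where \<open>x - y\<close> is positive; elsewhere the iterate
            vanishes.\<close>
          show "ennreal x * iter f n j (x - y) \<le> C1 * ennreal (w j) + ennreal y * ennreal (w j)"
          proof (cases "x - y \<le> 0")
            case True
            then show ?thesis using iter_zero[OF j] by simp
          next
            case False
            have "ennreal x = ennreal (x - y) + ennreal y"
              using False y by (subst ennreal_plus[symmetric]) auto
            then have "ennreal x * iter f n j (x - y) = ennreal (x - y) * iter f n j (x - y) + ennreal y * iter f n j (x - y)"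
              by (simp add: distrib_right)
            also have "\<dots> \<le> C1 * ennreal (w j) + ennreal y * ennreal (w j)"
              using Suc.IH[OF j] im[OF j] by (intro add_mono mult_left_mono) auto
            finally show ?thesis .
          qed
        qed
      qed
      also have "\<dots> = C1 * ennreal (w j) + (\<integral>\<^sup>+y. ennreal y \<partial>\<nu> l) * ennreal (w j)"
        by (subst nn_integral_add) (auto simp: nn_integral_multc emeasure_space_1)
      also have "\<dots> \<le> C1 * ennreal (w j) + ennreal b * ennreal (w j)"
        using b Suc.prems by (intro add_mono mult_right_mono) auto
      finally show ?thesis .
    qed
    have "ennreal x * iter f (Suc n) l x = ennreal x * f l x
        + (\<Sum>j<K. ennreal (p l j) * (ennreal x * (\<integral>\<^sup>+y. iter f n j (x - y) \<partial>\<nu> l)))"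
      by (simp add: distrib_left sum_distrib_left mult_ac)
    also have "\<dots> \<le> ennreal b + (\<Sum>j<K. ennreal (p l j) * (C1 * ennreal (w j) + ennreal b * ennreal (w j)))"
      using conv F1 Suc.prems by (intro add_mono sum_mono mult_left_mono) auto
    also have "\<dots> = (ennreal b + (\<Sum>j<K. ennreal (p l j) * (ennreal b * ennreal (w j)))) + (\<Sum>j<K. ennreal (p l j) * (C1 * ennreal (w j)))"
      by (simp add: distrib_left sum.distrib add_ac)
    also have "\<dots> \<le> C1 * ennreal (w l)"
    proof (intro supersolution_step Suc)
      show "ennreal b + (\<Sum>j<K. ennreal (p l j) * (ennreal b * ennreal (w j))) \<le> C1"
        unfolding C1_def using Suc.prems
        by (intro add_left_mono member_le_sum[of l "{..<K}" "\<lambda>l. \<Sum>j<K. ennreal (p l j) * (ennreal b * ennreal (w j))"]) auto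
    qed auto
    finally show ?case .
  qed simp
  define C2 where "C2 = (\<Sum>l<K. C1 * ennreal (w l))"
  have C2: "C2 < \<infinity>" using C1 by (simp add: C2_def ennreal_mult_less_top)
  have "ennreal x * res f l x \<le> ennreal (enn2real C2)" if l: "l < K" for l x
  proof -
    have "ennreal x * res f l x = (SUP n. ennreal x * iter f n l x)"
      by (simp add: res_def SUP_mult_left_ennreal)
    also have "\<dots> \<le> C1 * ennreal (w l)" using it[OF l] by (intro SUP_least) auto
    also have "\<dots> \<le> C2" unfolding C2_def using l by (intro member_le_sum) auto
    also have "\<dots> = ennreal (enn2real C2)" using C2 by simp
    finally show ?thesis .
  qed
  then show thesis using that[of "enn2real C2"] by simp
qed

end

end

lemma res_mono:
  assumes "\<And>l x. l < K \<Longrightarrow> f l x \<le> f' l x" and "l < K"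
  shows "res f l x \<le> res f' l x"
proof -
  have "iter f n l x \<le> iter f' n l x" for n using assms(2)
  proof (induction n arbitrary: l x)
    case (Suc n)
    then show ?case unfolding iter.simps using assms(1)
      by (intro add_mono sum_mono mult_left_mono nn_integral_mono) auto
  qed simp
  then show ?thesis unfolding res_def by (intro SUP_mono) auto
qed

end

section \<open>Measures on the half line\<close>

text \<open>Open left half lines form an intersection-stable generator, so equality there extends to
  Borel sets and then to integrals. Finitely many weighted summands are allowed because the arrivals
  of a class superpose an external stream and the routed departures of all classes.\<close>

lemma nn_integral_eq_weighted_sum_of_cdf:
  fixes M :: "real measure" and N :: "'i \<Rightarrow> real measure" and c :: "'i \<Rightarrow> real"
  assumes I: "finite I" and M: "finite_measure M" "sets M = sets borel"
    and N: "\<And>i. i \<in> I \<Longrightarrow> finite_measure (N i)" "\<And>i. i \<in> I \<Longrightarrow> sets (N i) = sets borel"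
    and c: "\<And>i. i \<in> I \<Longrightarrow> 0 \<le> c i"
    and cdf: "\<And>y. emeasure M {..<y} = (\<Sum>i\<in>I. ennreal (c i) * emeasure (N i) {..<y})"
    and F: "F \<in> borel_measurable borel"
  shows "(\<integral>\<^sup>+x. F x \<partial>M) = (\<Sum>i\<in>I. ennreal (c i) * (\<integral>\<^sup>+x. F x \<partial>N i))"
proof -
  have sp: "space M = UNIV" "\<And>i. i \<in> I \<Longrightarrow> space (N i) = UNIV"
    using M(2) N(2) by (metis sets_eq_imp_space_eq space_borel)+
  have cdf': "measure M {..<y} = (\<Sum>i\<in>I. c i * measure (N i) {..<y})" for y
  proof -
    have "ennreal (measure M {..<y}) = (\<Sum>i\<in>I. ennreal (c i) * ennreal (measure (N i) {..<y}))"
      using cdf[of y] N(1) by (simp add: finite_measure.emeasure_eq_measure[OF M(1)] finite_measure.emeasure_eq_measure)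
    also have "\<dots> = (\<Sum>i\<in>I. ennreal (c i * measure (N i) {..<y}))"
      using c by (intro sum.cong) (auto simp: ennreal_mult)
    also have "\<dots> = ennreal (\<Sum>i\<in>I. c i * measure (N i) {..<y})"
      using c by (intro sum_ennreal) auto
    finally show ?thesis using c by (subst (asm) ennreal_inj) (auto intro!: sum_nonneg)
  qed
  \<comment> \<open>The generator does not contain the whole line; the total masses, needed for
    complements, are limits along \<open>{..<real n}\<close>.\<close>
  have lim: "(\<lambda>n. measure L {..<real n}) \<longlonglongrightarrow> measure L UNIV" if "finite_measure L" "sets L = sets borel" for L :: "real measure"
  proof -
    interpret finite_measure L by (rule that(1))
    have "(\<lambda>n. measure L {..<real n}) \<longlonglongrightarrow> measure L (\<Union>n. {..<real n})"
    proof (rule finite_Lim_measure_incseq)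
      show "range (\<lambda>n. {..<real n}) \<subseteq> sets L" unfolding that(2) by auto
      show "incseq (\<lambda>n. {..<real n})" unfolding incseq_def by auto
    qed
    moreover have "(\<Union>n. {..<real n}) = UNIV"
      by (intro equalityI subsetI UNIV_I) (metis UN_iff UNIV_I lessThan_iff reals_Archimedean2)
    ultimately show ?thesis by simp
  qed
  have tot: "measure M UNIV = (\<Sum>i\<in>I. c i * measure (N i) UNIV)"
  proof -
    have "(\<lambda>n. \<Sum>i\<in>I. c i * measure (N i) {..<real n}) \<longlonglongrightarrow> (\<Sum>i\<in>I. c i * measure (N i) UNIV)"
      using N lim by (intro tendsto_sum tendsto_mult_left) auto
    then have "(\<lambda>n. measure M {..<real n}) \<longlonglongrightarrow> (\<Sum>i\<in>I. c i * measure (N i) UNIV)"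
      by (simp only: cdf')
    then show ?thesis using lim[OF M] LIMSEQ_unique by blast
  qed
  have meas: "measure M X = (\<Sum>i\<in>I. c i * measure (N i) X)" if "X \<in> sets borel" for X
  proof -
    have "Int_stable (range lessThan :: real set set)"
    proof (rule Int_stableI)
      fix X Y :: "real set" assume "X \<in> range lessThan" "Y \<in> range lessThan"
      then obtain a b where "X = {..<a}" "Y = {..<b}" by blast
      then have "X \<inter> Y = {..<min a b}" by auto
      then show "X \<inter> Y \<in> range lessThan" by blast
    qed
    moreover have "range lessThan \<subseteq> Pow (UNIV :: real set)" by simp
    moreover have "X \<in> sigma_sets UNIV (range lessThan)"
      using that unfolding borel_Iio by (simp add: sets_measure_of)
    ultimately show ?thesis
    proof (induction X rule: sigma_sets_induct_disjoint[of "range lessThan" UNIV])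
      case (compl X)
      have X: "X \<in> sets borel" using compl unfolding borel_Iio by (simp add: sets_measure_of)
      have "measure M (UNIV - X) = measure M UNIV - measure M X"
        using finite_measure.finite_measure_compl[OF M(1), of X] X M sp by simp
      moreover have "measure (N i) (UNIV - X) = measure (N i) UNIV - measure (N i) X" if "i \<in> I" for i
        using finite_measure.finite_measure_compl[OF N(1)[OF that], of X] X N[OF that] sp that by simp
      ultimately show ?case using compl tot by (simp add: right_diff_distrib sum_subtractf)
    next
      case (union X)
      have X: "range X \<subseteq> sets borel" using union unfolding borel_Iio by (simp add: sets_measure_of)
      have "(\<lambda>n. measure M (X n)) sums measure M (\<Union>n. X n)"
        using union X M by (intro finite_measure.finite_measure_UNION) auto
      moreover have "(\<lambda>n. \<Sum>i\<in>I. c i * measure (N i) (X n)) sums (\<Sum>i\<in>I. c i * measure (N i) (\<Union>n. X n))"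
        using union X N by (intro sums_sum sums_mult finite_measure.finite_measure_UNION) auto
      ultimately show ?case using union(3) by (simp add: sums_unique2)
    qed (auto simp: cdf')
  qed
  have emeas: "emeasure M X = (\<Sum>i\<in>I. ennreal (c i) * emeasure (N i) X)" if "X \<in> sets borel" for X
  proof -
    have "emeasure M X = ennreal (\<Sum>i\<in>I. c i * measure (N i) X)"
      using meas[OF that] by (simp add: finite_measure.emeasure_eq_measure[OF M(1)])
    also have "\<dots> = (\<Sum>i\<in>I. ennreal (c i * measure (N i) X))" using c by (intro sum_ennreal[symmetric]) auto
    also have "\<dots> = (\<Sum>i\<in>I. ennreal (c i) * emeasure (N i) X)"
      using c N(1) by (intro sum.cong) (auto simp: ennreal_mult finite_measure.emeasure_eq_measure)
    finally show ?thesis .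
  qed
  have mM: "(borel_measurable M :: (real \<Rightarrow> ennreal) set) = borel_measurable borel"
    "\<And>i. i \<in> I \<Longrightarrow> (borel_measurable (N i) :: (real \<Rightarrow> ennreal) set) = borel_measurable borel"
    using M(2) N(2) by (auto intro!: measurable_cong_sets)
  from F show ?thesis
  proof (induction F rule: borel_measurable_induct)
    case (cong f g)
    then have "f = g" by auto
    then show ?case using cong by simp
  next
    case (set X)
    then show ?case using emeas M(2) N(2) by simp
  next
    case (mult u a)
    have "(\<integral>\<^sup>+x. a * u x \<partial>M) = a * (\<Sum>i\<in>I. ennreal (c i) * (\<integral>\<^sup>+x. u x \<partial>N i))"
      using mult mM by (subst nn_integral_cmult) simp_all
    also have "\<dots> = (\<Sum>i\<in>I. ennreal (c i) * (a * (\<integral>\<^sup>+x. u x \<partial>N i)))"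
      by (simp add: sum_distrib_left mult_ac)
    also have "\<dots> = (\<Sum>i\<in>I. ennreal (c i) * (\<integral>\<^sup>+x. a * u x \<partial>N i))"
      using mult mM by (intro sum.cong refl arg_cong2[where f="(*)"] nn_integral_cmult[symmetric]) simp
    finally show ?case .
  next
    case (add u v)
    have "(\<integral>\<^sup>+x. v x + u x \<partial>M) = (\<Sum>i\<in>I. ennreal (c i) * (\<integral>\<^sup>+x. v x \<partial>N i)) + (\<Sum>i\<in>I. ennreal (c i) * (\<integral>\<^sup>+x. u x \<partial>N i))"
      using add mM by (subst nn_integral_add) simp_all
    also have "\<dots> = (\<Sum>i\<in>I. ennreal (c i) * ((\<integral>\<^sup>+x. v x \<partial>N i) + (\<integral>\<^sup>+x. u x \<partial>N i)))"
      by (simp add: sum.distrib distrib_left)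
    also have "\<dots> = (\<Sum>i\<in>I. ennreal (c i) * (\<integral>\<^sup>+x. v x + u x \<partial>N i))"
      using add mM by (intro sum.cong refl arg_cong2[where f="(*)"] nn_integral_add[symmetric]) simp_all
    finally show ?case .
  next
    case (seq U)
    have IH: "(\<integral>\<^sup>+x. U n x \<partial>M) = (\<Sum>i\<in>I. ennreal (c i) * (\<integral>\<^sup>+x. U n x \<partial>N i))" for n using seq by blast
    have "(\<integral>\<^sup>+x. (SUP i. U i) x \<partial>M) = (SUP n. \<integral>\<^sup>+x. U n x \<partial>M)"
      using seq mM unfolding SUP_apply by (intro nn_integral_monotone_convergence_SUP) auto
    moreover have inc: "incseq (\<lambda>n. \<integral>\<^sup>+x. U n x \<partial>L)" for L
      using \<open>incseq U\<close> by (auto simp: incseq_def le_fun_def intro!: nn_integral_mono)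
    then have "(\<lambda>n. \<integral>\<^sup>+x. U n x \<partial>M) \<longlonglongrightarrow> (SUP n. \<integral>\<^sup>+x. U n x \<partial>M)" by (rule LIMSEQ_SUP)
    ultimately have 1: "(\<lambda>n. \<Sum>i\<in>I. ennreal (c i) * (\<integral>\<^sup>+x. U n x \<partial>N i)) \<longlonglongrightarrow> (\<integral>\<^sup>+x. (SUP i. U i) x \<partial>M)"
      unfolding IH by simp
    have "(\<integral>\<^sup>+x. (SUP i. U i) x \<partial>N i) = (SUP n. \<integral>\<^sup>+x. U n x \<partial>N i)" if "i \<in> I" for i
      using seq mM that unfolding SUP_apply by (intro nn_integral_monotone_convergence_SUP) auto
    then have "(\<lambda>n. \<Sum>i\<in>I. ennreal (c i) * (\<integral>\<^sup>+x. U n x \<partial>N i)) \<longlonglongrightarrow> (\<Sum>i\<in>I. ennreal (c i) * (\<integral>\<^sup>+x. (SUP i. U i) x \<partial>N i))"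
      using inc LIMSEQ_SUP by (intro tendsto_sum ennreal_tendsto_cmult) auto
    with 1 show ?case by (rule LIMSEQ_unique)
  qed
qed

lemma measurable_measure_atLeast:
  fixes M :: "real measure"
  assumes "finite_measure M" "sets M = sets borel"
  shows "(\<lambda>x. measure M {x..}) \<in> borel_measurable borel"
proof -
  interpret finite_measure M by (rule assms(1))
  have "mono (\<lambda>x. - measure M {x..})"
    using assms(2) by (auto intro!: monoI finite_measure_mono)
  then have "(\<lambda>x. - (- measure M {x..})) \<in> borel_measurable borel"
    by (intro borel_measurable_uminus borel_measurable_mono)
  then show ?thesis by simp
qed

lemma measurable_measure_lessThan:
  fixes M :: "real measure"
  assumes "finite_measure M" "sets M = sets borel"
  shows "(\<lambda>x. measure M {..<x}) \<in> borel_measurable borel"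
proof -
  interpret finite_measure M by (rule assms(1))
  have "mono (\<lambda>x. measure M {..<x})"
  proof (rule monoI)
    fix x y :: real assume "x \<le> y"
    then have "{..<x} \<subseteq> {..<y}" by auto
    then show "measure M {..<x} \<le> measure M {..<y}" by (rule finite_measure_mono) (simp add: assms(2))
  qed
  then show ?thesis by (rule borel_measurable_mono)
qed

lemma is_meas_split:
  assumes "is_meas M"
  shows "finite_measure M" "sets M = sets borel" "space M = UNIV"
    "mass M = measure M {0..}" "mass M = measure M {..<y} + measure M {y..}" "y \<le> 0 \<Longrightarrow> measure M {..<y} = 0"
proof -
  show fin: "finite_measure M" and s: "sets M = sets borel" using assms by (auto simp: is_meas_def)
  show sp: "space M = UNIV" using s by (metis sets_eq_imp_space_eq space_borel)
  interpret finite_measure M by (rule fin)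
  have split: "mass M = measure M {..<y} + measure M {y..}" for y
  proof -
    have "UNIV = {..<y} \<union> {y..}" by auto
    then have "mass M = measure M ({..<y} \<union> {y..})" by (simp add: mass_def sp)
    also have "\<dots> = measure M {..<y} + measure M {y..}"
      using s by (intro finite_measure_Union) auto
    finally show ?thesis .
  qed
  have neg: "measure M {..<y} = 0" if "y \<le> 0" for y
  proof -
    have "emeasure M {..<y} \<le> emeasure M {..<0}" using that s by (intro emeasure_mono) auto
    then show ?thesis using assms by (simp add: is_meas_def measure_def)
  qed
  show "mass M = measure M {..<y} + measure M {y..}" by (rule split)
  show "y \<le> 0 \<Longrightarrow> measure M {..<y} = 0" by (rule neg)
  show "mass M = measure M {0..}" using split[of 0] neg[of 0] by simp
qed

section \<open>The processor sharing clock\<close>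

locale fluid_path = feedback +
  fixes \<alpha> :: "nat \<Rightarrow> real" and \<xi> :: "nat \<Rightarrow> real measure"
    and A D :: "real \<Rightarrow> nat \<Rightarrow> real" and \<mu> :: "real \<Rightarrow> nat \<Rightarrow> real measure"
  assumes alpha_nonneg: "\<And>k. k < K \<Longrightarrow> 0 \<le> \<alpha> k"
    and nu_meas: "\<And>k. k < K \<Longrightarrow> is_meas (\<nu> k)"
    and xi_meas: "\<And>k. k < K \<Longrightarrow> is_meas (\<xi> k)"
    and mu_meas: "\<And>t k. 0 \<le> t \<Longrightarrow> k < K \<Longrightarrow> is_meas (\<mu> t k)"
    and A_cont: "\<And>k. k < K \<Longrightarrow> continuous_on {0..} (\<lambda>t. A t k)"
    and D_cont: "\<And>k. k < K \<Longrightarrow> continuous_on {0..} (\<lambda>t. D t k)"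
    and A_mono: "\<And>k. k < K \<Longrightarrow> mono_on {0..} (\<lambda>t. A t k)"
    and D_mono: "\<And>k. k < K \<Longrightarrow> mono_on {0..} (\<lambda>t. D t k)"
    and mu_0: "\<And>k. k < K \<Longrightarrow> \<mu> 0 k = \<xi> k"
    and A_eq: "\<And>t k. 0 \<le> t \<Longrightarrow> k < K \<Longrightarrow> A t k = \<alpha> k * t + (\<Sum>j<K. p j k * D t j)"
    and mass_eq: "\<And>t k. 0 \<le> t \<Longrightarrow> k < K \<Longrightarrow> mass (\<mu> t k) = mass (\<xi> k) + A t k - D t k"
    and S_fin: "\<And>t. 0 \<le> t \<Longrightarrow> Sint K \<mu> t < \<infinity>"
    and dyn: "\<And>t x k. 0 \<le> t \<Longrightarrow> 0 \<le> x \<Longrightarrow> k < K \<Longrightarrow>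
        measure (\<mu> t k) {x..} = measure (\<xi> k) {x + Sbar K \<mu> t..}
          + (LINT s:{0..t}|interval_measure (\<lambda>s. A (max 0 s) k).
               measure (\<nu> k) {x + (Sbar K \<mu> t - Sbar K \<mu> s)..})"
    and mass_pos: "0 < (\<Sum>k<K. mass (\<xi> k))"
begin

definition z :: "real \<Rightarrow> real" where "z t = (\<Sum>k<K. mass (\<mu> t k))"

abbreviation S :: "real \<Rightarrow> real" where "S \<equiv> Sbar K \<mu>"

definition dA :: "nat \<Rightarrow> real measure" where "dA k = interval_measure (\<lambda>s. A (max 0 s) k)"

text \<open>\<open>\<mu>\<close> is arbitrary at negative times; the indicator sends those times to
  \<open>phi 0 = 0\<close> and makes the integrand measurable on the whole line.\<close>

definition rate :: "real \<Rightarrow> real" where "rate s = phi (indicator {0..} s * z s)"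

lemma z_nonneg: "0 \<le> z t" by (simp add: z_def mass_def sum_nonneg)

lemma z_cont: "continuous_on {0..} z"
proof -
  have "continuous_on {0..} (\<lambda>t. \<Sum>k<K. mass (\<xi> k) + A t k - D t k)"
    using A_cont D_cont by (intro continuous_intros) auto
  then show ?thesis
    by (rule continuous_on_cong[THEN iffD1, rotated -1]) (auto simp: z_def mass_eq)
qed

lemma z_0: "0 < z 0" using mass_pos mu_0 by (simp add: z_def)

lemma rate_meas[measurable]: "rate \<in> borel_measurable borel"
proof -
  have [measurable]: "(\<lambda>s. indicator {0..} s *\<^sub>R z s) \<in> borel_measurable borel"
    by (rule borel_measurable_continuous_on_indicator[OF _ z_cont]) simp
  have "(\<lambda>s. phi (indicator {0..} s *\<^sub>R z s)) \<in> borel_measurable borel"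
    unfolding phi_def by measurable
  then show ?thesis by (simp add: rate_def[abs_def])
qed

lemma rate_nonneg: "0 \<le> rate s" by (simp add: rate_def phi_def)

lemma rate_eq: "0 \<le> s \<Longrightarrow> rate s = phi (z s)" by (simp add: rate_def)

lemma Sint_eq: "Sint K \<mu> t = (\<integral>\<^sup>+s\<in>{0..t}. ennreal (rate s) \<partial>lborel)"
  unfolding Sint_def z_def[symmetric]
  by (intro nn_integral_cong) (auto simp: rate_eq split: split_indicator)

lemma ennreal_S: "0 \<le> t \<Longrightarrow> ennreal (S t) = (\<integral>\<^sup>+s\<in>{0..t}. ennreal (rate s) \<partial>lborel)"
  using S_fin[of t] by (simp add: Sbar_def Sint_eq)

lemma S_neg: "t \<le> 0 \<Longrightarrow> S t = 0"
proof -
  assume "t \<le> 0"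
  then have "AE s in lborel. ennreal (rate s) * indicator {0..t} s = 0"
    using AE_lborel_singleton[of 0] by (auto elim!: eventually_mono split: split_indicator)
  then have "(\<integral>\<^sup>+s\<in>{0..t}. ennreal (rate s) \<partial>lborel) = 0" by (subst nn_integral_0_iff_AE) auto
  then show ?thesis by (simp add: Sbar_def Sint_eq)
qed

lemma S_nonneg: "0 \<le> S t" by (simp add: Sbar_def)

lemma S_integral: "0 \<le> b \<Longrightarrow> rate integrable_on {0..b}" "0 \<le> t \<Longrightarrow> S t = integral {0..t} rate"
proof -
  have si: "set_integrable lborel {0..b} rate" if "0 \<le> b" for b
    unfolding set_integrable_def
    using ennreal_S[OF that] S_nonneg rate_nonneg
    by (intro integrableI_nn_integral_finite[where x="S b"]) (auto simp: ennreal_mult ennreal_indicator mult.commute)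
  show "rate integrable_on {0..b}" if "0 \<le> b" using set_borel_integral_eq_integral(1)[OF si[OF that]] .
  show "S t = integral {0..t} rate" if t: "0 \<le> t"
  proof -
    have "ennreal (S t) = ennreal (LINT s:{0..t}|lborel. rate s)"
      unfolding set_lebesgue_integral_def ennreal_S[OF t]
      using si[OF t] rate_nonneg unfolding set_integrable_def
      by (subst nn_integral_eq_integral[symmetric]) (auto simp: ennreal_mult ennreal_indicator mult.commute)
    moreover have "0 \<le> (LINT s:{0..t}|lborel. rate s)"
      unfolding set_lebesgue_integral_def using rate_nonneg by (intro integral_nonneg_AE) auto
    ultimately show ?thesis
      using set_borel_integral_eq_integral(2)[OF si[OF t]] S_nonneg by (subst (asm) ennreal_inj) auto
  qed
qed

lemma S_cont: "continuous_on {0..} S"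
proof -
  have "continuous_on {0..b} S" if "0 \<le> b" for b
    using indefinite_integral_continuous_1[OF S_integral(1)[OF that]]
    by (rule continuous_on_cong[THEN iffD1, rotated -1]) (auto simp: S_integral(2))
  then have "continuous (at t within {0..}) S" if "0 \<le> t" for t
  proof -
    have "continuous (at t within {0..t + 1}) S"
      using \<open>\<And>b. 0 \<le> b \<Longrightarrow> continuous_on {0..b} S\<close>[of "t + 1"] that
      by (auto simp: continuous_on_eq_continuous_within)
    moreover have "at t within {0..t + 1} = at t within {0..}"
      by (rule at_within_nhd[of t "{..<t + 1}"]) (use that in auto)
    ultimately show ?thesis by simp
  qed
  then show ?thesis by (auto simp: continuous_on_eq_continuous_within)
qed

lemma S_mono: "s \<le> t \<Longrightarrow> S s \<le> S t"
proof -
  assume st: "s \<le> t"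
  show ?thesis
  proof (cases "s \<le> 0")
    case True
    then show ?thesis using S_neg S_nonneg by simp
  next
    case False
    have "ennreal (S s) \<le> ennreal (S t)"
      using False st unfolding ennreal_S[of s] by (subst ennreal_S)
        (auto simp: ennreal_S intro!: nn_integral_mono split: split_indicator)
    then show ?thesis using S_nonneg by simp
  qed
qed

lemma S_meas[measurable]: "S \<in> borel_measurable borel"
  by (rule borel_measurable_mono) (auto intro!: monoI S_mono)

text \<open>Positivity is asked only before \<open>t\<close>, so that the estimate reaches up to a
  possible first zero of \<open>z\<close>.\<close>

lemma S_diff_ge:
  assumes pos: "\<And>r. 0 \<le> r \<Longrightarrow> r < t \<Longrightarrow> 0 < z r \<and> z r \<le> C" and st: "0 \<le> s" "s \<le> t" and C: "0 < C"
  shows "(t - s) / C \<le> S t - S s"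
proof -
  have i: "rate integrable_on {s..t}"
    by (rule integrable_subinterval_real[OF S_integral(1)[of t]]) (use st in auto)
  have "integral {0..s} rate + integral {s..t} rate = integral {0..t} rate"
    using st S_integral(1)[of t] by (intro Henstock_Kurzweil_Integration.integral_combine) auto
  then have "S t - S s = integral {s..t} rate" using st by (simp add: S_integral(2))
  \<comment> \<open>At \<open>t\<close> itself \<open>z\<close> may vanish, where \<open>phi\<close>
    is 0 instead of large; one point is altered to keep the pointwise comparison.\<close>
  also have "\<dots> = integral {s..t} (\<lambda>r. if r = t then 1 / C else rate r)"
    by (rule integral_spike[of "{t}"]) auto
  also have "\<dots> \<ge> integral {s..t} (\<lambda>r. 1 / C)"
  proof (rule integral_le)
    show "(\<lambda>r. if r = t then 1 / C else rate r) integrable_on {s..t}"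
      using i by (rule integrable_spike[of _ _ "{t}"]) auto
    fix r assume r: "r \<in> {s..t}"
    show "1 / C \<le> (if r = t then 1 / C else rate r)"
    proof (cases "r = t")
      case False
      then have "0 < z r" "z r \<le> C" using pos[of r] r st by auto
      then show ?thesis using False r st C by (simp add: rate_eq phi_def frac_le)
    qed simp
  qed auto
  finally show ?thesis using st by simp
qed

lemma z_bdd: "\<exists>C>0. \<forall>r\<in>{0..t}. z r \<le> C"
proof -
  have "compact (z ` {0..t})"
    by (intro compact_continuous_image continuous_on_subset[OF z_cont]) auto
  then obtain C where "\<forall>y\<in>z ` {0..t}. \<bar>y\<bar> \<le> C" using compact_imp_bounded bounded_real by metis
  then show ?thesis by (intro exI[of _ "max C 1"]) (force simp: le_max_iff_disj)
qed

lemma S_strict: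
  assumes pos: "\<And>r. 0 \<le> r \<Longrightarrow> r < T \<Longrightarrow> 0 < z r" and st: "0 \<le> s" "s < t" "t \<le> T"
  shows "S s < S t"
proof -
  obtain C where C: "0 < C" "\<And>r. r \<in> {0..t} \<Longrightarrow> z r \<le> C" using z_bdd by blast
  have "(t - s) / C \<le> S t - S s" using C pos st by (intro S_diff_ge) auto
  moreover have "0 < (t - s) / C" using st C by simp
  ultimately show ?thesis by linarith
qed

text \<open>The clock has density \<open>rate\<close>, and by strict monotonicity the event
  \<open>S s < y\<close> with y = S t is \<open>s < t\<close>. So the image under \<open>S\<close>
  of \<open>rate\<close> times Lebesgue measure on [0, T) has the distribution function of Lebesgue
  measure on [0, S T).\<close>

lemma push_lebesgue:
  assumes pos: "\<And>r. 0 \<le> r \<Longrightarrow> r < T \<Longrightarrow> 0 < z r" and T: "0 \<le> T"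
    and [measurable]: "F \<in> borel_measurable borel"
  shows "(\<integral>\<^sup>+s\<in>{0..<T}. F (S s) * ennreal (rate s) \<partial>lborel) = (\<integral>\<^sup>+v\<in>{0..<S T}. F v \<partial>lborel)"
proof -
  define M where "M = distr (density lborel (\<lambda>s. ennreal (rate s) * indicator {0..<T} s)) borel S"
  define N where "N = density lborel (indicator {0..<S T} :: real \<Rightarrow> ennreal)"
  have Ico: "(\<integral>\<^sup>+s\<in>{0..<t}. ennreal (rate s) \<partial>lborel) = ennreal (S t)" if "0 \<le> t" for t
    unfolding ennreal_S[OF that] using AE_lborel_singleton[of t]
    by (intro nn_integral_cong_AE) (auto elim!: eventually_mono split: split_indicator)
  have M_eq: "emeasure M {..<y} = (\<integral>\<^sup>+s. ennreal (rate s) * indicator {0..<T} s * indicator {..<y} (S s) \<partial>lborel)" for y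
  proof -
    have "emeasure M {..<y} = (\<integral>\<^sup>+x. indicator {..<y} x \<partial>M)" by (simp add: M_def)
    then show ?thesis unfolding M_def
      by (simp add: nn_integral_distr nn_integral_density del: nn_integral_indicator)
  qed
  have N_eq: "emeasure N {..<y} = emeasure lborel ({0..<S T} \<inter> {..<y})" for y
    unfolding N_def by (subst emeasure_density) (auto simp flip: indicator_inter_arith)
  have cdf: "emeasure M {..<y} = emeasure N {..<y}" for y
  proof -
    consider "y \<le> 0" | "0 < y" "y \<le> S T" | "S T < y" by linarith
    then show ?thesis
    proof cases
      case 1
      then have "\<not> S s < y" for s using S_nonneg[of s] by linarith
      then have "emeasure M {..<y} = 0" unfolding M_eq by simp
      moreover have "{0..<S T} \<inter> {..<y} = {}" using 1 by auto
      ultimately show ?thesis unfolding N_eq by simp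
    next
      case 2
      have "\<exists>t\<ge>0. t \<le> T \<and> S t = y"
        using 2 T S_neg[of 0] continuous_on_subset[OF S_cont, of "{0..T}"] by (intro IVT') auto
      then obtain t where t: "0 \<le> t" "t \<le> T" "S t = y" by blast
      have "s < t \<longleftrightarrow> S s < y" if "0 \<le> s" "s < T" for s
        using S_strict[of T s t, OF pos] S_mono[of t s] that t by linarith
      then have "emeasure M {..<y} = (\<integral>\<^sup>+s\<in>{0..<t}. ennreal (rate s) \<partial>lborel)"
        unfolding M_eq using t by (intro nn_integral_cong) (auto split: split_indicator)
      also have "\<dots> = ennreal y" using Ico[OF t(1)] t by simp
      finally have "emeasure M {..<y} = ennreal y" .
      moreover have "{0..<S T} \<inter> {..<y} = {0..<y}" using 2 by auto
      ultimately show ?thesis unfolding N_eq using 2 by simp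
    next
      case 3
      have "S s < y" if "s < T" for s using S_mono[of s T] that 3 by linarith
      then have "emeasure M {..<y} = (\<integral>\<^sup>+s\<in>{0..<T}. ennreal (rate s) \<partial>lborel)"
        unfolding M_eq by (intro nn_integral_cong) (auto split: split_indicator)
      moreover have "{0..<S T} \<inter> {..<y} = {0..<S T}" using 3 by auto
      ultimately show ?thesis unfolding N_eq using Ico[OF T] S_nonneg by simp
    qed
  qed
  have "finite_measure M" "finite_measure N"
    using Ico[OF T] S_nonneg
    by (auto intro!: finite_measureI simp: M_def N_def emeasure_density emeasure_distr)
  then have "(\<integral>\<^sup>+x. F x \<partial>M) = (\<Sum>i\<in>{()}. ennreal 1 * (\<integral>\<^sup>+x. F x \<partial>N))"
    by (intro nn_integral_eq_weighted_sum_of_cdf) (simp_all add: cdf, simp_all add: M_def N_def)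
  then show ?thesis
    by (simp add: M_def N_def nn_integral_distr nn_integral_density mult_ac)
qed

section \<open>Arrival measures and departures\<close>

lemma dA_cdf_cont: "k < K \<Longrightarrow> continuous_on UNIV (\<lambda>s. A (max 0 s) k)"
  by (intro continuous_on_compose2[OF A_cont] continuous_intros) auto

lemma dA_cdf_mono: "k < K \<Longrightarrow> x \<le> y \<Longrightarrow> A (max 0 x) k \<le> A (max 0 y) k"
  using A_mono[of k] by (auto simp: mono_on_def)

lemma sets_dA[simp, measurable_cong]: "sets (dA k) = sets borel" by (simp add: dA_def)

lemma space_dA[simp]: "space (dA k) = UNIV" by (simp add: dA_def)

lemma dA_Icc: "k < K \<Longrightarrow> 0 \<le> s \<Longrightarrow> s \<le> t \<Longrightarrow> emeasure (dA k) {s..t} = ennreal (A t k - A s k)"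
  unfolding dA_def using emeasure_interval_measure_Icc[of s t, OF _ dA_cdf_mono[of k] dA_cdf_cont[of k]] by simp

lemma dA_singleton: "k < K \<Longrightarrow> 0 \<le> t \<Longrightarrow> AE s in dA k. s \<noteq> t"
  using dA_Icc[of k t t] by (auto intro!: AE_I[of _ _ "{t}"])

lemma dA_Ico:
  assumes k: "k < K" and t: "0 \<le> t" and [measurable]: "F \<in> borel_measurable borel"
  shows "(\<integral>\<^sup>+s\<in>{0..<t}. F s \<partial>dA k) = (\<integral>\<^sup>+s\<in>{0..t}. F s \<partial>dA k)"
  using dA_singleton[OF k t] by (intro nn_integral_cong_AE) (auto elim!: eventually_mono split: split_indicator)

lemma emeasure_dA_Ico: "k < K \<Longrightarrow> 0 \<le> t \<Longrightarrow> emeasure (dA k) {0..<t} = ennreal (A t k - A 0 k)"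
  using dA_Ico[of k t "\<lambda>_. 1"] dA_Icc[of k 0 t] by simp

lemma nu_tail_meas: "k < K \<Longrightarrow> (\<lambda>x. measure (\<nu> k) {x..}) \<in> borel_measurable borel"
  using nu_meas by (intro measurable_measure_atLeast is_meas_split)

lemma nu_head_meas: "k < K \<Longrightarrow> (\<lambda>x. measure (\<nu> k) {..<x}) \<in> borel_measurable borel"
  using nu_meas by (intro measurable_measure_lessThan is_meas_split)

lemma nu_mass: "k < K \<Longrightarrow> mass (\<nu> k) = 1"
  using prob_space.prob_space[OF nu_prob] by (simp add: mass_def)

lemma nu_le_1: "k < K \<Longrightarrow> measure (\<nu> k) X \<le> 1"
  using prob_space.prob_le_1[OF nu_prob] by simp

text \<open>The last instant carries no arrivals, so a half-open interval may be used; as long as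
  \<open>z\<close> has not vanished, \<open>S t - S s\<close> is positive on it, which matches
  kernels cut off at 0.\<close>

lemma dyn_nn:
  assumes k: "k < K" and t: "0 \<le> t" and x: "0 \<le> x"
  shows "ennreal (measure (\<mu> t k) {x..}) = ennreal (measure (\<xi> k) {x + S t..})
     + (\<integral>\<^sup>+s\<in>{0..<t}. ennreal (measure (\<nu> k) {x + (S t - S s)..}) \<partial>dA k)"
proof -
  note [measurable] = nu_tail_meas[OF k]
  let ?f = "\<lambda>s. measure (\<nu> k) {x + (S t - S s)..}"
  have int: "integrable (dA k) (\<lambda>s. indicator {0..t} s *\<^sub>R ?f s)"
  proof (rule Bochner_Integration.integrable_bound[of _ "indicator {0..t} :: real \<Rightarrow> real"])
    show "integrable (dA k) (indicator {0..t} :: real \<Rightarrow> real)"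
      using dA_Icc[OF k _ t] by (intro integrable_real_indicator) auto
    show "AE s in dA k. norm (indicator {0..t} s *\<^sub>R ?f s) \<le> norm (indicator {0..t} s :: real)"
      using nu_le_1[OF k] by (intro AE_I2) (auto split: split_indicator)
  qed measurable
  have "(\<integral>\<^sup>+s\<in>{0..<t}. ennreal (?f s) \<partial>dA k) = (\<integral>\<^sup>+s\<in>{0..t}. ennreal (?f s) \<partial>dA k)"
    using k t by (intro dA_Ico) measurable
  also have "\<dots> = (\<integral>\<^sup>+s. ennreal (indicator {0..t} s *\<^sub>R ?f s) \<partial>dA k)"
    by (intro nn_integral_cong) (auto split: split_indicator)
  also have "\<dots> = ennreal (LINT s:{0..t}|dA k. ?f s)"
    unfolding set_lebesgue_integral_def using int by (intro nn_integral_eq_integral) auto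
  finally show ?thesis
    unfolding dyn[OF t x k] dA_def[symmetric]
    by (subst ennreal_plus) (auto simp: set_lebesgue_integral_def intro!: integral_nonneg_AE)
qed

text \<open>A job has left by time t when its size is below the service attained since its arrival.
  The formula is the complement of the dynamic equation at \<open>x = 0\<close>, obtained by
  cancelling the finite mass still present.\<close>

lemma departures:
  assumes k: "k < K" and t: "0 \<le> t"
  shows "ennreal (D t k - D 0 k) = ennreal (measure (\<xi> k) {..<S t})
     + (\<integral>\<^sup>+s\<in>{0..<t}. ennreal (measure (\<nu> k) {..<S t - S s}) \<partial>dA k)"
proof -
  note [measurable] = nu_tail_meas[OF k] nu_head_meas[OF k]
  let ?I = "\<integral>\<^sup>+s\<in>{0..<t}. ennreal (measure (\<nu> k) {S t - S s..}) \<partial>dA k"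
  let ?J = "\<integral>\<^sup>+s\<in>{0..<t}. ennreal (measure (\<nu> k) {..<S t - S s}) \<partial>dA k"
  have zk: "ennreal (mass (\<mu> t k)) = ennreal (measure (\<xi> k) {S t..}) + ?I"
    using dyn_nn[OF k t, of 0] is_meas_split(4)[OF mu_meas[OF t k]] by simp
  have "ennreal (A t k - A 0 k) = (\<integral>\<^sup>+s. indicator {0..<t} s \<partial>dA k)"
    using emeasure_dA_Ico[OF k t] by simp
  also have "\<dots> = (\<integral>\<^sup>+s. ennreal (measure (\<nu> k) {S t - S s..}) * indicator {0..<t} s
      + ennreal (measure (\<nu> k) {..<S t - S s}) * indicator {0..<t} s \<partial>dA k)"
    using is_meas_split(5)[OF nu_meas[OF k]] nu_mass[OF k]
    by (intro nn_integral_cong) (auto split: split_indicator simp flip: ennreal_plus simp: add.commute)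
  also have "\<dots> = ?I + ?J" by (intro nn_integral_add) measurable
  finally have dA: "ennreal (A t k - A 0 k) = ?I + ?J" .
  \<comment> \<open>At time 0 the mass equation says that both counters agree, and everything is
    expressed through increments from there.\<close>
  have D0: "D 0 k = A 0 k" using mass_eq[OF _ k, of 0] mu_0[OF k] by simp
  have mono: "A 0 k \<le> A t k" "D 0 k \<le> D t k"
    using A_mono[OF k] D_mono[OF k] t by (auto simp: mono_on_def)
  have "ennreal (mass (\<mu> t k)) + ennreal (D t k - D 0 k) = ennreal (mass (\<xi> k)) + ennreal (A t k - A 0 k)"
  proof -
    have "mass (\<mu> t k) + (D t k - D 0 k) = mass (\<xi> k) + (A t k - A 0 k)" using mass_eq[OF t k] D0 by simp
    then show ?thesis using mono by (subst (1 2) ennreal_plus[symmetric]) (auto simp: mass_def)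
  qed
  also have "\<dots> = ennreal (measure (\<xi> k) {..<S t}) + ennreal (measure (\<xi> k) {S t..}) + (?I + ?J)"
    unfolding dA using is_meas_split(5)[OF xi_meas[OF k], of "S t"] by simp
  also have "\<dots> = ennreal (mass (\<mu> t k)) + (ennreal (measure (\<xi> k) {..<S t}) + ?J)"
    unfolding zk by (simp add: add_ac)
  finally show ?thesis unfolding ennreal_add_left_cancel by simp
qed

lemma finite_dA_Ico:
  assumes "k < K" "0 \<le> T"
  shows "finite_measure (density (dA k) (indicator {0..<T}))"
  using emeasure_dA_Ico[OF assms] by (intro finite_measureI) (simp add: emeasure_density)

text \<open>This is the traffic equation in clock time. A job of class j arriving at s with size y
  leaves at clock value \<open>S s + y\<close>, an initial job at \<open>y\<close>, and both join
  class k with weight \<open>p j k\<close>; on half lines \<open>{..<S t}\<close> the claim is the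
  equation for \<open>A\<close> combined with \<open>departures\<close>. \<open>F0\<close> discards
  what leaves after the horizon.\<close>

lemma arrival_identity:
  assumes pos: "\<And>r. 0 \<le> r \<Longrightarrow> r < T \<Longrightarrow> 0 < z r" and T: "0 \<le> T" and k: "k < K"
    and F[measurable]: "F \<in> borel_measurable borel" and F0: "\<And>v. S T \<le> v \<Longrightarrow> F v = 0"
  shows "(\<integral>\<^sup>+s\<in>{0..<T}. F (S s) \<partial>dA k) = ennreal (\<alpha> k) * (\<integral>\<^sup>+s\<in>{0..<T}. F (S s) \<partial>lborel)
     + (\<Sum>j<K. ennreal (p j k) * ((\<integral>\<^sup>+y. F y \<partial>\<xi> j) + (\<integral>\<^sup>+s\<in>{0..<T}. (\<integral>\<^sup>+y. F (S s + y) \<partial>\<nu> j) \<partial>dA j)))"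
proof -
  \<comment> \<open>Tag 0 is the external stream, tag 1 the initial jobs of class j, tag 2 the jobs
    of class j that arrived later.\<close>
  define I :: "(nat \<times> nat) set" where "I = insert (0, 0) ({1} \<times> {..<K} \<union> {2} \<times> {..<K})"
  define c :: "nat \<times> nat \<Rightarrow> real" where "c = (\<lambda>(a, j). if a = 0 then \<alpha> k else p j k)"
  define dT where "dT j = density (dA j) (indicator {0..<T})" for j
  define N where "N = (\<lambda>(a, j). if a = 0 then distr (density lborel (indicator {0..<T})) borel S
     else if a = (1::nat) then density (\<xi> j) (indicator {..<S T})
     else density (distr (dT j \<Otimes>\<^sub>M \<nu> j) borel (\<lambda>(s, y). S s + y)) (indicator {..<S T}))"
  define M where "M = distr (dT k) borel S"
  have sum_I: "(\<Sum>i\<in>I. f i) = f (0, 0) + (\<Sum>j<K. f (1, j)) + (\<Sum>j<K. f (2, j))" for f :: "nat \<times> nat \<Rightarrow> ennreal"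
  proof -
    have "(\<Sum>i\<in>I. f i) = f (0, 0) + (\<Sum>i\<in>{1} \<times> {..<K} \<union> {2} \<times> {..<K}. f i)"
      unfolding I_def by (subst sum.insert) auto
    also have "(\<Sum>i\<in>{1} \<times> {..<K} \<union> {2} \<times> {..<K}. f i) = (\<Sum>i\<in>{1} \<times> {..<K}. f i) + (\<Sum>i\<in>{2} \<times> {..<K}. f i)"
      by (rule sum.union_disjoint) auto
    moreover have "(\<Sum>i\<in>{a} \<times> {..<K}. f i) = (\<Sum>j<K. f (a, j))" for a
      by (subst sum.cartesian_product') simp
    ultimately show ?thesis by (simp only: add.assoc)
  qed
  have dT: "finite_measure (dT j)" "sets (dT j) = sets borel" "space (dT j) = UNIV" if "j < K" for j
    using finite_dA_Ico[OF that T] by (auto simp: dT_def)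
  have nu: "finite_measure (\<nu> j)" "sets (\<nu> j) = sets borel" "space (\<nu> j) = UNIV" if "j < K" for j
    using is_meas_split[OF nu_meas[OF that]] by auto
  have xi: "finite_measure (\<xi> j)" "sets (\<xi> j) = sets borel" "space (\<xi> j) = UNIV" if "j < K" for j
    using is_meas_split[OF xi_meas[OF that]] by auto
  have plus_meas: "(\<lambda>(s, y). S s + y) \<in> borel_measurable (dT j \<Otimes>\<^sub>M \<nu> j)" if "j < K" for j
  proof -
    note [measurable_cong] = dT(2)[OF that] nu(2)[OF that]
    show ?thesis by measurable
  qed
  have N0: "(\<integral>\<^sup>+x. G x \<partial>N (0, 0)) = (\<integral>\<^sup>+s\<in>{0..<T}. G (S s) \<partial>lborel)" if [measurable]: "G \<in> borel_measurable borel" for G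
    by (simp add: N_def nn_integral_distr nn_integral_density mult.commute)
  have N1: "(\<integral>\<^sup>+x. G x \<partial>N (1, j)) = (\<integral>\<^sup>+x. G x * indicator {..<S T} x \<partial>\<xi> j)" if "G \<in> borel_measurable borel" "j < K" for G j
  proof -
    note [measurable_cong] = xi(2)[OF that(2)]
    note [measurable] = that(1)
    show ?thesis by (simp add: N_def nn_integral_density mult.commute)
  qed
  have N2: "(\<integral>\<^sup>+x. G x \<partial>N (2, j)) = (\<integral>\<^sup>+s\<in>{0..<T}. (\<integral>\<^sup>+y. G (S s + y) * indicator {..<S T} (S s + y) \<partial>\<nu> j) \<partial>dA j)"
    if G: "G \<in> borel_measurable borel" and j: "j < K" for G j
  proof -
    note [measurable_cong] = dT(2)[OF j] nu(2)[OF j]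
    note [measurable] = G plus_meas[OF j]
    interpret nu: finite_measure "\<nu> j" by (rule nu(1)[OF j])
    have "(\<integral>\<^sup>+x. G x \<partial>N (2, j)) = (\<integral>\<^sup>+w. indicator {..<S T} (case w of (s, y) \<Rightarrow> S s + y) * G (case w of (s, y) \<Rightarrow> S s + y) \<partial>(dT j \<Otimes>\<^sub>M \<nu> j))"
      unfolding N_def by (simp add: nn_integral_density nn_integral_distr)
    also have "\<dots> = (\<integral>\<^sup>+s. \<integral>\<^sup>+y. indicator {..<S T} (S s + y) * G (S s + y) \<partial>\<nu> j \<partial>dT j)"
      by (subst nu.nn_integral_fst[symmetric]) auto
    also have "\<dots> = (\<integral>\<^sup>+s. indicator {0..<T} s * (\<integral>\<^sup>+y. indicator {..<S T} (S s + y) * G (S s + y) \<partial>\<nu> j) \<partial>dA j)"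
      unfolding dT_def by (subst nn_integral_density) auto
    finally show ?thesis by (simp add: mult.commute)
  qed
  have M_eq: "(\<integral>\<^sup>+x. G x \<partial>M) = (\<integral>\<^sup>+s\<in>{0..<T}. G (S s) \<partial>dA k)" if [measurable]: "G \<in> borel_measurable borel" for G
    using dT[OF k] by (simp add: M_def nn_integral_distr dT_def nn_integral_density mult.commute)
  have setsM: "sets M = sets borel" by (simp add: M_def)
  have setsN: "sets (N i) = sets borel" if "i \<in> I" for i
    using that xi by (auto simp: N_def I_def)
  have finM: "finite_measure M"
    unfolding M_def using dT[OF k] by (intro finite_measure.finite_measure_distr) auto
  have finN: "finite_measure (N i)" if i: "i \<in> I" for i
  proof -
    have sp: "space (N i) = UNIV" using setsN[OF i] by (metis sets_eq_imp_space_eq space_borel)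
    have "emeasure (N i) UNIV = (\<integral>\<^sup>+x. 1 \<partial>N i)" using sp by simp
    also have "\<dots> < \<infinity>"
    proof -
      consider "i = (0, 0)" | j where "j < K" "i = (1, j)" | j where "j < K" "i = (2, j)" using i by (auto simp: I_def)
      then show ?thesis
      proof cases
        case 1
        then show ?thesis using N0[of "\<lambda>_. 1"] T by simp
      next
        case (2 j)
        have "(\<integral>\<^sup>+x. 1 * indicator {..<S T} x \<partial>\<xi> j) \<le> (\<integral>\<^sup>+x. 1 \<partial>\<xi> j)" by (intro nn_integral_mono) (auto split: split_indicator)
        also have "\<dots> < \<infinity>" using finite_measure.emeasure_finite[OF xi(1)[OF 2(1)]] by (simp add: less_top)
        finally show ?thesis using N1[of "\<lambda>_. 1" j] 2 by simp
      next
        case (3 j)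
        interpret prob_space "\<nu> j" by (rule nu_prob[OF 3(1)])
        have "(\<integral>\<^sup>+y. 1 * indicator {..<S T} (S s + y) \<partial>\<nu> j) \<le> 1" for s
          using nn_integral_mono[of "\<nu> j" "\<lambda>y. 1 * indicator {..<S T} (S s + y)" "\<lambda>_. 1"] emeasure_space_1
          by (auto split: split_indicator)
        then have "(\<integral>\<^sup>+s\<in>{0..<T}. (\<integral>\<^sup>+y. 1 * indicator {..<S T} (S s + y) \<partial>\<nu> j) \<partial>dA j) \<le> (\<integral>\<^sup>+s. indicator {0..<T} s \<partial>dA j)"
          by (intro nn_integral_mono) (auto split: split_indicator)
        also have "\<dots> < \<infinity>" using emeasure_dA_Ico[OF 3(1) T] by simp
        finally show ?thesis using N2[of "\<lambda>_. 1" j] 3 by simp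
      qed
    qed
    finally show ?thesis using sp by (intro finite_measureI) auto
  qed
  have cdf_eq: "emeasure L {..<y} = (\<integral>\<^sup>+x. indicator {..<y} x \<partial>L)" if "sets L = sets borel" for L :: "real measure" and y
    using that by simp
  have cdfM: "emeasure M {..<y} = (\<integral>\<^sup>+s\<in>{0..<T}. indicator {..<y} (S s) \<partial>dA k)" for y
    unfolding cdf_eq[OF setsM] by (rule M_eq) simp
  have cdfN0: "emeasure (N (0, 0)) {..<y} = (\<integral>\<^sup>+s\<in>{0..<T}. indicator {..<y} (S s) \<partial>lborel)" for y
    using cdf_eq[OF setsN[of "(0, 0)"]] N0[of "indicator {..<y}"] by (simp add: I_def)
  have cdfN1: "emeasure (N (1, j)) {..<y} = (\<integral>\<^sup>+x. indicator {..<y} x * indicator {..<S T} x \<partial>\<xi> j)" if j: "j < K" for y j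
    using cdf_eq[OF setsN[of "(1, j)"], of y] N1[of "indicator {..<y}", OF _ j] j by (simp add: I_def)
  have cdfN2: "emeasure (N (2, j)) {..<y} = (\<integral>\<^sup>+s\<in>{0..<T}. (\<integral>\<^sup>+v. indicator {..<y} (S s + v) * indicator {..<S T} (S s + v) \<partial>\<nu> j) \<partial>dA j)" if j: "j < K" for y j
    using cdf_eq[OF setsN[of "(2, j)"], of y] N2[of "indicator {..<y}", OF _ j] j by (simp add: I_def)
  have cdf: "emeasure M {..<y} = (\<Sum>i\<in>I. ennreal (c i) * emeasure (N i) {..<y})" for y
  proof (cases "min y (S T) \<le> 0")
    case True
    have neg: "\<not> (v < y \<and> v < S T)" if "0 \<le> v" for v using True that by auto
    have Mz: "emeasure M {..<y} = 0"
    proof -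
      have "indicator {..<y} (S s) * indicator {0..<T} s = (0 :: ennreal)" for s
        using neg[OF S_nonneg[of s]] S_strict[of T s T, OF pos] by (auto split: split_indicator)
      then have "(\<integral>\<^sup>+s\<in>{0..<T}. indicator {..<y} (S s) \<partial>dA k) = (\<integral>\<^sup>+s. 0 \<partial>dA k)"
        by (intro nn_integral_cong)
      then show ?thesis unfolding cdfM by simp
    qed
    moreover have "emeasure (N i) {..<y} = 0" if i: "i \<in> I" for i
    proof -
      consider "i = (0, 0)" | j where "j < K" "i = (1, j)" | j where "j < K" "i = (2, j)" using i by (auto simp: I_def)
      then show ?thesis
      proof cases
        case 1
        have "indicator {..<y} (S s) * indicator {0..<T} s = (0 :: ennreal)" for s
          using neg[OF S_nonneg[of s]] S_strict[of T s T, OF pos] by (auto split: split_indicator)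
        then have "(\<integral>\<^sup>+s\<in>{0..<T}. indicator {..<y} (S s) \<partial>lborel) = (\<integral>\<^sup>+s. 0 \<partial>(lborel :: real measure))"
          by (intro nn_integral_cong)
        then show ?thesis unfolding 1 cdfN0 by simp
      next
        case (2 j)
        have "(\<integral>\<^sup>+x. indicator {..<y} x * indicator {..<S T} x \<partial>\<xi> j) = (\<integral>\<^sup>+x. indicator {..<min y (S T)} x \<partial>\<xi> j)"
          by (intro nn_integral_cong) (auto split: split_indicator)
        also have "\<dots> = emeasure (\<xi> j) {..<min y (S T)}" using xi[OF 2(1)] by simp
        also have "\<dots> = 0" using is_meas_split(6)[OF xi_meas[OF 2(1)] True]
          by (simp add: finite_measure.emeasure_eq_measure[OF xi(1)[OF 2(1)]])
        finally show ?thesis unfolding 2(2) cdfN1[OF 2(1)] .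
      next
        case (3 j)
        have "(\<integral>\<^sup>+v. indicator {..<y} (S s + v) * indicator {..<S T} (S s + v) \<partial>\<nu> j) = (\<integral>\<^sup>+v. 0 \<partial>\<nu> j)" for s
        proof (rule nn_integral_cong_AE)
          show "AE v in \<nu> j. indicator {..<y} (S s + v) * indicator {..<S T} (S s + v) = (0 :: ennreal)"
            using nu_pos[OF 3(1)]
          proof eventually_elim
            fix v :: real assume "0 < v"
            then have "\<not> (S s + v < y \<and> S s + v < S T)" using S_nonneg[of s] by (intro neg) simp
            then show "indicator {..<y} (S s + v) * indicator {..<S T} (S s + v) = (0 :: ennreal)"
              by (auto split: split_indicator)
          qed
        qed
        then show ?thesis unfolding 3(2) cdfN2[OF 3(1)] by simp
      qed
    qed
    ultimately show ?thesis by simp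
  next
    case False
    \<comment> \<open>All measures involved only charge values below \<open>S T\<close>, so it is
      enough to consider \<open>min y (S T)\<close>, which the clock attains.\<close>
    define y' where "y' = min y (S T)"
    have y': "0 < y'" "y' \<le> S T" using False by (auto simp: y'_def)
    have "\<exists>t\<ge>0. t \<le> T \<and> S t = y'"
      using y' T S_neg[of 0] continuous_on_subset[OF S_cont, of "{0..T}"] by (intro IVT') auto
    then obtain t where t: "0 \<le> t" "t \<le> T" "S t = y'" by blast
    have iff: "s < t \<longleftrightarrow> S s < y" if "0 \<le> s" "s < T" for s
      using S_strict[of T s t, OF pos] S_strict[of T s T, OF pos] S_mono[of t s] that t unfolding y'_def by linarith
    have ind: "indicator {..<y} (S s) * indicator {0..<T} s = (indicator {0..<t} s :: ennreal)" for s
      using iff[of s] t by (auto split: split_indicator)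
    have M_t: "emeasure M {..<y} = ennreal (A t k - A 0 k)"
      unfolding cdfM ind using emeasure_dA_Ico[OF k t(1)] by simp
    have N0_t: "emeasure (N (0, 0)) {..<y} = ennreal t"
      unfolding cdfN0 ind using t by simp
    have N1_t: "emeasure (N (1, j)) {..<y} = ennreal (measure (\<xi> j) {..<S t})" if j: "j < K" for j
    proof -
      have "emeasure (N (1, j)) {..<y} = (\<integral>\<^sup>+x. indicator {..<y} x * indicator {..<S T} x \<partial>\<xi> j)"
        by (rule cdfN1[OF j])
      also have "\<dots> = (\<integral>\<^sup>+x. indicator {..<S t} x \<partial>\<xi> j)"
        unfolding t y'_def by (intro nn_integral_cong) (auto split: split_indicator)
      also have "\<dots> = emeasure (\<xi> j) {..<S t}" using xi[OF j] by simp
      finally show ?thesis by (simp add: finite_measure.emeasure_eq_measure[OF xi(1)[OF j]])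
    qed
    have N2_t: "emeasure (N (2, j)) {..<y} = (\<integral>\<^sup>+s\<in>{0..<t}. ennreal (measure (\<nu> j) {..<S t - S s}) \<partial>dA j)" if j: "j < K" for j
    proof -
      have "emeasure (N (2, j)) {..<y} = (\<integral>\<^sup>+s\<in>{0..<T}. (\<integral>\<^sup>+v. indicator {..<y} (S s + v) * indicator {..<S T} (S s + v) \<partial>\<nu> j) \<partial>dA j)"
        by (rule cdfN2[OF j])
      also have "\<dots> = (\<integral>\<^sup>+s\<in>{0..<T}. ennreal (measure (\<nu> j) {..<S t - S s}) \<partial>dA j)"
      proof (intro nn_integral_cong arg_cong2[where f="(*)"] refl)
        fix s
        have "(\<integral>\<^sup>+v. indicator {..<y} (S s + v) * indicator {..<S T} (S s + v) \<partial>\<nu> j) = (\<integral>\<^sup>+v. indicator {..<S t - S s} v \<partial>\<nu> j)"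
          unfolding t y'_def by (intro nn_integral_cong) (auto split: split_indicator)
        then show "(\<integral>\<^sup>+v. indicator {..<y} (S s + v) * indicator {..<S T} (S s + v) \<partial>\<nu> j) = ennreal (measure (\<nu> j) {..<S t - S s})"
          using nu[OF j] by (simp add: finite_measure.emeasure_eq_measure)
      qed
      also have "\<dots> = (\<integral>\<^sup>+s\<in>{0..<t}. ennreal (measure (\<nu> j) {..<S t - S s}) \<partial>dA j)"
      proof (intro nn_integral_cong)
        fix s
        \<comment> \<open>Jobs arriving from \<open>t\<close> on have not left by \<open>t\<close>;
          this shortens the interval from \<open>T\<close> to \<open>t\<close>.\<close>
        have "measure (\<nu> j) {..<S t - S s} = 0" if "t \<le> s"
          using S_mono[OF that] is_meas_split(6)[OF nu_meas[OF j], of "S t - S s"] by simp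
        then show "ennreal (measure (\<nu> j) {..<S t - S s}) * indicator {0..<T} s = ennreal (measure (\<nu> j) {..<S t - S s}) * indicator {0..<t} s"
          using t by (auto split: split_indicator)
      qed
      finally show ?thesis .
    qed
    have Dm: "0 \<le> D t j - D 0 j" if "j < K" for j using D_mono[OF that] t by (auto simp: mono_on_def)
    have pn: "0 \<le> p j k" if "j < K" for j using p_nonneg[OF that k] .
    have "A t k - A 0 k = \<alpha> k * t + (\<Sum>j<K. p j k * (D t j - D 0 j))"
      using A_eq[OF t(1) k] A_eq[OF order.refl k] by (simp add: right_diff_distrib sum_subtractf)
    then have "emeasure M {..<y} = ennreal (\<alpha> k * t) + ennreal (\<Sum>j<K. p j k * (D t j - D 0 j))"
      unfolding M_t using Dm pn alpha_nonneg[OF k] t by (simp only:) (intro ennreal_plus sum_nonneg mult_nonneg_nonneg; simp)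
    also have "\<dots> = ennreal (\<alpha> k) * ennreal t + (\<Sum>j<K. ennreal (p j k) * ennreal (D t j - D 0 j))"
      using Dm pn alpha_nonneg[OF k] t by (subst sum_ennreal[symmetric]) (auto simp: ennreal_mult)
    also have "\<dots> = ennreal (\<alpha> k) * emeasure (N (0, 0)) {..<y} + (\<Sum>j<K. ennreal (p j k) * (emeasure (N (1, j)) {..<y} + emeasure (N (2, j)) {..<y}))"
      by (intro arg_cong2[where f="(+)"] sum.cong refl) (simp_all only: N0_t N1_t N2_t departures t lessThan_iff)
    also have "\<dots> = (\<Sum>i\<in>I. ennreal (c i) * emeasure (N i) {..<y})"
      unfolding sum_I by (simp add: c_def distrib_left sum.distrib add.assoc)
    finally show ?thesis .
  qed
  have c0: "0 \<le> c i" if "i \<in> I" for i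
    using that alpha_nonneg[OF k] p_nonneg[OF _ k] by (auto simp: I_def c_def)
  have "finite I" by (simp add: I_def)
  then have "(\<integral>\<^sup>+x. F x \<partial>M) = (\<Sum>i\<in>I. ennreal (c i) * (\<integral>\<^sup>+x. F x \<partial>N i))"
    using nn_integral_eq_weighted_sum_of_cdf[OF _ finM setsM finN setsN c0 cdf F] by blast
  then have main: "(\<integral>\<^sup>+s\<in>{0..<T}. F (S s) \<partial>dA k) = ennreal (\<alpha> k) * (\<integral>\<^sup>+s\<in>{0..<T}. F (S s) \<partial>lborel)
     + (\<Sum>j<K. ennreal (p j k) * ((\<integral>\<^sup>+x. F x \<partial>N (1, j)) + (\<integral>\<^sup>+x. F x \<partial>N (2, j))))"
    unfolding sum_I M_eq[OF F] N0[OF F, symmetric] by (simp add: c_def distrib_left sum.distrib add.assoc)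
  have F_ind: "F v * indicator {..<S T} v = F v" for v using F0[of v] by (auto split: split_indicator)
  show ?thesis unfolding main
    by (intro arg_cong2[where f="(+)"] sum.cong refl) (simp_all only: N1[OF F] N2[OF F] F_ind lessThan_iff)
qed

end

section \<open>Renewal equations along a fluid path\<close>

context feedback
begin

text \<open>Both tails are cut off at x \<le> 0, including x = 0, so that the time integrals over [0, T) extend
  to the whole line after the change of clock.\<close>

definition svc_tail :: "nat \<Rightarrow> real \<Rightarrow> ennreal" where
  "svc_tail l x = (if 0 < x then ennreal (measure (\<nu> l) {x..}) else 0)"

definition svc_tail_at :: "nat \<Rightarrow> real \<Rightarrow> nat \<Rightarrow> real \<Rightarrow> ennreal" where
  "svc_tail_at k x0 l x = (if l = k \<and> 0 < x then ennreal (measure (\<nu> l) {x0 + x..}) else 0)"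

text \<open>For \<open>f = svc_tail\<close> the resolvent at \<open>x\<close> is the expected part
  of a job, followed along its whole route, that is still in the system after service
  \<open>x\<close>; weighted by the external rates it is the renewal kernel.\<close>

definition net_kernel :: "(nat \<Rightarrow> real) \<Rightarrow> (nat \<Rightarrow> real \<Rightarrow> ennreal) \<Rightarrow> real \<Rightarrow> ennreal" where
  "net_kernel \<alpha> f x = (\<Sum>l<K. ennreal (\<alpha> l) * res f l x)"

text \<open>Initial jobs after their first departure: one of class j leaves at clock value y, moves
  to class l with weight \<open>p j l\<close>, and from then on behaves like an arrival.\<close>

definition forcing :: "(nat \<Rightarrow> real measure) \<Rightarrow> (nat \<Rightarrow> real \<Rightarrow> ennreal) \<Rightarrow> real \<Rightarrow> ennreal" where
  "forcing \<xi> f u = (\<Sum>j<K. \<Sum>l<K. ennreal (p j l) * (\<integral>\<^sup>+y. res f l (u - y) \<partial>\<xi> j))"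

lemma nu_tail_measurable: "l < K \<Longrightarrow> (\<lambda>x. measure (\<nu> l) {x..}) \<in> borel_measurable borel"
  using nu_prob nu_sets by (intro measurable_measure_atLeast prob_space.finite_measure)

lemma svc_tail_meas: "l < K \<Longrightarrow> svc_tail l \<in> borel_measurable borel"
proof -
  assume "l < K"
  note [measurable] = nu_tail_measurable[OF this]
  show ?thesis unfolding svc_tail_def by measurable
qed

lemma svc_tail_at_meas: "l < K \<Longrightarrow> svc_tail_at k x0 l \<in> borel_measurable borel"
proof -
  assume "l < K"
  note [measurable] = nu_tail_measurable[OF this]
  show ?thesis unfolding svc_tail_at_def by measurable
qed

lemma svc_tail_zero: "x \<le> 0 \<Longrightarrow> svc_tail l x = 0" by (simp add: svc_tail_def)

lemma svc_tail_at_zero: "x \<le> 0 \<Longrightarrow> svc_tail_at k x0 l x = 0" by (simp add: svc_tail_at_def)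

lemma svc_tail_le: "l < K \<Longrightarrow> svc_tail l x \<le> ennreal 1"
  using prob_space.prob_le_1[OF nu_prob] by (auto simp: svc_tail_def simp del: ennreal_1)

lemma svc_tail_at_le:
  assumes l: "l < K" and x0: "0 \<le> x0"
  shows "svc_tail_at k x0 l x \<le> svc_tail l x"
proof -
  interpret prob_space "\<nu> l" by (rule nu_prob[OF l])
  have "measure (\<nu> l) {x0 + x..} \<le> measure (\<nu> l) {x..}"
    using x0 nu_sets[OF l] by (intro finite_measure_mono) auto
  then show ?thesis by (auto simp: svc_tail_def svc_tail_at_def)
qed

lemma net_kernel_meas:
  assumes "\<And>l. l < K \<Longrightarrow> f l \<in> borel_measurable borel"
  shows "net_kernel \<alpha> f \<in> borel_measurable borel"
  unfolding net_kernel_def using res_meas[of f, OF assms] by (intro borel_measurable_sum borel_measurable_times) auto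

lemma net_kernel_zero:
  assumes "\<And>l. l < K \<Longrightarrow> f l \<in> borel_measurable borel" "\<And>l x. l < K \<Longrightarrow> x \<le> 0 \<Longrightarrow> f l x = 0" "x \<le> 0"
  shows "net_kernel \<alpha> f x = 0"
  unfolding net_kernel_def using res_zero[of f, OF assms(1,2) _ assms(3)] by simp

end

context fluid_path
begin

text \<open>Integrate the resolvent against the arrivals. Its own equation yields \<open>f\<close>
  plus a term for one service and one routing step; \<open>arrival_identity\<close> yields the
  external and initial contributions plus the same term. That term is finite and cancels, so the
  arrival streams of the single classes disappear from the right side.\<close>

lemma master_identity:
  assumes pos: "\<And>r. 0 \<le> r \<Longrightarrow> r < T \<Longrightarrow> 0 < z r" and T: "0 \<le> T"
    and fm: "\<And>l. l < K \<Longrightarrow> f l \<in> borel_measurable borel"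
    and f0: "\<And>l x. l < K \<Longrightarrow> x \<le> 0 \<Longrightarrow> f l x = 0" and fb: "\<And>l x. l < K \<Longrightarrow> f l x \<le> ennreal C"
  shows "(\<Sum>l<K. \<integral>\<^sup>+s\<in>{0..<T}. f l (S T - S s) \<partial>dA l)
    = (\<integral>\<^sup>+s\<in>{0..<T}. net_kernel \<alpha> f (S T - S s) \<partial>lborel) + forcing \<xi> f (S T)"
proof -
  have rm: "res f l \<in> borel_measurable borel" if "l < K" for l using res_meas[of f] fm that by blast
  \<comment> \<open>The pieces of the two expansions: \<open>a\<close> is the resolvent against
    arrivals, \<open>q\<close> its source part, \<open>b\<close> the routed part, \<open>d\<close>
    the external part, \<open>e\<close> the initial part.\<close>
  define a where "a l = (\<integral>\<^sup>+s\<in>{0..<T}. res f l (S T - S s) \<partial>dA l)" for l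
  define b where "b j l = (\<integral>\<^sup>+s\<in>{0..<T}. (\<integral>\<^sup>+y. res f l (S T - (S s + y)) \<partial>\<nu> j) \<partial>dA j)" for j l
  define e where "e j l = (\<integral>\<^sup>+y. res f l (S T - y) \<partial>\<xi> j)" for j l
  define d where "d l = (\<integral>\<^sup>+s\<in>{0..<T}. res f l (S T - S s) \<partial>lborel)" for l
  define q where "q l = (\<integral>\<^sup>+s\<in>{0..<T}. f l (S T - S s) \<partial>dA l)" for l
  have 1: "a j = q j + (\<Sum>l<K. ennreal (p j l) * b j l)" if j: "j < K" for j
  proof -
    note [measurable] = fm[OF j]
    have "a j = (\<integral>\<^sup>+s. f j (S T - S s) * indicator {0..<T} s
        + (\<Sum>l<K. ennreal (p j l) * ((\<integral>\<^sup>+y. res f l (S T - (S s + y)) \<partial>\<nu> j) * indicator {0..<T} s)) \<partial>dA j)"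
      unfolding a_def using res_eq[where f=f, OF fm j]
      by (intro nn_integral_cong) (simp add: distrib_right sum_distrib_right mult.assoc diff_diff_eq)
    also have "\<dots> = q j + (\<Sum>l<K. ennreal (p j l) * b j l)"
      unfolding q_def b_def
    proof (rule nn_integral_add_weighted_sum)
      fix l assume l: "l < K"
      have "(\<lambda>s. \<integral>\<^sup>+y. res f l (S T - S s - y) \<partial>\<nu> j) \<in> borel_measurable borel"
        using measurable_compose[OF _ nn_integral_nu_shift_meas[where f=f, OF fm j rm[OF l]], of "\<lambda>s. S T - S s" borel] by simp
      then have [measurable]: "(\<lambda>s. \<integral>\<^sup>+y. res f l (S T - (S s + y)) \<partial>\<nu> j) \<in> borel_measurable borel"
        by (simp add: diff_diff_eq)
      show "(\<lambda>s. (\<integral>\<^sup>+y. res f l (S T - (S s + y)) \<partial>\<nu> j) * indicator {0..<T} s) \<in> borel_measurable (dA j)"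
        by measurable
    qed auto
    finally show ?thesis .
  qed
  have 2: "a l = ennreal (\<alpha> l) * d l + (\<Sum>j<K. ennreal (p j l) * (e j l + b j l))" if l: "l < K" for l
  proof -
    note [measurable] = rm[OF l]
    show ?thesis unfolding a_def d_def e_def b_def
    proof (rule arrival_identity[OF pos T l, of "\<lambda>v. res f l (S T - v)"])
      show "(\<lambda>v. res f l (S T - v)) \<in> borel_measurable borel" by measurable
    qed (auto intro: res_zero[where f=f, OF fm f0 l])
  qed
  \<comment> \<open>The resolvent is bounded and only a finite amount arrives before
    \<open>T\<close>; this legitimises the cancellation of \<open>Y\<close>.\<close>
  have b_fin: "b j l < \<infinity>" if j: "j < K" and l: "l < K" for j l
  proof -
    interpret prob_space "\<nu> j" by (rule nu_prob[OF j])
    have "(\<integral>\<^sup>+y. res f l (S T - (S s + y)) \<partial>\<nu> j) \<le> ennreal C * ennreal (w l)" for s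
      using nn_integral_mono[of "\<nu> j" "\<lambda>y. res f l (S T - (S s + y))" "\<lambda>_. ennreal C * ennreal (w l)"] res_le[where f=f, OF fm fb l]
      by (simp add: emeasure_space_1)
    then have "b j l \<le> (\<integral>\<^sup>+s. ennreal C * ennreal (w l) * indicator {0..<T} s \<partial>dA j)"
      unfolding b_def by (intro nn_integral_mono mult_right_mono) auto
    also have "\<dots> = ennreal C * ennreal (w l) * emeasure (dA j) {0..<T}" by (subst nn_integral_cmult) auto
    also have "\<dots> < \<infinity>" using emeasure_dA_Ico[OF j T] by (simp add: ennreal_mult_less_top)
    finally show ?thesis .
  qed
  define Y where "Y = (\<Sum>j<K. \<Sum>l<K. ennreal (p j l) * b j l)"
  have Y: "Y \<noteq> \<infinity>" unfolding Y_def using b_fin by (auto simp: ennreal_mult_eq_top_iff less_top[symmetric])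
  have "Y + (\<Sum>l<K. q l) = (\<Sum>l<K. a l)" by (simp add: 1 sum.distrib Y_def add.commute)
  also have "\<dots> = (\<Sum>l<K. ennreal (\<alpha> l) * d l) + (\<Sum>l<K. \<Sum>j<K. ennreal (p j l) * e j l) + (\<Sum>l<K. \<Sum>j<K. ennreal (p j l) * b j l)"
    by (simp add: 2 sum.distrib distrib_left add.assoc)
  also have "(\<Sum>l<K. \<Sum>j<K. ennreal (p j l) * b j l) = Y" unfolding Y_def by (rule sum.swap)
  also have "(\<Sum>l<K. \<Sum>j<K. ennreal (p j l) * e j l) = forcing \<xi> f (S T)"
    unfolding forcing_def e_def by (rule sum.swap)
  also have "(\<Sum>l<K. ennreal (\<alpha> l) * d l) = (\<integral>\<^sup>+s\<in>{0..<T}. net_kernel \<alpha> f (S T - S s) \<partial>lborel)"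
  proof -
    have "(\<integral>\<^sup>+s\<in>{0..<T}. net_kernel \<alpha> f (S T - S s) \<partial>lborel)
        = (\<integral>\<^sup>+s. 0 + (\<Sum>l<K. ennreal (\<alpha> l) * (res f l (S T - S s) * indicator {0..<T} s)) \<partial>lborel)"
      unfolding net_kernel_def by (intro nn_integral_cong) (simp add: sum_distrib_right mult.assoc)
    also have "\<dots> = (\<integral>\<^sup>+s. 0 \<partial>(lborel :: real measure)) + (\<Sum>l<K. ennreal (\<alpha> l) * d l)"
      unfolding d_def
    proof (rule nn_integral_add_weighted_sum)
      fix l assume l: "l < K"
      note [measurable] = rm[OF l]
      show "(\<lambda>s. res f l (S T - S s) * indicator {0..<T} s) \<in> borel_measurable lborel" by measurable
    qed auto
    finally show ?thesis by simp
  qed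
  finally have "Y + (\<Sum>l<K. q l) = Y + ((\<integral>\<^sup>+s\<in>{0..<T}. net_kernel \<alpha> f (S T - S s) \<partial>lborel) + forcing \<xi> f (S T))"
    by (simp add: add_ac)
  then show ?thesis using Y unfolding ennreal_add_left_cancel q_def by blast
qed

lemma class_identity:
  assumes pos: "\<And>r. 0 \<le> r \<Longrightarrow> r < T \<Longrightarrow> 0 < z r" and T: "0 \<le> T" and k: "k < K" and x0: "0 \<le> x0"
  shows "ennreal (measure (\<mu> T k) {x0..}) = ennreal (measure (\<xi> k) {x0 + S T..})
    + ((\<integral>\<^sup>+s\<in>{0..<T}. net_kernel \<alpha> (svc_tail_at k x0) (S T - S s) \<partial>lborel) + forcing \<xi> (svc_tail_at k x0) (S T))"
proof -
  have "(\<integral>\<^sup>+s\<in>{0..<T}. net_kernel \<alpha> (svc_tail_at k x0) (S T - S s) \<partial>lborel) + forcing \<xi> (svc_tail_at k x0) (S T)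
      = (\<Sum>l<K. \<integral>\<^sup>+s\<in>{0..<T}. svc_tail_at k x0 l (S T - S s) \<partial>dA l)"
    by (rule master_identity[symmetric, where f="svc_tail_at k x0", OF pos T svc_tail_at_meas svc_tail_at_zero order_trans[OF svc_tail_at_le[OF _ x0] svc_tail_le]])
  also have "\<dots> = (\<Sum>l<K. if l = k then \<integral>\<^sup>+s\<in>{0..<T}. svc_tail_at k x0 l (S T - S s) \<partial>dA l else 0)"
    by (intro sum.cong refl) (auto simp: svc_tail_at_def)
  also have "\<dots> = (\<integral>\<^sup>+s\<in>{0..<T}. svc_tail_at k x0 k (S T - S s) \<partial>dA k)" using k by simp
  \<comment> \<open>Before the horizon \<open>S T - S s\<close> is positive, so the cut-off at 0 in
    \<open>svc_tail_at\<close> is invisible.\<close>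
  also have "\<dots> = (\<integral>\<^sup>+s\<in>{0..<T}. ennreal (measure (\<nu> k) {x0 + (S T - S s)..}) \<partial>dA k)"
    using S_strict[of T _ T, OF pos] by (intro nn_integral_cong) (auto simp: svc_tail_at_def split: split_indicator)
  finally show ?thesis using dyn_nn[OF k T x0] by simp
qed

lemma total_identity:
  assumes pos: "\<And>r. 0 \<le> r \<Longrightarrow> r < T \<Longrightarrow> 0 < z r" and T: "0 \<le> T"
  shows "ennreal (z T) = ennreal (\<Sum>k<K. measure (\<xi> k) {S T..})
    + ((\<integral>\<^sup>+s\<in>{0..<T}. net_kernel \<alpha> svc_tail (S T - S s) \<partial>lborel) + forcing \<xi> svc_tail (S T))"
proof -
  have "(\<integral>\<^sup>+s\<in>{0..<T}. net_kernel \<alpha> svc_tail (S T - S s) \<partial>lborel) + forcing \<xi> svc_tail (S T)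
      = (\<Sum>l<K. \<integral>\<^sup>+s\<in>{0..<T}. svc_tail l (S T - S s) \<partial>dA l)"
    by (rule master_identity[symmetric, where f=svc_tail, OF pos T svc_tail_meas svc_tail_zero svc_tail_le])
  also have "\<dots> = (\<Sum>l<K. \<integral>\<^sup>+s\<in>{0..<T}. ennreal (measure (\<nu> l) {0 + (S T - S s)..}) \<partial>dA l)"
    using S_strict[of T _ T, OF pos] by (intro sum.cong nn_integral_cong) (auto simp: svc_tail_def split: split_indicator)
  finally have *: "(\<integral>\<^sup>+s\<in>{0..<T}. net_kernel \<alpha> svc_tail (S T - S s) \<partial>lborel) + forcing \<xi> svc_tail (S T)
      = (\<Sum>l<K. \<integral>\<^sup>+s\<in>{0..<T}. ennreal (measure (\<nu> l) {0 + (S T - S s)..}) \<partial>dA l)" .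
  have "ennreal (z T) = (\<Sum>k<K. ennreal (measure (\<mu> T k) {0..}))"
    unfolding z_def using is_meas_split(4)[OF mu_meas[OF T]] by (subst sum_ennreal) (auto simp: mass_def)
  also have "\<dots> = (\<Sum>k<K. ennreal (measure (\<xi> k) {S T..}) + (\<integral>\<^sup>+s\<in>{0..<T}. ennreal (measure (\<nu> k) {0 + (S T - S s)..}) \<partial>dA k))"
    using dyn_nn[OF _ T, of _ 0] by (intro sum.cong refl) simp
  finally show ?thesis unfolding * by (simp add: sum.distrib flip: sum_ennreal)
qed

text \<open>At a first zero \<open>T\<close> the total identity still holds. External arrivals in a
  short interval before \<open>T\<close> have attained service at most \<delta>, so by the lower
  bound on the kernel they contribute a positive amount to \<open>z T\<close>.\<close>

lemma z_pos:
  assumes c: "0 < c" and \<delta>: "0 < \<delta>" and lower: "\<And>x. 0 < x \<Longrightarrow> x \<le> \<delta> \<Longrightarrow> ennreal c \<le> net_kernel \<alpha> svc_tail x"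
    and t: "0 \<le> t"
  shows "0 < z t"
proof (rule ccontr)
  assume "\<not> 0 < z t"
  then have zt: "z t = 0" using z_nonneg[of t] by linarith
  define E where "E = {r \<in> {0..t}. z r = 0}"
  have "closed E"
    unfolding E_def by (intro continuous_closed_preimage_constant continuous_on_subset[OF z_cont]) auto
  moreover have E: "t \<in> E" "E \<subseteq> {0..t}" using t zt by (auto simp: E_def)
  moreover have bdd: "bdd_below E" using E by (meson bdd_below_Icc bdd_below_mono)
  ultimately have T_in: "Inf E \<in> E" by (intro closed_contains_Inf) auto
  define T where "T = Inf E"
  have T: "0 \<le> T" "z T = 0" "T \<le> t" using T_in by (auto simp: T_def E_def)
  have "T \<noteq> 0" using z_0 T by auto
  then have T0: "0 < T" using T by simp
  have pos: "0 < z r" if "0 \<le> r" "r < T" for r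
  proof -
    have "r \<notin> E" using that cInf_lower[OF _ bdd, of r] by (auto simp: T_def)
    then show ?thesis using that T z_nonneg[of r] by (auto simp: E_def)
  qed
  have "(S \<longlongrightarrow> S T) (at T within {0..})" using S_cont T by (auto simp: continuous_on_def)
  then obtain d where d: "0 < d" "\<And>s. 0 \<le> s \<Longrightarrow> s \<noteq> T \<Longrightarrow> dist s T < d \<Longrightarrow> dist (S s) (S T) < \<delta>"
    using \<delta> unfolding tendsto_iff eventually_at by (metis atLeast_iff)
  define s0 where "s0 = max 0 (T - d / 2)"
  have s0: "0 \<le> s0" "s0 < T" using T0 d by (auto simp: s0_def)
  have "0 < ennreal (c * (T - s0))" using c s0 by simp
  also have "\<dots> = (\<integral>\<^sup>+s. ennreal c * indicator {s0..<T} s \<partial>lborel)"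
    using c s0 by (simp add: nn_integral_cmult ennreal_mult)
  also have "\<dots> \<le> (\<integral>\<^sup>+s\<in>{0..<T}. net_kernel \<alpha> svc_tail (S T - S s) \<partial>lborel)"
  proof (intro nn_integral_mono)
    fix s
    have "ennreal c \<le> net_kernel \<alpha> svc_tail (S T - S s)" if "s \<in> {s0..<T}"
    proof (rule lower)
      show "0 < S T - S s" using S_strict[of T s T, OF pos] that s0 by simp
      have "dist s T < d" using that d by (auto simp: s0_def dist_real_def)
      then show "S T - S s \<le> \<delta>" using d(2)[of s] that s0 by (auto simp: dist_real_def)
    qed
    then show "ennreal c * indicator {s0..<T} s \<le> net_kernel \<alpha> svc_tail (S T - S s) * indicator {0..<T} s"
      using s0 by (auto split: split_indicator)
  qed
  also have "\<dots> \<le> ennreal (z T)"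
    by (subst total_identity[of T]) (use pos T in \<open>auto intro!: add_increasing add_increasing2\<close>)
  finally show False using T by simp
qed

text \<open>The total mass as a function of the clock. The value zero outside the range lets
  equations be written on the whole line while the range is only known to be an initial segment of
  the half line.\<close>

definition Z :: "real \<Rightarrow> real" where
  "Z v = (if v \<in> S ` {0..} then z (inv_into {0..} S v) else 0)"

definition total_forcing :: "real \<Rightarrow> real" where
  "total_forcing u = (if 0 \<le> u then (\<Sum>k<K. measure (\<xi> k) {u..}) + enn2real (forcing \<xi> svc_tail u) else 0)"

lemma Z_nonneg: "0 \<le> Z v" by (simp add: Z_def z_nonneg)

lemma Z_neg: "v < 0 \<Longrightarrow> Z v = 0"
proof -
  assume "v < 0"
  then have "v \<notin> S ` {0..}" using S_nonneg by (metis imageE not_le)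
  then show ?thesis by (simp add: Z_def)
qed

lemma range_S_downward: "u \<in> S ` {0..} \<Longrightarrow> 0 \<le> v \<Longrightarrow> v \<le> u \<Longrightarrow> v \<in> S ` {0..}"
proof -
  assume "u \<in> S ` {0..}" and v: "0 \<le> v" "v \<le> u"
  then obtain t where t: "0 \<le> t" "S t = u" by auto
  have "\<exists>s\<ge>0. s \<le> t \<and> S s = v"
    using v t S_neg[of 0] continuous_on_subset[OF S_cont, of "{0..t}"] by (intro IVT') auto
  then show ?thesis by auto
qed

lemma range_S_borel: "S ` {0..} \<in> sets borel"
proof -
  have "S ` {0..} = (\<Union>n. {0..S (real n)})"
  proof (intro equalityI subsetI)
    fix v assume "v \<in> S ` {0..}"
    then obtain t where t: "0 \<le> t" "v = S t" by auto
    obtain n where "t \<le> real n" using real_arch_simple by blast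
    then have "v \<in> {0..S (real n)}" using t S_nonneg[of t] S_mono[of t "real n"] by simp
    then show "v \<in> (\<Union>n. {0..S (real n)})" by blast
  next
    fix v assume "v \<in> (\<Union>n. {0..S (real n)})"
    then obtain n :: nat where n: "0 \<le> v" "v \<le> S (real n)" by auto
    have "S (real n) \<in> S ` {0..}" by simp
    then show "v \<in> S ` {0..}" using n by (rule range_S_downward)
  qed
  then show ?thesis by simp
qed

section \<open>Renewal equations in clock time\<close>

context
  assumes pos: "\<And>t. 0 \<le> t \<Longrightarrow> 0 < z t"
begin

lemma S_inj: "inj_on S {0..}"
proof (rule inj_onI)
  fix s t assume st: "s \<in> {0..}" "t \<in> {0..}" and eq: "S s = S t"
  show "s = t"
  proof (rule ccontr)
    assume "s \<noteq> t"
    then consider "s < t" | "t < s" by linarith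
    then show False
      using S_strict[of t s t, OF pos] S_strict[of s t s, OF pos] st eq by cases auto
  qed
qed

lemma Z_S: "0 \<le> t \<Longrightarrow> Z (S t) = z t"
  using S_inj by (simp add: Z_def inv_into_f_f)

lemma Z_meas[measurable]: "Z \<in> borel_measurable borel"
proof -
  have "mono_on (S ` {0..}) (inv_into {0..} S)"
  proof (rule mono_onI)
    fix u v assume "u \<in> S ` {0..}" "v \<in> S ` {0..}" and uv: "u \<le> v"
    then obtain s t where st: "0 \<le> s" "0 \<le> t" "u = S s" "v = S t" by auto
    have "s \<le> t"
    proof (rule ccontr)
      assume "\<not> s \<le> t"
      then have "S t < S s" using S_strict[of s t s, OF pos] st by simp
      then show False using uv st by simp
    qed
    then show "inv_into {0..} S u \<le> inv_into {0..} S v" using st S_inj by (simp add: inv_into_f_f)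
  qed
  then have [measurable]: "inv_into {0..} S \<in> borel_measurable (restrict_space borel (S ` {0..}))"
    by (rule borel_measurable_mono_on_fnc)
  have [measurable]: "(\<lambda>s. indicator {0..} s *\<^sub>R z s) \<in> borel_measurable borel"
    by (rule borel_measurable_continuous_on_indicator[OF _ z_cont]) simp
  have "(\<lambda>v. indicator {0..} (inv_into {0..} S v) *\<^sub>R z (inv_into {0..} S v)) \<in> borel_measurable (restrict_space borel (S ` {0..}))"
    by (rule measurable_compose[where f="inv_into {0..} S"]) measurable
  then have "(\<lambda>v. indicator (S ` {0..}) v *\<^sub>R (indicator {0..} (inv_into {0..} S v) *\<^sub>R z (inv_into {0..} S v))) \<in> borel_measurable borel"
    using range_S_borel by (subst (asm) borel_measurable_restrict_space_iff) auto
  also have "(\<lambda>v. indicator (S ` {0..}) v *\<^sub>R (indicator {0..} (inv_into {0..} S v) *\<^sub>R z (inv_into {0..} S v))) = Z"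
    by (rule ext) (auto simp: Z_def S_inj inv_into_f_f)
  finally show ?thesis .
qed

text \<open>Since S' = 1/z, \<open>Z (S s) * rate s = 1\<close>, so ds becomes Z(v) dv. The kernel
  vanishes for v \<ge> S T and \<open>Z\<close> for v < 0, which frees the integral from its
  limits.\<close>

lemma change_clock:
  assumes fm: "\<And>l. l < K \<Longrightarrow> f l \<in> borel_measurable borel"
    and f0: "\<And>l x. l < K \<Longrightarrow> x \<le> 0 \<Longrightarrow> f l x = 0" and T: "0 \<le> T"
  shows "(\<integral>\<^sup>+s\<in>{0..<T}. net_kernel \<alpha> f (S T - S s) \<partial>lborel) = (\<integral>\<^sup>+v. net_kernel \<alpha> f (S T - v) * ennreal (Z v) \<partial>lborel)"
proof -
  note [measurable] = net_kernel_meas[where f=f, OF fm]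
  have "(\<integral>\<^sup>+s\<in>{0..<T}. net_kernel \<alpha> f (S T - S s) \<partial>lborel)
      = (\<integral>\<^sup>+s\<in>{0..<T}. net_kernel \<alpha> f (S T - S s) * ennreal (Z (S s)) * ennreal (rate s) \<partial>lborel)"
  proof (intro nn_integral_cong)
    fix s
    have "ennreal (Z (S s)) * ennreal (rate s) = 1" if "0 \<le> s"
      using pos[OF that] Z_S[OF that] rate_eq[OF that] by (simp add: phi_def flip: ennreal_mult)
    then show "net_kernel \<alpha> f (S T - S s) * indicator {0..<T} s = net_kernel \<alpha> f (S T - S s) * ennreal (Z (S s)) * ennreal (rate s) * indicator {0..<T} s"
      by (auto split: split_indicator simp: mult.assoc)
  qed
  also have "\<dots> = (\<integral>\<^sup>+v\<in>{0..<S T}. net_kernel \<alpha> f (S T - v) * ennreal (Z v) \<partial>lborel)"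
    using pos by (intro push_lebesgue[of T "\<lambda>v. net_kernel \<alpha> f (S T - v) * ennreal (Z v)"] T) auto
  also have "\<dots> = (\<integral>\<^sup>+v. net_kernel \<alpha> f (S T - v) * ennreal (Z v) \<partial>lborel)"
  proof (intro nn_integral_cong)
    fix v
    show "net_kernel \<alpha> f (S T - v) * ennreal (Z v) * indicator {0..<S T} v = net_kernel \<alpha> f (S T - v) * ennreal (Z v)"
      using net_kernel_zero[where f=f, OF fm f0, where x="S T - v"] Z_neg[of v] by (auto split: split_indicator simp: not_less)
  qed
  finally show ?thesis .
qed

lemma forcing_finite:
  assumes fm: "\<And>l. l < K \<Longrightarrow> f l \<in> borel_measurable borel" and fb: "\<And>l x. l < K \<Longrightarrow> f l x \<le> ennreal C"
  shows "forcing \<xi> f u < \<infinity>"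
proof -
  have "(\<integral>\<^sup>+y. res f l (u - y) \<partial>\<xi> j) < \<infinity>" if "l < K" "j < K" for l j
  proof -
    have "(\<integral>\<^sup>+y. res f l (u - y) \<partial>\<xi> j) \<le> (\<integral>\<^sup>+y. ennreal C * ennreal (w l) \<partial>\<xi> j)"
      by (intro nn_integral_mono res_le[where f=f, OF fm fb that(1)])
    also have "\<dots> < \<infinity>"
      using finite_measure.emeasure_finite[OF is_meas_split(1)[OF xi_meas[OF that(2)]]]
      by (simp add: ennreal_mult_less_top less_top)
    finally show ?thesis .
  qed
  then show ?thesis unfolding forcing_def by (simp add: ennreal_mult_less_top)
qed

text \<open>On the negative half line both sides vanish; including it gives the equation on all of
  \<open>{..u}\<close> once \<open>u\<close> is in the range of the clock.\<close>

lemma Z_renewal: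
  assumes u: "u \<in> S ` {0..} \<or> u < 0"
  shows "ennreal (Z u) = ennreal (total_forcing u) + (\<integral>\<^sup>+v. net_kernel \<alpha> svc_tail (u - v) * ennreal (Z v) \<partial>lborel)"
proof (cases "u < 0")
  case True
  have "net_kernel \<alpha> svc_tail (u - v) * ennreal (Z v) = 0" for v
    using True Z_neg[of v] net_kernel_zero[where f=svc_tail, OF svc_tail_meas svc_tail_zero, where x="u - v"] by (cases "v < 0") auto
  then have "(\<integral>\<^sup>+v. net_kernel \<alpha> svc_tail (u - v) * ennreal (Z v) \<partial>lborel) = (\<integral>\<^sup>+v. 0 \<partial>(lborel :: real measure))"
    by (intro nn_integral_cong)
  then show ?thesis using True by (simp add: Z_neg total_forcing_def)
next
  case False
  then obtain T where T: "0 \<le> T" "u = S T" using u by auto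
  have "ennreal (Z u) = ennreal (z T)" using Z_S T by simp
  also have "\<dots> = ennreal (\<Sum>k<K. measure (\<xi> k) {S T..})
    + ((\<integral>\<^sup>+s\<in>{0..<T}. net_kernel \<alpha> svc_tail (S T - S s) \<partial>lborel) + forcing \<xi> svc_tail (S T))"
    using pos T by (intro total_identity) auto
  also have "(\<integral>\<^sup>+s\<in>{0..<T}. net_kernel \<alpha> svc_tail (S T - S s) \<partial>lborel) = (\<integral>\<^sup>+v. net_kernel \<alpha> svc_tail (S T - v) * ennreal (Z v) \<partial>lborel)"
    by (rule change_clock[where f=svc_tail, OF svc_tail_meas svc_tail_zero T(1)])
  also have "forcing \<xi> svc_tail (S T) = ennreal (enn2real (forcing \<xi> svc_tail (S T)))"
    using forcing_finite[where f=svc_tail, OF svc_tail_meas svc_tail_le, where u="S T"] by simp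
  finally show ?thesis
    using False T by (simp add: total_forcing_def sum_nonneg ennreal_plus add_ac)
qed

lemma class_renewal:
  assumes T: "0 \<le> T" and k: "k < K" and x0: "0 \<le> x0"
  shows "ennreal (measure (\<mu> T k) {x0..}) = ennreal (measure (\<xi> k) {x0 + S T..})
    + ((\<integral>\<^sup>+v. net_kernel \<alpha> (svc_tail_at k x0) (S T - v) * ennreal (Z v) \<partial>lborel) + forcing \<xi> (svc_tail_at k x0) (S T))"
proof -
  have "(\<integral>\<^sup>+s\<in>{0..<T}. net_kernel \<alpha> (svc_tail_at k x0) (S T - S s) \<partial>lborel)
      = (\<integral>\<^sup>+v. net_kernel \<alpha> (svc_tail_at k x0) (S T - v) * ennreal (Z v) \<partial>lborel)"
    by (rule change_clock) (auto simp: svc_tail_at_meas svc_tail_at_zero T)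
  then show ?thesis using class_identity[of T k x0] pos T k x0 by simp
qed

end

end

section \<open>Moments of the renewal kernel\<close>

lemma layer_cake:
  fixes M :: "real measure"
  assumes M: "finite_measure M" "sets M = sets borel" and [measurable]: "g \<in> borel_measurable borel"
  shows "(\<integral>\<^sup>+x. g x * ennreal (measure M {x..}) \<partial>lborel) = (\<integral>\<^sup>+y. (\<integral>\<^sup>+x. g x * indicator {..y} x \<partial>lborel) \<partial>M)"
proof -
  interpret finite_measure M by (rule M(1))
  interpret pair_sigma_finite M lborel ..
  note [measurable_cong] = M(2)
  have [measurable]: "(\<lambda>w. indicator {..fst w} (snd w) :: ennreal) \<in> borel_measurable (M \<Otimes>\<^sub>M lborel)"
    by (simp add: indicator_def of_bool_def)
  have "(\<integral>\<^sup>+x. g x * ennreal (measure M {x..}) \<partial>lborel) = (\<integral>\<^sup>+x. (\<integral>\<^sup>+y. g x * indicator {..y} x \<partial>M) \<partial>lborel)"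
  proof (intro nn_integral_cong)
    fix x
    have "(\<integral>\<^sup>+y. g x * indicator {..y} x \<partial>M) = (\<integral>\<^sup>+y. g x * indicator {x..} y \<partial>M)"
      by (intro nn_integral_cong) (auto split: split_indicator)
    also have "\<dots> = g x * emeasure M {x..}" using M(2) by (subst nn_integral_cmult) auto
    finally show "g x * ennreal (measure M {x..}) = (\<integral>\<^sup>+y. g x * indicator {..y} x \<partial>M)"
      by (simp add: emeasure_eq_measure)
  qed
  also have "\<dots> = (\<integral>\<^sup>+y. (\<integral>\<^sup>+x. g x * indicator {..y} x \<partial>lborel) \<partial>M)"
    by (rule Fubini') (simp add: split_beta')
  finally show ?thesis .
qed

lemma nn_integral_lborel_id_Icc: "0 \<le> y \<Longrightarrow> (\<integral>\<^sup>+x. ennreal x * indicator {0..y} x \<partial>lborel) = ennreal (y\<^sup>2 / 2)"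
proof -
  assume y: "0 \<le> y"
  have "(\<integral>\<^sup>+x. ennreal x * indicator {0..y} x \<partial>lborel) = ennreal (y\<^sup>2 / 2 - 0\<^sup>2 / 2)"
    by (rule nn_integral_FTC_Icc) (use y in \<open>auto intro!: derivative_eq_intros simp: has_real_derivative_iff_has_vector_derivative[symmetric]\<close>)
  then show ?thesis by simp
qed

lemma markov_atLeast:
  fixes M :: "real measure"
  assumes M: "finite_measure M" "sets M = sets borel" and b: "(\<integral>\<^sup>+y. ennreal y \<partial>M) \<le> ennreal b" and x: "0 \<le> x" and b0: "0 \<le> b"
  shows "x * measure M {x..} \<le> b"
proof -
  interpret finite_measure M by (rule M(1))
  note [measurable_cong] = M(2)
  have "ennreal (x * measure M {x..}) = (\<integral>\<^sup>+y. ennreal x * indicator {x..} y \<partial>M)"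
    using x M(2) by (subst nn_integral_cmult) (auto simp: emeasure_eq_measure ennreal_mult)
  also have "\<dots> \<le> (\<integral>\<^sup>+y. ennreal y \<partial>M)"
    by (intro nn_integral_mono) (auto split: split_indicator intro: ennreal_leI)
  finally show ?thesis using b b0 ennreal_le_iff[of b "x * measure M {x..}"] by (metis order_trans)
qed

locale network = feedback +
  fixes \<beta> m2 \<alpha> lam' :: "nat \<Rightarrow> real"
  assumes beta_nonneg: "\<And>l. l < K \<Longrightarrow> 0 \<le> \<beta> l" and m2_nonneg: "\<And>l. l < K \<Longrightarrow> 0 \<le> m2 l"
    and beta: "\<And>l. l < K \<Longrightarrow> (\<integral>\<^sup>+y. ennreal y \<partial>\<nu> l) = ennreal (\<beta> l)"
    and m2: "\<And>l. l < K \<Longrightarrow> (\<integral>\<^sup>+y. ennreal (y\<^sup>2) \<partial>\<nu> l) = ennreal (m2 l)"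
    and alpha_nn: "\<And>l. l < K \<Longrightarrow> 0 \<le> \<alpha> l"
    and lam': "\<And>k. k < K \<Longrightarrow> lam' k = \<alpha> k + (\<Sum>j<K. p j k * lam' j)"
    and critical': "(\<Sum>k<K. \<beta> k * lam' k) = 1"
begin

lemma nu_finite: "l < K \<Longrightarrow> finite_measure (\<nu> l)"
  by (intro prob_space.finite_measure nu_prob)

lemma svc_tail_mass:
  assumes l: "l < K"
  shows "(\<integral>\<^sup>+x. svc_tail l x \<partial>lborel) = ennreal (\<beta> l)"
proof -
  have "(\<integral>\<^sup>+x. svc_tail l x \<partial>lborel) = (\<integral>\<^sup>+x. indicator {0<..} x * ennreal (measure (\<nu> l) {x..}) \<partial>lborel)"
    by (intro nn_integral_cong) (auto simp: svc_tail_def split: split_indicator)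
  also have "\<dots> = (\<integral>\<^sup>+y. (\<integral>\<^sup>+x. indicator {0<..} x * indicator {..y} x \<partial>lborel) \<partial>\<nu> l)"
    by (rule layer_cake[OF nu_finite[OF l] nu_sets[OF l]]) simp
  also have "\<dots> = (\<integral>\<^sup>+y. ennreal y \<partial>\<nu> l)"
  proof (rule nn_integral_cong_AE)
    show "AE y in \<nu> l. (\<integral>\<^sup>+x. indicator {0<..} x * indicator {..y} x \<partial>lborel) = ennreal y"
      using nu_pos[OF l]
    proof eventually_elim
      fix y :: real assume "0 < y"
      have "(\<integral>\<^sup>+x. indicator {0<..} x * indicator {..y} x \<partial>lborel) = (\<integral>\<^sup>+x. indicator {0<..y} x \<partial>lborel)"
        by (intro nn_integral_cong) (auto split: split_indicator)
      then show "(\<integral>\<^sup>+x. indicator {0<..} x * indicator {..y} x \<partial>lborel) = ennreal y"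
        using \<open>0 < y\<close> by simp
    qed
  qed
  finally show ?thesis by (simp add: beta[OF l])
qed

lemma svc_tail_moment:
  assumes l: "l < K"
  shows "(\<integral>\<^sup>+x. ennreal x * svc_tail l x \<partial>lborel) = ennreal (m2 l / 2)"
proof -
  have "(\<integral>\<^sup>+x. ennreal x * svc_tail l x \<partial>lborel) = (\<integral>\<^sup>+x. (ennreal x * indicator {0<..} x) * ennreal (measure (\<nu> l) {x..}) \<partial>lborel)"
    by (intro nn_integral_cong) (auto simp: svc_tail_def split: split_indicator)
  also have "\<dots> = (\<integral>\<^sup>+y. (\<integral>\<^sup>+x. ennreal x * indicator {0<..} x * indicator {..y} x \<partial>lborel) \<partial>\<nu> l)"
    by (rule layer_cake[OF nu_finite[OF l] nu_sets[OF l]]) simp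
  also have "\<dots> = (\<integral>\<^sup>+y. ennreal (1 / 2) * ennreal (y\<^sup>2) \<partial>\<nu> l)"
  proof (rule nn_integral_cong_AE)
    show "AE y in \<nu> l. (\<integral>\<^sup>+x. ennreal x * indicator {0<..} x * indicator {..y} x \<partial>lborel) = ennreal (1 / 2) * ennreal (y\<^sup>2)"
      using nu_pos[OF l]
    proof eventually_elim
      fix y :: real assume y: "0 < y"
      have "(\<integral>\<^sup>+x. ennreal x * indicator {0<..} x * indicator {..y} x \<partial>lborel) = (\<integral>\<^sup>+x. ennreal x * indicator {0..y} x \<partial>lborel)"
        by (intro nn_integral_cong) (auto split: split_indicator)
      also have "\<dots> = ennreal (1 / 2 * y\<^sup>2)" using y nn_integral_lborel_id_Icc[of y] by simp
      also have "\<dots> = ennreal (1 / 2) * ennreal (y\<^sup>2)" by (rule ennreal_mult) auto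
      finally show "(\<integral>\<^sup>+x. ennreal x * indicator {0<..} x * indicator {..y} x \<partial>lborel) = ennreal (1 / 2) * ennreal (y\<^sup>2)" .
    qed
  qed
  also have "\<dots> = ennreal (1 / 2) * (\<integral>\<^sup>+y. ennreal (y\<^sup>2) \<partial>\<nu> l)"
    using nu_sets[OF l] by (intro nn_integral_cmult) (simp cong: measurable_cong_sets)
  also have "\<dots> = ennreal (1 / 2 * m2 l)" unfolding m2[OF l] using m2_nonneg[OF l] by (intro ennreal_mult[symmetric]) auto
  finally show ?thesis by simp
qed

lemma svc_tail_markov: "l < K \<Longrightarrow> ennreal x * svc_tail l x \<le> ennreal (\<beta> l)"
proof -
  assume l: "l < K"
  have "x * measure (\<nu> l) {x..} \<le> \<beta> l" if "0 < x"
    using that beta[OF l] beta_nonneg[OF l] by (intro markov_atLeast[OF nu_finite[OF l] nu_sets[OF l]]) auto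
  then show ?thesis by (auto simp: svc_tail_def intro!: ennreal_leI simp flip: ennreal_mult)
qed

lemma res_mass_real:
  assumes fm: "\<And>l. l < K \<Longrightarrow> f l \<in> borel_measurable borel"
    and F: "\<And>l. l < K \<Longrightarrow> (\<integral>\<^sup>+x. f l x \<partial>lborel) = ennreal (F l)" "\<And>l. l < K \<Longrightarrow> 0 \<le> F l"
  obtains R where "\<And>l. l < K \<Longrightarrow> 0 \<le> R l" "\<And>l. l < K \<Longrightarrow> (\<integral>\<^sup>+x. res f l x \<partial>lborel) = ennreal (R l)"
    "\<And>l. l < K \<Longrightarrow> R l = F l + (\<Sum>j<K. p l j * R j)"
proof -
  define C where "C = (\<Sum>l<K. F l)"
  have FC: "(\<integral>\<^sup>+x. f l x \<partial>lborel) \<le> ennreal C" if "l < K" for l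
    unfolding F(1)[OF that] C_def using F that by (intro ennreal_leI member_le_sum) auto
  define R where "R l = enn2real (\<integral>\<^sup>+x. res f l x \<partial>lborel)" for l
  have R: "(\<integral>\<^sup>+x. res f l x \<partial>lborel) = ennreal (R l)" if "l < K" for l
  proof -
    have "(\<integral>\<^sup>+x. res f l x \<partial>lborel) \<le> ennreal C * ennreal (w l)"
      by (rule res_mass_le) (use fm FC that in auto)
    also have "\<dots> < top_class.top" by (simp add: ennreal_mult_less_top)
    finally show ?thesis by (simp add: R_def)
  qed
  show thesis
  proof (rule that[of R])
    fix l assume l: "l < K"
    have "ennreal (R l) = ennreal (F l) + (\<Sum>j<K. ennreal (p l j) * ennreal (R j))"
      using res_mass[of f l] fm l R F(1) by simp
    also have "\<dots> = ennreal (F l) + ennreal (\<Sum>j<K. p l j * R j)"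
      using l p_nonneg by (subst sum_ennreal[symmetric]) (auto simp: ennreal_mult R_def)
    also have "\<dots> = ennreal (F l + (\<Sum>j<K. p l j * R j))"
      using l p_nonneg F(2) by (intro ennreal_plus[symmetric]) (auto simp: R_def intro!: sum_nonneg)
    finally show "R l = F l + (\<Sum>j<K. p l j * R j)"
      using l p_nonneg F(2) by (subst (asm) ennreal_inj) (auto simp: R_def intro!: sum_nonneg add_nonneg_nonneg)
  qed (simp add: R_def, rule R)
qed

lemma net_kernel_integral:
  assumes fm: "\<And>l. l < K \<Longrightarrow> f l \<in> borel_measurable borel" and g[measurable]: "g \<in> borel_measurable borel"
    and R: "\<And>l. l < K \<Longrightarrow> 0 \<le> R l" "\<And>l. l < K \<Longrightarrow> (\<integral>\<^sup>+x. g x * res f l x \<partial>lborel) = ennreal (R l)"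
  shows "(\<integral>\<^sup>+x. g x * net_kernel \<alpha> f x \<partial>lborel) = ennreal (\<Sum>l<K. \<alpha> l * R l)"
proof -
  have "(\<integral>\<^sup>+x. g x * net_kernel \<alpha> f x \<partial>lborel) = (\<integral>\<^sup>+x. 0 + (\<Sum>l<K. ennreal (\<alpha> l) * (g x * res f l x)) \<partial>lborel)"
    unfolding net_kernel_def by (intro nn_integral_cong) (simp add: sum_distrib_left mult_ac)
  also have "\<dots> = (\<integral>\<^sup>+x. 0 \<partial>(lborel :: real measure)) + (\<Sum>l<K. ennreal (\<alpha> l) * ennreal (R l))"
    using R res_meas[of f] fm by (intro nn_integral_add_weighted_sum) auto
  also have "\<dots> = ennreal (\<Sum>l<K. \<alpha> l * R l)"
    using R alpha_nn by (subst sum_ennreal[symmetric]) (auto simp: ennreal_mult)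
  finally show ?thesis .
qed

text \<open>The masses of the resolvent solve R = F + P R, and \<open>alpha_lam_duality\<close>
  trades \<alpha> R for \<lambda> F. Nonnegativity is stated as well because the sign of
  \<open>lam'\<close> has not been established.\<close>

lemma net_kernel_mass:
  assumes fm: "\<And>l. l < K \<Longrightarrow> f l \<in> borel_measurable borel"
    and F: "\<And>l. l < K \<Longrightarrow> (\<integral>\<^sup>+x. f l x \<partial>lborel) = ennreal (F l)" "\<And>l. l < K \<Longrightarrow> 0 \<le> F l"
  shows "(\<integral>\<^sup>+x. net_kernel \<alpha> f x \<partial>lborel) = ennreal (\<Sum>l<K. lam' l * F l)" "0 \<le> (\<Sum>l<K. lam' l * F l)"
proof -
  obtain R where R: "\<And>l. l < K \<Longrightarrow> 0 \<le> R l" "\<And>l. l < K \<Longrightarrow> (\<integral>\<^sup>+x. res f l x \<partial>lborel) = ennreal (R l)"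
    "\<And>l. l < K \<Longrightarrow> R l = F l + (\<Sum>j<K. p l j * R j)"
    using res_mass_real[of f F] fm F by blast
  have eq: "(\<Sum>l<K. \<alpha> l * R l) = (\<Sum>l<K. lam' l * F l)"
    by (rule alpha_lam_duality[OF lam' R(3)]) auto
  show "(\<integral>\<^sup>+x. net_kernel \<alpha> f x \<partial>lborel) = ennreal (\<Sum>l<K. lam' l * F l)"
    unfolding eq[symmetric] using net_kernel_integral[of f "\<lambda>_. 1" R] fm R(1,2) by simp
  show "0 \<le> (\<Sum>l<K. lam' l * F l)"
    unfolding eq[symmetric] using R(1) alpha_nn by (auto intro!: sum_nonneg)
qed

definition h :: "real \<Rightarrow> real" where "h x = enn2real (net_kernel \<alpha> svc_tail x)"

definition hb :: real where "hb = (\<Sum>l<K. \<alpha> l * w l)"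

lemma net_kernel_le:
  assumes "\<And>l. l < K \<Longrightarrow> f l \<in> borel_measurable borel" "\<And>l x. l < K \<Longrightarrow> f l x \<le> svc_tail l x"
  shows "net_kernel \<alpha> f x \<le> net_kernel \<alpha> svc_tail x"
  unfolding net_kernel_def
proof (intro sum_mono mult_left_mono)
  fix l assume "l \<in> {..<K}"
  then show "res f l x \<le> res svc_tail l x" using res_mono[of f svc_tail l x] assms(2) by simp
qed simp

lemma res_svc_tail_le: "l < K \<Longrightarrow> res svc_tail l x \<le> ennreal (w l)"
proof -
  assume l: "l < K"
  have "res svc_tail l x \<le> ennreal 1 * ennreal (w l)"
    by (rule res_le[of svc_tail, OF svc_tail_meas svc_tail_le l])
  then show ?thesis by simp
qed

lemma net_kernel_svc_le: "net_kernel \<alpha> svc_tail x \<le> ennreal hb"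
proof -
  have "net_kernel \<alpha> svc_tail x \<le> (\<Sum>l<K. ennreal (\<alpha> l) * ennreal (w l))"
    unfolding net_kernel_def using res_svc_tail_le by (intro sum_mono mult_left_mono) auto
  also have "\<dots> = ennreal hb"
    unfolding hb_def using alpha_nn w_nonneg by (subst sum_ennreal[symmetric]) (auto simp: ennreal_mult)
  finally show ?thesis .
qed

lemma ennreal_h: "ennreal (h x) = net_kernel \<alpha> svc_tail x"
  unfolding h_def by (rule ennreal_enn2real) (rule le_less_trans[OF net_kernel_svc_le], simp)

lemma res_svc_mass:
  obtains R where "\<And>l. l < K \<Longrightarrow> 0 \<le> R l" "\<And>l. l < K \<Longrightarrow> (\<integral>\<^sup>+x. res svc_tail l x \<partial>lborel) = ennreal (R l)"
    "\<And>l. l < K \<Longrightarrow> R l = \<beta> l + (\<Sum>j<K. p l j * R j)"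
  by (rule res_mass_real[where f=svc_tail and F=\<beta>, OF svc_tail_meas svc_tail_mass beta_nonneg],
      assumption, assumption, assumption, rule that)

text \<open>Weighting by x turns the equation of the resolvent into the same linear system with
  source m2/2 + \<beta> P R, as the mean service time multiplies the masses of the classes visited
  next.\<close>

lemma res_svc_moment:
  assumes R: "\<And>l. l < K \<Longrightarrow> 0 \<le> R l" "\<And>l. l < K \<Longrightarrow> (\<integral>\<^sup>+x. res svc_tail l x \<partial>lborel) = ennreal (R l)"
  obtains X where "\<And>l. l < K \<Longrightarrow> 0 \<le> X l" "\<And>l. l < K \<Longrightarrow> (\<integral>\<^sup>+x. ennreal x * res svc_tail l x \<partial>lborel) = ennreal (X l)"
    "\<And>l. l < K \<Longrightarrow> X l = (m2 l / 2 + \<beta> l * (\<Sum>j<K. p l j * R j)) + (\<Sum>j<K. p l j * X j)"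
proof -
  define X where "X l = enn2real (\<integral>\<^sup>+x. ennreal x * res svc_tail l x \<partial>lborel)" for l
  define C where "C = (\<Sum>l<K. \<beta> l + m2 l / 2)"
  have C: "\<beta> l \<le> C" "m2 l / 2 \<le> C" if "l < K" for l
  proof -
    have "\<beta> l + m2 l / 2 \<le> C" unfolding C_def using that beta_nonneg m2_nonneg by (intro member_le_sum) auto
    then show "\<beta> l \<le> C" "m2 l / 2 \<le> C" using beta_nonneg[OF that] m2_nonneg[OF that] by auto
  qed
  have X: "(\<integral>\<^sup>+x. ennreal x * res svc_tail l x \<partial>lborel) = ennreal (X l)" if "l < K" for l
  proof -
    have "(\<integral>\<^sup>+x. ennreal x * res svc_tail l x \<partial>lborel) < \<infinity>"
      by (rule res_moment_finite[of svc_tail C C])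
        (use that C in \<open>auto simp: svc_tail_meas svc_tail_zero svc_tail_mass svc_tail_moment beta intro!: ennreal_leI\<close>)
    then show ?thesis by (simp add: X_def)
  qed
  show thesis
  proof (rule that[of X])
    fix l assume l: "l < K"
    have "ennreal (X l) = ennreal (m2 l / 2) + (\<Sum>j<K. ennreal (p l j) * (ennreal (X j) + ennreal (\<beta> l) * ennreal (R j)))"
      using res_moment[of svc_tail l] svc_tail_meas svc_tail_zero l X R(2) svc_tail_moment beta by simp
    also have "\<dots> = ennreal (m2 l / 2) + ennreal (\<Sum>j<K. p l j * (X j + \<beta> l * R j))"
      using l p_nonneg R(1) beta_nonneg
      by (subst sum_ennreal[symmetric]) (auto simp: ennreal_mult ennreal_plus X_def)
    also have "\<dots> = ennreal (m2 l / 2 + (\<Sum>j<K. p l j * (X j + \<beta> l * R j)))"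
      using l p_nonneg R(1) beta_nonneg m2_nonneg by (intro ennreal_plus[symmetric]) (auto simp: X_def intro!: sum_nonneg)
    finally have "X l = m2 l / 2 + (\<Sum>j<K. p l j * (X j + \<beta> l * R j))"
      using l p_nonneg R(1) beta_nonneg m2_nonneg by (subst (asm) ennreal_inj) (auto simp: X_def intro!: sum_nonneg add_nonneg_nonneg)
    then show "X l = (m2 l / 2 + \<beta> l * (\<Sum>j<K. p l j * R j)) + (\<Sum>j<K. p l j * X j)"
      by (simp add: distrib_left sum.distrib sum_distrib_left mult_ac)
  qed (simp add: X_def, rule X)
qed

text \<open>If all external rates vanished, duality would give \<Sum> \<lambda> \<beta> = 0 against
  criticality. For a class with positive rate, \<open>\<nu> k\<close> has no mass at 0, so its tail
  is at least 1/2 near 0, and the resolvent dominates its source.\<close>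

lemma kernel_lower:
  obtains c \<delta> where "0 < c" "0 < \<delta>" "\<And>x. 0 < x \<Longrightarrow> x \<le> \<delta> \<Longrightarrow> c \<le> h x"
proof -
  have "\<exists>k<K. 0 < \<alpha> k"
  proof (rule ccontr)
    assume "\<not> ?thesis"
    then have a0: "\<alpha> k = 0" if "k < K" for k
      using alpha_nn[OF that] that by (metis linorder_not_less order_antisym)
    obtain R where "\<And>l. l < K \<Longrightarrow> 0 \<le> R l" "\<And>l. l < K \<Longrightarrow> (\<integral>\<^sup>+x. res svc_tail l x \<partial>lborel) = ennreal (R l)"
      and R: "\<And>l. l < K \<Longrightarrow> R l = \<beta> l + (\<Sum>j<K. p l j * R j)" by (rule res_svc_mass) (rule that)
    have "(\<Sum>l<K. \<alpha> l * R l) = (\<Sum>l<K. lam' l * \<beta> l)"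
      by (rule alpha_lam_duality[OF lam' R]) auto
    then show False using critical' a0 by (simp add: mult.commute)
  qed
  then obtain k where k: "k < K" "0 < \<alpha> k" by blast
  interpret nu: prob_space "\<nu> k" by (rule nu_prob[OF k(1)])
  have "(\<lambda>n. measure (\<nu> k) {1 / real (Suc n)..}) \<longlonglongrightarrow> measure (\<nu> k) (\<Union>n. {1 / real (Suc n)..})"
  proof (rule nu.finite_Lim_measure_incseq)
    show "range (\<lambda>n. {1 / real (Suc n)..}) \<subseteq> sets (\<nu> k)" unfolding nu_sets[OF k(1)] by auto
    show "incseq (\<lambda>n. {1 / real (Suc n)..})"
      unfolding incseq_def by (auto intro: order_trans[rotated] simp: frac_le)
  qed
  also have "(\<Union>n. {1 / real (Suc n)..}) = {0<..}"
  proof (intro equalityI subsetI)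
    fix x :: real assume "x \<in> {0<..}"
    then obtain n where "inverse (real (Suc n)) < x" using reals_Archimedean by auto
    then have "x \<in> {1 / real (Suc n)..}" by (simp add: inverse_eq_divide)
    then show "x \<in> (\<Union>n. {1 / real (Suc n)..})" by blast
  next
    fix x :: real assume "x \<in> (\<Union>n. {1 / real (Suc n)..})"
    then obtain n where "1 / real (Suc n) \<le> x" by auto
    moreover have "0 < 1 / real (Suc n)" by simp
    ultimately show "x \<in> {0<..}" unfolding greaterThan_iff by (rule less_le_trans[rotated])
  qed
  also have "measure (\<nu> k) {0<..} = 1"
    using nu_pos[OF k(1)] nu_sets[OF k(1)] by (subst nu.prob_eq_1) auto
  finally have "\<forall>\<^sub>F n in sequentially. 1 / 2 < measure (\<nu> k) {1 / real (Suc n)..}"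
    by (rule order_tendstoD) simp
  then obtain n where n: "1 / 2 < measure (\<nu> k) {1 / real (Suc n)..}"
    by (auto simp: eventually_sequentially)
  show thesis
  proof (rule that[of "\<alpha> k / 2" "1 / real (Suc n)"])
    fix x :: real assume x: "0 < x" "x \<le> 1 / real (Suc n)"
    have "1 / 2 \<le> measure (\<nu> k) {x..}"
      using n nu.finite_measure_mono[of "{1 / real (Suc n)..}" "{x..}"] x nu_sets[OF k(1)] by auto
    then have "ennreal (1 / 2) \<le> svc_tail k x" using x by (simp add: svc_tail_def ennreal_leI del: ennreal_half)
    also have "\<dots> \<le> res svc_tail k x" using f_le_res[of svc_tail k x] svc_tail_meas k by simp
    finally have "ennreal (\<alpha> k) * ennreal (1 / 2) \<le> ennreal (\<alpha> k) * res svc_tail k x" by (rule mult_left_mono) simp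
    also have "\<dots> \<le> net_kernel \<alpha> svc_tail x"
      unfolding net_kernel_def using k by (intro member_le_sum[of k "{..<K}" "\<lambda>l. ennreal (\<alpha> l) * res svc_tail l x"]) auto
    finally have "ennreal (\<alpha> k * (1 / 2)) \<le> ennreal (h x)"
      using k by (subst ennreal_mult) (auto simp: ennreal_h)
    then show "\<alpha> k / 2 \<le> h x" by (simp add: h_def)
  qed (use k in auto)
qed

text \<open>For \<open>x0 \<ge> 0\<close> this is the mean service time times the tail of the
  equilibrium law \<open>nu_e \<nu> k\<close> beyond \<open>x0\<close>; the normalisation is left
  out because \<open>lift\<close> multiplies it back in.\<close>

definition resid :: "nat \<Rightarrow> real \<Rightarrow> real" where
  "resid k x0 = enn2real (\<integral>\<^sup>+x. indicator {x0<..} x * svc_tail k x \<partial>lborel)"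

lemma ennreal_resid: "k < K \<Longrightarrow> ennreal (resid k x0) = (\<integral>\<^sup>+x. indicator {x0<..} x * svc_tail k x \<partial>lborel)"
proof -
  assume k: "k < K"
  have "(\<integral>\<^sup>+x. indicator {x0<..} x * svc_tail k x \<partial>lborel) \<le> (\<integral>\<^sup>+x. svc_tail k x \<partial>lborel)"
    by (intro nn_integral_mono) (auto split: split_indicator)
  also have "\<dots> < top_class.top" by (simp add: svc_tail_mass[OF k])
  finally show ?thesis unfolding resid_def by (rule ennreal_enn2real)
qed

lemma resid_nonneg: "0 \<le> resid k x0" by (simp add: resid_def)

lemma resid_0: "k < K \<Longrightarrow> resid k 0 = \<beta> k"
proof -
  assume k: "k < K"
  have "ennreal (resid k 0) = (\<integral>\<^sup>+x. svc_tail k x \<partial>lborel)"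
    unfolding ennreal_resid[OF k] by (intro nn_integral_cong) (auto simp: svc_tail_def split: split_indicator)
  then show ?thesis using svc_tail_mass[OF k] beta_nonneg[OF k] by (simp add: resid_nonneg)
qed

lemma resid_markov: "k < K \<Longrightarrow> 0 \<le> x0 \<Longrightarrow> x0 * resid k x0 \<le> m2 k / 2"
proof -
  assume k: "k < K" and x0: "0 \<le> x0"
  note [measurable] = svc_tail_meas[OF k]
  have "ennreal (x0 * resid k x0) = (\<integral>\<^sup>+x. ennreal x0 * (indicator {x0<..} x * svc_tail k x) \<partial>lborel)"
    using x0 k by (subst nn_integral_cmult) (auto simp: ennreal_mult resid_nonneg ennreal_resid)
  also have "\<dots> \<le> (\<integral>\<^sup>+x. ennreal x * svc_tail k x \<partial>lborel)"
    by (intro nn_integral_mono) (auto split: split_indicator intro!: mult_right_mono ennreal_leI)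
  finally show ?thesis using svc_tail_moment[OF k] m2_nonneg[OF k] by simp
qed

lemma svc_tail_at_mass:
  assumes k: "k < K" and x0: "0 \<le> x0" and l: "l < K"
  shows "(\<integral>\<^sup>+x. svc_tail_at k x0 l x \<partial>lborel) = ennreal (if l = k then resid k x0 else 0)"
proof (cases "l = k")
  case True
  note [measurable] = svc_tail_meas[OF k]
  have "(\<integral>\<^sup>+x. svc_tail_at k x0 k x \<partial>lborel) = (\<integral>\<^sup>+x. indicator {x0<..} (x - (- x0)) * svc_tail k (x - (- x0)) \<partial>lborel)"
    using x0 by (intro nn_integral_cong) (auto simp: svc_tail_at_def svc_tail_def add.commute split: split_indicator)
  also have "\<dots> = ennreal (resid k x0)"
    unfolding ennreal_resid[OF k] by (rule nn_integral_lborel_shift[of "\<lambda>x. indicator {x0<..} x * svc_tail k x"]) measurable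
  finally show ?thesis using True by simp
next
  case False
  then show ?thesis by (simp add: svc_tail_at_def)
qed

lemma net_kernel_at_mass:
  assumes k: "k < K" and x0: "0 \<le> x0"
  shows "(\<integral>\<^sup>+x. net_kernel \<alpha> (svc_tail_at k x0) x \<partial>lborel) = ennreal (lam' k * resid k x0)" "0 \<le> lam' k * resid k x0"
proof -
  have eq: "(\<Sum>l<K. lam' l * (if l = k then resid k x0 else 0)) = lam' k * resid k x0"
  proof -
    have "(\<Sum>l<K. lam' l * (if l = k then resid k x0 else 0)) = (\<Sum>l<K. if l = k then lam' k * resid k x0 else 0)"
      by (intro sum.cong) auto
    then show ?thesis using k by simp
  qed
  show "(\<integral>\<^sup>+x. net_kernel \<alpha> (svc_tail_at k x0) x \<partial>lborel) = ennreal (lam' k * resid k x0)" "0 \<le> lam' k * resid k x0"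
    using net_kernel_mass[of "svc_tail_at k x0" "\<lambda>l. if l = k then resid k x0 else 0"]
      svc_tail_at_meas svc_tail_at_mass[OF k x0] resid_nonneg unfolding eq by auto
qed

text \<open>Criticality is exactly the statement that the kernel is a probability density.\<close>

lemma kernel_mass: "(\<integral>\<^sup>+x. ennreal (h x) \<partial>lborel) = 1"
proof -
  have "(\<Sum>l<K. lam' l * \<beta> l) = 1" using critical' by (simp only: mult.commute)
  then show ?thesis unfolding ennreal_h
    using net_kernel_mass(1)[of svc_tail \<beta>] svc_tail_meas svc_tail_mass beta_nonneg by simp
qed

lemma h_meas: "h \<in> borel_measurable borel"
proof -
  have [measurable]: "net_kernel \<alpha> svc_tail \<in> borel_measurable borel"
    by (rule net_kernel_meas) (rule svc_tail_meas)
  show ?thesis unfolding h_def by measurable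
qed

text \<open>Duality applied to the first moments \<open>X\<close> of the resolvents. The resulting
  sum is the constant of the lifting map in dual form.\<close>

lemma kernel_moment:
  assumes R: "\<And>l. l < K \<Longrightarrow> 0 \<le> R l" "\<And>l. l < K \<Longrightarrow> (\<integral>\<^sup>+x. res svc_tail l x \<partial>lborel) = ennreal (R l)"
  shows "(\<integral>\<^sup>+x. ennreal (x * h x) \<partial>lborel) = ennreal (\<Sum>l<K. lam' l * (m2 l / 2 + \<beta> l * (\<Sum>j<K. p l j * R j)))"
    "0 \<le> (\<Sum>l<K. lam' l * (m2 l / 2 + \<beta> l * (\<Sum>j<K. p l j * R j)))"
proof -
  obtain X where X: "\<And>l. l < K \<Longrightarrow> 0 \<le> X l" "\<And>l. l < K \<Longrightarrow> (\<integral>\<^sup>+x. ennreal x * res svc_tail l x \<partial>lborel) = ennreal (X l)"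
    "\<And>l. l < K \<Longrightarrow> X l = (m2 l / 2 + \<beta> l * (\<Sum>j<K. p l j * R j)) + (\<Sum>j<K. p l j * X j)"
    by (rule res_svc_moment[OF R], assumption, assumption, rule that)
  have eq: "(\<Sum>l<K. \<alpha> l * X l) = (\<Sum>l<K. lam' l * (m2 l / 2 + \<beta> l * (\<Sum>j<K. p l j * R j)))"
    by (rule alpha_lam_duality[OF lam' X(3)]) auto
  have "(\<integral>\<^sup>+x. ennreal (x * h x) \<partial>lborel) = (\<integral>\<^sup>+x. ennreal x * net_kernel \<alpha> svc_tail x \<partial>lborel)"
    unfolding ennreal_h[symmetric] by (intro nn_integral_cong ennreal_mult'') (simp add: h_def)
  also have "\<dots> = ennreal (\<Sum>l<K. \<alpha> l * X l)"
    using net_kernel_integral[of svc_tail ennreal X] svc_tail_meas X(1,2) by simp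
  finally show "(\<integral>\<^sup>+x. ennreal (x * h x) \<partial>lborel) = ennreal (\<Sum>l<K. lam' l * (m2 l / 2 + \<beta> l * (\<Sum>j<K. p l j * R j)))"
    unfolding eq .
  show "0 \<le> (\<Sum>l<K. lam' l * (m2 l / 2 + \<beta> l * (\<Sum>j<K. p l j * R j)))"
    unfolding eq[symmetric] using X(1) alpha_nn by (auto intro!: sum_nonneg)
qed

end

section \<open>Bounds on the initial work\<close>

lemma is_meas_AE_nonneg: "is_meas M \<Longrightarrow> AE y in M. 0 \<le> y"
  by (rule AE_I[of _ _ "{..<0}"]) (auto simp: is_meas_def)

lemma ennreal_le_of_mult_le:
  assumes "0 < x" "0 \<le> C" "ennreal x * a \<le> ennreal C"
  shows "a \<le> ennreal (C / x)"
proof -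
  have "a = ennreal (1 / x) * (ennreal x * a)"
    using assms(1) by (simp add: mult.assoc[symmetric] flip: ennreal_mult)
  also have "\<dots> \<le> ennreal (1 / x) * ennreal C" by (intro mult_left_mono assms(3)) simp
  also have "\<dots> = ennreal (C / x)" using assms by (simp flip: ennreal_mult)
  finally show ?thesis .
qed

text \<open>Meant for functions of \<open>u - y\<close>: sizes below \<open>u / 2\<close> leave an
  argument above \<open>u / 2\<close>, where decay applies; larger ones have mass at most
  \<open>2 * N / u\<close> by Markov. The bound depends on the measure only through
  \<open>N\<close>.\<close>

lemma nn_integral_split_half:
  fixes M :: "real measure"
  assumes M: "is_meas M" "mass M \<le> N" "(\<integral>\<^sup>+y. ennreal y \<partial>M) \<le> ennreal N" and N: "0 \<le> N"
    and u: "0 < u" and ab: "0 \<le> a" "0 \<le> b" and f: "\<And>y. 0 \<le> y \<Longrightarrow> y < u / 2 \<Longrightarrow> f y \<le> ennreal (a / u)" "\<And>y. f y \<le> ennreal b"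
  shows "(\<integral>\<^sup>+y. f y \<partial>M) \<le> ennreal ((a * N + 2 * b * N) / u)"
proof -
  interpret finite_measure M by (rule is_meas_split(1)[OF M(1)])
  note [measurable_cong] = is_meas_split(2)[OF M(1)]
  have mk: "measure M {u / 2..} \<le> 2 * N / u"
  proof -
    have "u / 2 * measure M {u / 2..} \<le> N"
      using u M(3) N by (intro markov_atLeast is_meas_split M(1)) auto
    then show ?thesis using u by (simp add: field_simps)
  qed
  have "(\<integral>\<^sup>+y. f y \<partial>M) \<le> (\<integral>\<^sup>+y. ennreal (a / u) + ennreal b * indicator {u / 2..} y \<partial>M)"
  proof (rule nn_integral_mono_AE)
    show "AE y in M. f y \<le> ennreal (a / u) + ennreal b * indicator {u / 2..} y"
      using is_meas_AE_nonneg[OF M(1)]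
    proof eventually_elim
      fix y :: real assume "0 \<le> y"
      then show "f y \<le> ennreal (a / u) + ennreal b * indicator {u / 2..} y"
        using f(1)[of y] f(2)[of y] by (cases "y < u / 2") (auto intro: add_increasing)
    qed
  qed
  also have "\<dots> = ennreal (a / u) * emeasure M (space M) + ennreal b * emeasure M {u / 2..}"
    by (subst nn_integral_add) (auto simp: nn_integral_cmult is_meas_split(2)[OF M(1)])
  also have "\<dots> = ennreal (a / u) * ennreal (mass M) + ennreal b * ennreal (measure M {u / 2..})"
    by (simp add: emeasure_eq_measure mass_def)
  also have "\<dots> \<le> ennreal (a / u) * ennreal N + ennreal b * ennreal (2 * N / u)"
    using M(2) mk by (intro add_mono mult_left_mono ennreal_leI) auto
  also have "\<dots> = ennreal (a / u * N) + ennreal (b * (2 * N / u))"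
    using u ab N by (simp flip: ennreal_mult)
  also have "\<dots> = ennreal (a / u * N + b * (2 * N / u))"
    using u ab N by (intro ennreal_plus[symmetric]) auto
  also have "a / u * N + b * (2 * N / u) = (a * N + 2 * b * N) / u" using u by (simp add: field_simps)
  finally show ?thesis .
qed

text \<open>The layer cake formula turns the left side into the integral of the excess over
  \<open>u\<close>, which is at most \<open>u powr (- q) * y powr (1 + q)\<close>. Here the moment
  of order 1 + q makes the smallness uniform; a bound on the mean would not.\<close>

lemma tail_integral_le_power:
  fixes M :: "real measure"
  assumes M: "is_meas M" "(\<integral>\<^sup>+y. ennreal (y powr (1 + q)) \<partial>M) \<le> ennreal N" and u: "0 < u" and q: "0 < q" and N: "0 \<le> N"
  shows "(\<integral>\<^sup>+v\<in>{u<..}. ennreal (measure M {v..}) \<partial>lborel) \<le> ennreal (N * u powr (- q))"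
proof -
  note ms = is_meas_split(1,2)[OF M(1)]
  note [measurable_cong] = ms(2)
  have "(\<integral>\<^sup>+v\<in>{u<..}. ennreal (measure M {v..}) \<partial>lborel) = (\<integral>\<^sup>+v. indicator {u<..} v * ennreal (measure M {v..}) \<partial>lborel)"
    by (simp add: mult.commute)
  also have "\<dots> = (\<integral>\<^sup>+y. (\<integral>\<^sup>+v. indicator {u<..} v * indicator {..y} v \<partial>lborel) \<partial>M)"
    by (rule layer_cake[OF ms]) simp
  also have "\<dots> \<le> (\<integral>\<^sup>+y. ennreal (u powr (- q)) * ennreal (y powr (1 + q)) \<partial>M)"
  proof (intro nn_integral_mono)
    fix y :: real
    show "(\<integral>\<^sup>+v. indicator {u<..} v * indicator {..y} v \<partial>lborel) \<le> ennreal (u powr (- q)) * ennreal (y powr (1 + q))"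
    proof (cases "u < y")
      case True
      have "(\<integral>\<^sup>+v. indicator {u<..} v * indicator {..y} v \<partial>lborel) = (\<integral>\<^sup>+v. indicator {u<..y} v \<partial>lborel)"
        by (intro nn_integral_cong) (auto split: split_indicator)
      also have "\<dots> = ennreal (y - u)" using True by simp
      also have "\<dots> \<le> ennreal (u powr (- q) * y powr (1 + q))"
      proof (rule ennreal_leI)
        have "u powr q \<le> y powr q" using True u q by (intro powr_mono2) auto
        then have "1 \<le> u powr (- q) * y powr q" using u by (simp add: powr_minus field_simps)
        then have "y * 1 \<le> y * (u powr (- q) * y powr q)" using True u by (intro mult_left_mono) auto
        moreover have "y powr (1 + q) = y * y powr q" using True u by (simp add: powr_add)
        ultimately show "y - u \<le> u powr (- q) * y powr (1 + q)" using u by (simp add: mult_ac)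
      qed
      also have "\<dots> = ennreal (u powr (- q)) * ennreal (y powr (1 + q))" by (rule ennreal_mult) auto
      finally show ?thesis .
    next
      case False
      have "(\<integral>\<^sup>+v. indicator {u<..} v * indicator {..y} v \<partial>lborel) = (\<integral>\<^sup>+v. 0 \<partial>(lborel :: real measure))"
        using False by (intro nn_integral_cong) (auto split: split_indicator)
      then show ?thesis by simp
    qed
  qed
  also have "\<dots> = ennreal (u powr (- q)) * (\<integral>\<^sup>+y. ennreal (y powr (1 + q)) \<partial>M)"
    by (rule nn_integral_cmult) measurable
  also have "\<dots> \<le> ennreal (u powr (- q)) * ennreal N" by (intro mult_left_mono M(2)) simp
  also have "\<dots> = ennreal (N * u powr (- q))" using N by (simp add: mult.commute flip: ennreal_mult)
  finally show ?thesis .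
qed

lemma nn_integral_convolve_meas:
  fixes M :: "real measure"
  assumes M: "finite_measure M" "sets M = sets borel"
    and [measurable]: "d \<in> borel_measurable borel" "r \<in> borel_measurable borel"
  shows "(\<lambda>u. \<integral>\<^sup>+y. d u * r (u - y) \<partial>M) \<in> borel_measurable borel"
proof -
  interpret finite_measure M by (rule M(1))
  note [measurable_cong] = M(2)
  show ?thesis by (rule borel_measurable_nn_integral) measurable
qed

section \<open>Uniform estimates of the forcing\<close>

context network
begin

definition moment_bounded :: "real \<Rightarrow> real \<Rightarrow> (nat \<Rightarrow> real measure) \<Rightarrow> bool" where
  "moment_bounded q N \<xi> \<longleftrightarrow> (\<forall>j<K. is_meas (\<xi> j) \<and> mass (\<xi> j) \<le> N \<and> (\<integral>\<^sup>+y. ennreal y \<partial>\<xi> j) \<le> ennreal N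
     \<and> (\<integral>\<^sup>+y. ennreal (y powr (1 + q)) \<partial>\<xi> j) \<le> ennreal N)"

text \<open>The forcing of the scalar equation, defined from the initial state alone so that uniform
  estimates do not mention a fluid path; along a path it coincides with
  \<open>total_forcing\<close>.\<close>

definition drive :: "(nat \<Rightarrow> real measure) \<Rightarrow> real \<Rightarrow> real" where
  "drive \<xi> u = (if 0 \<le> u then (\<Sum>k<K. measure (\<xi> k) {u..}) + enn2real (forcing \<xi> svc_tail u) else 0)"

lemma forcing_sum_le:
  assumes "\<And>j l. j < K \<Longrightarrow> l < K \<Longrightarrow> I j l \<le> ennreal (b l)" and b: "\<And>l. l < K \<Longrightarrow> 0 \<le> b l"
  shows "(\<Sum>j<K. \<Sum>l<K. ennreal (p j l) * I j l) \<le> ennreal (\<Sum>j<K. \<Sum>l<K. p j l * b l)"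
proof -
  have "(\<Sum>j<K. \<Sum>l<K. ennreal (p j l) * I j l) \<le> (\<Sum>j<K. \<Sum>l<K. ennreal (p j l * b l))"
    using assms p_nonneg by (intro sum_mono) (auto simp: ennreal_mult intro!: mult_left_mono)
  also have "\<dots> = (\<Sum>j<K. ennreal (\<Sum>l<K. p j l * b l))"
    using b p_nonneg by (intro sum.cong refl sum_ennreal) auto
  also have "\<dots> = ennreal (\<Sum>j<K. \<Sum>l<K. p j l * b l)"
    using b p_nonneg by (intro sum_ennreal) (auto intro!: sum_nonneg)
  finally show ?thesis .
qed

lemma forcing_meas:
  assumes "\<And>j. j < K \<Longrightarrow> is_meas (\<xi> j)"
  shows "forcing \<xi> svc_tail \<in> borel_measurable borel"
proof -
  have "(\<lambda>u. \<integral>\<^sup>+y. 1 * res svc_tail l (u - y) \<partial>\<xi> j) \<in> borel_measurable borel" if j: "j < K" and l: "l < K" for j l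
  proof (rule nn_integral_convolve_meas[OF is_meas_split(1,2)[OF assms[OF j]]])
    show "res svc_tail l \<in> borel_measurable borel" using res_meas[of svc_tail l] svc_tail_meas l by blast
  qed simp
  then show ?thesis unfolding forcing_def by (intro borel_measurable_sum borel_measurable_times) auto
qed

lemma forcing_bound:
  assumes \<xi>: "moment_bounded q N \<xi>" and N: "0 \<le> N"
  shows "forcing \<xi> svc_tail u \<le> ennreal (\<Sum>j<K. \<Sum>l<K. p j l * (w l * N))"
  unfolding forcing_def
proof (rule forcing_sum_le)
  fix j l assume j: "j < K" and l: "l < K"
  have m: "is_meas (\<xi> j)" "mass (\<xi> j) \<le> N" using \<xi> j by (auto simp: moment_bounded_def)
  interpret finite_measure "\<xi> j" by (rule is_meas_split(1)[OF m(1)])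
  have "(\<integral>\<^sup>+y. res svc_tail l (u - y) \<partial>\<xi> j) \<le> (\<integral>\<^sup>+y. ennreal (w l) \<partial>\<xi> j)"
    by (intro nn_integral_mono res_svc_tail_le l)
  also have "\<dots> = ennreal (w l * mass (\<xi> j))" using w_nonneg[OF l] by (simp add: emeasure_eq_measure mass_def ennreal_mult)
  also have "\<dots> \<le> ennreal (w l * N)" using m w_nonneg[OF l] by (intro ennreal_leI mult_left_mono) auto
  finally show "(\<integral>\<^sup>+y. res svc_tail l (u - y) \<partial>\<xi> j) \<le> ennreal (w l * N)" .
qed (use w_nonneg N in auto)

lemma ennreal_forcing:
  assumes "moment_bounded q N \<xi>" "0 \<le> N"
  shows "ennreal (enn2real (forcing \<xi> svc_tail u)) = forcing \<xi> svc_tail u"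
  by (rule ennreal_enn2real) (rule le_less_trans[OF forcing_bound[OF assms]], simp)

lemma drive_nonneg: "0 \<le> drive \<xi> u" by (simp add: drive_def sum_nonneg)

lemma drive_meas:
  assumes "\<And>j. j < K \<Longrightarrow> is_meas (\<xi> j)"
  shows "drive \<xi> \<in> borel_measurable borel"
proof -
  have [measurable]: "(\<lambda>u. measure (\<xi> k) {u..}) \<in> borel_measurable borel" if "k < K" for k
    using that assms by (intro measurable_measure_atLeast is_meas_split)
  have [measurable]: "(\<lambda>u. \<Sum>k<K. measure (\<xi> k) {u..}) \<in> borel_measurable borel"
    by (intro borel_measurable_sum) auto
  note [measurable] = forcing_meas[OF assms]
  show ?thesis unfolding drive_def by measurable
qed

lemma drive_bounded:
  assumes N: "0 \<le> N"
  obtains C where "0 \<le> C" "\<And>\<xi> u. moment_bounded q N \<xi> \<Longrightarrow> drive \<xi> u \<le> C"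
proof -
  let ?C2 = "\<Sum>j<K. \<Sum>l<K. p j l * (w l * N)"
  have C2: "0 \<le> ?C2" using p_nonneg w_nonneg N by (auto intro!: sum_nonneg)
  show thesis
  proof (rule that[of "real K * N + ?C2"])
    fix \<xi> u assume \<xi>: "moment_bounded q N \<xi>"
    have "(\<Sum>k<K. measure (\<xi> k) {u..}) \<le> (\<Sum>k<K. N)"
    proof (intro sum_mono)
      fix k assume "k \<in> {..<K}"
      then have "is_meas (\<xi> k)" "mass (\<xi> k) \<le> N" using \<xi> by (auto simp: moment_bounded_def)
      then show "measure (\<xi> k) {u..} \<le> N" using is_meas_split(5)[of "\<xi> k" u] by (smt (verit) measure_nonneg)
    qed
    moreover have "enn2real (forcing \<xi> svc_tail u) \<le> ?C2"
      using forcing_bound[OF \<xi> N] C2 by (simp add: enn2real_leI)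
    moreover have "0 \<le> real K * N" using N by simp
    ultimately show "drive \<xi> u \<le> real K * N + ?C2" using C2 by (simp add: drive_def)
  qed (use N C2 in auto)
qed

text \<open>Both parts are of order 1/u with constants that depend on the state only through
  \<open>N\<close>: the initial tails by Markov, the routed part by the decay of the resolvent and
  the splitting at \<open>u / 2\<close>.\<close>

lemma drive_small:
  assumes N: "0 \<le> N" and e: "0 < e"
  shows "\<exists>T. \<forall>\<xi>. moment_bounded q N \<xi> \<longrightarrow> (\<forall>u\<ge>T. drive \<xi> u \<le> e)"
proof -
  define b where "b = (\<Sum>l<K. \<beta> l)"
  have b: "\<beta> l \<le> b" if "l < K" for l unfolding b_def using that beta_nonneg by (intro member_le_sum) auto
  have b0: "0 \<le> b" unfolding b_def using beta_nonneg by (auto intro!: sum_nonneg)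
  obtain C where C: "0 \<le> C" "\<And>l x. l < K \<Longrightarrow> ennreal x * res svc_tail l x \<le> ennreal C"
  proof (rule res_decay[of svc_tail b])
    show "svc_tail l x \<le> 1" if "l < K" for l x using svc_tail_le[OF that] by simp
    show "ennreal x * svc_tail l x \<le> ennreal b" if "l < K" for l x
      using svc_tail_markov[OF that, of x] b[OF that] by (meson ennreal_leI order_trans)
    show "(\<integral>\<^sup>+y. ennreal y \<partial>\<nu> l) \<le> ennreal b" if "l < K" for l
      unfolding beta[OF that] by (rule ennreal_leI[OF b[OF that]])
  qed (auto simp: svc_tail_meas svc_tail_zero)
  define E where "E = (\<Sum>j<K. \<Sum>l<K. p j l * (2 * C * N + 2 * w l * N))"
  have E: "0 \<le> E" unfolding E_def using p_nonneg w_nonneg N C by (auto intro!: sum_nonneg)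
  have le: "drive \<xi> u \<le> (real K * N + E) / u" if \<xi>: "moment_bounded q N \<xi>" and u: "0 < u" for \<xi> u
  proof -
    have "(\<Sum>k<K. measure (\<xi> k) {u..}) \<le> (\<Sum>k<K. N / u)"
    proof (intro sum_mono)
      fix k assume "k \<in> {..<K}"
      then have m: "is_meas (\<xi> k)" "(\<integral>\<^sup>+y. ennreal y \<partial>\<xi> k) \<le> ennreal N" using \<xi> by (auto simp: moment_bounded_def)
      have "u * measure (\<xi> k) {u..} \<le> N" using m u N by (intro markov_atLeast is_meas_split) auto
      then show "measure (\<xi> k) {u..} \<le> N / u" using u by (simp add: field_simps)
    qed
    moreover have "forcing \<xi> svc_tail u \<le> ennreal (\<Sum>j<K. \<Sum>l<K. p j l * ((2 * C * N + 2 * w l * N) / u))"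
      unfolding forcing_def
    proof (rule forcing_sum_le)
      fix j l assume j: "j < K" and l: "l < K"
      have m: "is_meas (\<xi> j)" "mass (\<xi> j) \<le> N" "(\<integral>\<^sup>+y. ennreal y \<partial>\<xi> j) \<le> ennreal N" using \<xi> j by (auto simp: moment_bounded_def)
      show "(\<integral>\<^sup>+y. res svc_tail l (u - y) \<partial>\<xi> j) \<le> ennreal ((2 * C * N + 2 * w l * N) / u)"
      proof (rule nn_integral_split_half[OF m N u _ w_nonneg[OF l]])
        fix y assume y: "0 \<le> y" "y < u / 2"
        have "res svc_tail l (u - y) \<le> ennreal (C / (u - y))"
          using y u C(2)[OF l, of "u - y"] by (intro ennreal_le_of_mult_le C(1)) auto
        also have "\<dots> \<le> ennreal (2 * C / u)"
        proof (rule ennreal_leI)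
          have "C / (u - y) \<le> C / (u / 2)" using y u C(1) by (intro divide_left_mono) auto
          then show "C / (u - y) \<le> 2 * C / u" by (simp add: mult.commute)
        qed
        finally show "res svc_tail l (u - y) \<le> ennreal (2 * C / u)" .
      qed (use C(1) res_svc_tail_le[OF l] in auto)
    qed (use w_nonneg N C u in auto)
    moreover have "(\<Sum>j<K. \<Sum>l<K. p j l * ((2 * C * N + 2 * w l * N) / u)) = E / u"
      by (simp add: E_def sum_divide_distrib)
    ultimately have "(\<Sum>k<K. measure (\<xi> k) {u..}) \<le> real K * N / u" "enn2real (forcing \<xi> svc_tail u) \<le> E / u"
      using E u by (auto simp: enn2real_leI)
    then show ?thesis using u by (simp add: drive_def add_divide_distrib)
  qed
  define T where "T = (real K * N + E) / e + 1"
  have "drive \<xi> u \<le> e" if \<xi>: "moment_bounded q N \<xi>" and u: "T \<le> u" for \<xi> u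
  proof -
    have "0 \<le> (real K * N + E) / e" using N E e by simp
    then have u0: "0 < u" using u by (simp add: T_def)
    have "(real K * N + E) / e \<le> u" using u by (simp add: T_def)
    then have "(real K * N + E) / u \<le> e" using u0 e by (simp add: field_simps)
    then show ?thesis using le[OF \<xi> u0] by linarith
  qed
  then show ?thesis by blast
qed

lemma ennreal_drive:
  assumes "moment_bounded q N \<xi>" "0 \<le> N" "0 \<le> u"
  shows "ennreal (drive \<xi> u) = (\<Sum>k<K. ennreal (measure (\<xi> k) {u..})) + forcing \<xi> svc_tail u"
  using assms ennreal_forcing[OF assms(1,2), of u] by (simp add: drive_def ennreal_plus sum_nonneg)

text \<open>The free weight \<open>c\<close> lets one exchange of integrals serve both the total
  integral and the integral over \<open>{u<..}\<close>.\<close>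

lemma nn_integral_drive:
  assumes \<xi>: "moment_bounded q N \<xi>" and N: "0 \<le> N" and c[measurable]: "c \<in> borel_measurable borel"
  shows "(\<integral>\<^sup>+u. ennreal (drive \<xi> u) * (c u * indicator {0<..} u) \<partial>lborel)
     = (\<Sum>k<K. \<integral>\<^sup>+u. (c u * indicator {0<..} u) * ennreal (measure (\<xi> k) {u..}) \<partial>lborel)
       + (\<Sum>j<K. \<Sum>l<K. ennreal (p j l) * (\<integral>\<^sup>+y. (\<integral>\<^sup>+u. (c u * indicator {0<..} u) * res svc_tail l (u - y) \<partial>lborel) \<partial>\<xi> j))"
proof -
  have m: "is_meas (\<xi> k)" if "k < K" for k using \<xi> that by (auto simp: moment_bounded_def)
  define d where "d u = c u * indicator {0<..} u" for u :: real
  have [measurable]: "d \<in> borel_measurable borel" unfolding d_def by measurable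
  have r[measurable]: "res svc_tail l \<in> borel_measurable borel" if "l < K" for l
    using res_meas[of svc_tail l] svc_tail_meas that by blast
  have [measurable]: "(\<lambda>u. measure (\<xi> k) {u..}) \<in> borel_measurable borel" if "k < K" for k
    using that m by (intro measurable_measure_atLeast is_meas_split)
  have inner: "(\<lambda>u. \<integral>\<^sup>+y. d u * res svc_tail l (u - y) \<partial>\<xi> j) \<in> borel_measurable borel \<and>
      (\<integral>\<^sup>+u. (\<integral>\<^sup>+y. d u * res svc_tail l (u - y) \<partial>\<xi> j) \<partial>lborel) = (\<integral>\<^sup>+y. (\<integral>\<^sup>+u. d u * res svc_tail l (u - y) \<partial>lborel) \<partial>\<xi> j)"
    if j: "j < K" and l: "l < K" for j l
  proof
    interpret finite_measure "\<xi> j" by (rule is_meas_split(1)[OF m[OF j]])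
    interpret pair_sigma_finite "\<xi> j" lborel ..
    note [measurable_cong] = is_meas_split(2)[OF m[OF j]]
    note [measurable] = r[OF l]
    show "(\<lambda>u. \<integral>\<^sup>+y. d u * res svc_tail l (u - y) \<partial>\<xi> j) \<in> borel_measurable borel"
      by (rule nn_integral_convolve_meas[OF is_meas_split(1,2)[OF m[OF j]]]) measurable
    show "(\<integral>\<^sup>+u. (\<integral>\<^sup>+y. d u * res svc_tail l (u - y) \<partial>\<xi> j) \<partial>lborel) = (\<integral>\<^sup>+y. (\<integral>\<^sup>+u. d u * res svc_tail l (u - y) \<partial>lborel) \<partial>\<xi> j)"
      by (rule Fubini') measurable
  qed
  have inner_m: "(\<lambda>u. ennreal (p j l) * (\<integral>\<^sup>+y. d u * res svc_tail l (u - y) \<partial>\<xi> j)) \<in> borel_measurable borel"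
    if "j < K" "l < K" for j l
  proof -
    note [measurable] = inner[THEN conjunct1, OF that]
    show ?thesis by simp
  qed
  have "(\<integral>\<^sup>+u. ennreal (drive \<xi> u) * d u \<partial>lborel)
      = (\<integral>\<^sup>+u. (\<Sum>k<K. d u * ennreal (measure (\<xi> k) {u..}))
          + (\<Sum>j<K. \<Sum>l<K. ennreal (p j l) * (\<integral>\<^sup>+y. d u * res svc_tail l (u - y) \<partial>\<xi> j)) \<partial>lborel)"
  proof (intro nn_integral_cong)
    fix u :: real
    have "(\<integral>\<^sup>+y. d u * res svc_tail l (u - y) \<partial>\<xi> j) = d u * (\<integral>\<^sup>+y. res svc_tail l (u - y) \<partial>\<xi> j)" if j: "j < K" and l: "l < K" for j l
    proof -
      note [measurable_cong] = is_meas_split(2)[OF m[OF j]]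
      note [measurable] = r[OF l]
      show ?thesis by (rule nn_integral_cmult) measurable
    qed
    then have "(\<Sum>j<K. \<Sum>l<K. ennreal (p j l) * (\<integral>\<^sup>+y. d u * res svc_tail l (u - y) \<partial>\<xi> j)) = d u * forcing \<xi> svc_tail u"
      unfolding forcing_def sum_distrib_left by (intro sum.cong refl) (simp add: mult_ac)
    moreover have "ennreal (drive \<xi> u) * d u = d u * ((\<Sum>k<K. ennreal (measure (\<xi> k) {u..})) + forcing \<xi> svc_tail u)"
    proof (cases "0 < u")
      case True
      then show ?thesis using ennreal_drive[OF \<xi> N, of u] by (simp add: mult.commute)
    next
      case False
      then show ?thesis by (simp add: d_def)
    qed
    ultimately show "ennreal (drive \<xi> u) * d u = (\<Sum>k<K. d u * ennreal (measure (\<xi> k) {u..}))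
          + (\<Sum>j<K. \<Sum>l<K. ennreal (p j l) * (\<integral>\<^sup>+y. d u * res svc_tail l (u - y) \<partial>\<xi> j))"
      by (simp only: distrib_left sum_distrib_left)
  qed
  also have "\<dots> = (\<integral>\<^sup>+u. (\<Sum>k<K. d u * ennreal (measure (\<xi> k) {u..})) \<partial>lborel)
      + (\<integral>\<^sup>+u. (\<Sum>j<K. \<Sum>l<K. ennreal (p j l) * (\<integral>\<^sup>+y. d u * res svc_tail l (u - y) \<partial>\<xi> j)) \<partial>lborel)"
    using inner_m by (intro nn_integral_add) (auto intro!: borel_measurable_sum)
  also have "(\<integral>\<^sup>+u. (\<Sum>k<K. d u * ennreal (measure (\<xi> k) {u..})) \<partial>lborel) = (\<Sum>k<K. \<integral>\<^sup>+u. d u * ennreal (measure (\<xi> k) {u..}) \<partial>lborel)"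
    by (intro nn_integral_sum) auto
  also have "(\<integral>\<^sup>+u. (\<Sum>j<K. \<Sum>l<K. ennreal (p j l) * (\<integral>\<^sup>+y. d u * res svc_tail l (u - y) \<partial>\<xi> j)) \<partial>lborel)
      = (\<Sum>j<K. \<integral>\<^sup>+u. (\<Sum>l<K. ennreal (p j l) * (\<integral>\<^sup>+y. d u * res svc_tail l (u - y) \<partial>\<xi> j)) \<partial>lborel)"
    using inner_m by (intro nn_integral_sum) (auto intro!: borel_measurable_sum)
  also have "\<dots> = (\<Sum>j<K. \<Sum>l<K. ennreal (p j l) * (\<integral>\<^sup>+y. (\<integral>\<^sup>+u. d u * res svc_tail l (u - y) \<partial>lborel) \<partial>\<xi> j))"
  proof (intro sum.cong refl)
    fix j assume j: "j \<in> {..<K}"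
    show "(\<integral>\<^sup>+u. (\<Sum>l<K. ennreal (p j l) * (\<integral>\<^sup>+y. d u * res svc_tail l (u - y) \<partial>\<xi> j)) \<partial>lborel)
        = (\<Sum>l<K. ennreal (p j l) * (\<integral>\<^sup>+y. (\<integral>\<^sup>+u. d u * res svc_tail l (u - y) \<partial>lborel) \<partial>\<xi> j))"
      using nn_integral_add_weighted_sum[of "\<lambda>_. 0" lborel K "\<lambda>l u. \<integral>\<^sup>+y. d u * res svc_tail l (u - y) \<partial>\<xi> j"
          "\<lambda>l. \<integral>\<^sup>+y. (\<integral>\<^sup>+u. d u * res svc_tail l (u - y) \<partial>lborel) \<partial>\<xi> j" "\<lambda>l. ennreal (p j l)"] inner j by simp
  qed
  finally show ?thesis unfolding d_def .
qed

text \<open>\<open>R l\<close> is the expected work a job brings over its whole route from class l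
  on, so the right side is the work present initially together with the work of all later visits:
  the initial workload in dual form.\<close>

lemma drive_mass:
  assumes \<xi>: "moment_bounded q N \<xi>" and N: "0 \<le> N"
    and R: "\<And>l. l < K \<Longrightarrow> 0 \<le> R l" "\<And>l. l < K \<Longrightarrow> (\<integral>\<^sup>+x. res svc_tail l x \<partial>lborel) = ennreal (R l)"
  shows "(\<integral>\<^sup>+u. ennreal (drive \<xi> u) \<partial>lborel)
    = ennreal ((\<Sum>k<K. integral\<^sup>L (\<xi> k) (\<lambda>x. x)) + (\<Sum>k<K. mass (\<xi> k) * (\<Sum>j<K. p k j * R j)))"
    "0 \<le> (\<Sum>k<K. integral\<^sup>L (\<xi> k) (\<lambda>x. x)) + (\<Sum>k<K. mass (\<xi> k) * (\<Sum>j<K. p k j * R j))"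
    "(\<Sum>k<K. integral\<^sup>L (\<xi> k) (\<lambda>x. x)) + (\<Sum>k<K. mass (\<xi> k) * (\<Sum>j<K. p k j * R j))
      \<le> real K * N + (\<Sum>k<K. N * (\<Sum>j<K. p k j * R j))"
proof -
  have m: "is_meas (\<xi> k)" "mass (\<xi> k) \<le> N" "(\<integral>\<^sup>+y. ennreal y \<partial>\<xi> k) \<le> ennreal N" if "k < K" for k
    using \<xi> that by (auto simp: moment_bounded_def)
  have mean: "(\<integral>\<^sup>+y. ennreal y \<partial>\<xi> k) = ennreal (integral\<^sup>L (\<xi> k) (\<lambda>x. x))" "0 \<le> integral\<^sup>L (\<xi> k) (\<lambda>x. x)"
    "integral\<^sup>L (\<xi> k) (\<lambda>x. x) \<le> N" if k: "k < K" for k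
  proof -
    note [measurable_cong] = is_meas_split(2)[OF m(1)[OF k]]
    have nn: "AE x in \<xi> k. 0 \<le> x" by (rule is_meas_AE_nonneg[OF m(1)[OF k]])
    have "integrable (\<xi> k) (\<lambda>x. x)"
      using m(3)[OF k] nn by (intro integrableI_nonneg) (auto intro: le_less_trans)
    then show *: "(\<integral>\<^sup>+y. ennreal y \<partial>\<xi> k) = ennreal (integral\<^sup>L (\<xi> k) (\<lambda>x. x))"
      using nn by (intro nn_integral_eq_integral)
    show "0 \<le> integral\<^sup>L (\<xi> k) (\<lambda>x. x)" using nn by (intro integral_nonneg_AE)
    show "integral\<^sup>L (\<xi> k) (\<lambda>x. x) \<le> N" using m(3)[OF k] N unfolding * by simp
  qed
  have res_shift: "(\<integral>\<^sup>+y. (\<integral>\<^sup>+u. (1 * indicator {0<..} u) * res svc_tail l (u - y) \<partial>lborel) \<partial>\<xi> j) = ennreal (mass (\<xi> j) * R l)"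
    if j: "j < K" and l: "l < K" for j l
  proof -
    interpret finite_measure "\<xi> j" by (rule is_meas_split(1)[OF m(1)[OF j]])
    have [measurable]: "res svc_tail l \<in> borel_measurable borel" using res_meas[of svc_tail l] svc_tail_meas l by blast
    have "(\<integral>\<^sup>+y. (\<integral>\<^sup>+u. (1 * indicator {0<..} u) * res svc_tail l (u - y) \<partial>lborel) \<partial>\<xi> j) = (\<integral>\<^sup>+y. ennreal (R l) \<partial>\<xi> j)"
      using is_meas_AE_nonneg[OF m(1)[OF j]]
    proof (intro nn_integral_cong_AE, eventually_elim)
      fix y :: real assume y: "0 \<le> y"
      have "(\<integral>\<^sup>+u. (1 * indicator {0<..} u) * res svc_tail l (u - y) \<partial>lborel) = (\<integral>\<^sup>+u. res svc_tail l (u - y) \<partial>lborel)"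
      proof (intro nn_integral_cong)
        fix u :: real
        \<comment> \<open>Initial sizes are nonnegative, so the resolvent vanishes for
          \<open>u \<le> 0\<close> and the cut-off changes nothing.\<close>
        have "res svc_tail l (u - y) = 0" if "u \<le> 0"
          using that y l by (intro res_zero[of svc_tail]) (auto simp: svc_tail_meas svc_tail_zero)
        then show "1 * indicator {0<..} u * res svc_tail l (u - y) = res svc_tail l (u - y)" by (auto split: split_indicator)
      qed
      also have "\<dots> = ennreal (R l)" unfolding R(2)[OF l, symmetric] by (rule nn_integral_lborel_shift) measurable
      finally show "(\<integral>\<^sup>+u. (1 * indicator {0<..} u) * res svc_tail l (u - y) \<partial>lborel) = ennreal (R l)" .
    qed
    also have "\<dots> = ennreal (R l * mass (\<xi> j))" using R(1)[OF l] by (simp add: emeasure_eq_measure mass_def ennreal_mult)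
    finally show ?thesis by (simp add: mult.commute)
  qed
  have xi_part: "(\<integral>\<^sup>+u. (1 * indicator {0<..} u) * ennreal (measure (\<xi> k) {u..}) \<partial>lborel) = ennreal (integral\<^sup>L (\<xi> k) (\<lambda>x. x))"
    if k: "k < K" for k
  proof -
    have "(\<integral>\<^sup>+u. (1 * indicator {0<..} u) * ennreal (measure (\<xi> k) {u..}) \<partial>lborel)
        = (\<integral>\<^sup>+y. (\<integral>\<^sup>+u. (1 * indicator {0<..} u) * indicator {..y} u \<partial>lborel) \<partial>\<xi> k)"
      by (intro layer_cake is_meas_split m k) simp
    also have "\<dots> = (\<integral>\<^sup>+y. ennreal y \<partial>\<xi> k)"
      using is_meas_AE_nonneg[OF m(1)[OF k]]
    proof (intro nn_integral_cong_AE, eventually_elim)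
      fix y :: real assume "0 \<le> y"
      have "(\<integral>\<^sup>+u. (1 * indicator {0<..} u) * indicator {..y} u \<partial>lborel) = (\<integral>\<^sup>+u. indicator {0<..y} u \<partial>lborel)"
        by (intro nn_integral_cong) (auto split: split_indicator)
      then show "(\<integral>\<^sup>+u. (1 * indicator {0<..} u) * indicator {..y} u \<partial>lborel) = ennreal y"
        using \<open>0 \<le> y\<close> by simp
    qed
    finally show ?thesis by (simp add: mean(1)[OF k])
  qed
  have "(\<integral>\<^sup>+u. ennreal (drive \<xi> u) \<partial>lborel) = (\<integral>\<^sup>+u. ennreal (drive \<xi> u) * (1 * indicator {0<..} u) \<partial>lborel)"
  proof (rule nn_integral_cong_AE)
    show "AE u in lborel. ennreal (drive \<xi> u) = ennreal (drive \<xi> u) * (1 * indicator {0<..} u)"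
      using AE_lborel_singleton[of 0] by eventually_elim (auto simp: drive_def split: split_indicator)
  qed
  also have "\<dots> = (\<Sum>k<K. \<integral>\<^sup>+u. (1 * indicator {0<..} u) * ennreal (measure (\<xi> k) {u..}) \<partial>lborel)
       + (\<Sum>j<K. \<Sum>l<K. ennreal (p j l) * (\<integral>\<^sup>+y. (\<integral>\<^sup>+u. (1 * indicator {0<..} u) * res svc_tail l (u - y) \<partial>lborel) \<partial>\<xi> j))"
    by (rule nn_integral_drive[OF \<xi> N]) simp
  also have "\<dots> = (\<Sum>k<K. ennreal (integral\<^sup>L (\<xi> k) (\<lambda>x. x))) + (\<Sum>j<K. \<Sum>l<K. ennreal (p j l) * ennreal (mass (\<xi> j) * R l))"
    using xi_part res_shift by (intro arg_cong2[where f="(+)"] sum.cong refl arg_cong2[where f="(*)"]) auto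
  also have "(\<Sum>k<K. ennreal (integral\<^sup>L (\<xi> k) (\<lambda>x. x))) = ennreal (\<Sum>k<K. integral\<^sup>L (\<xi> k) (\<lambda>x. x))"
    using mean by (intro sum_ennreal) auto
  also have "(\<Sum>j<K. \<Sum>l<K. ennreal (p j l) * ennreal (mass (\<xi> j) * R l)) = (\<Sum>j<K. \<Sum>l<K. ennreal (p j l * (mass (\<xi> j) * R l)))"
    using p_nonneg R(1) by (intro sum.cong refl ennreal_mult[symmetric]) (auto simp: mass_def)
  also have "\<dots> = (\<Sum>j<K. ennreal (\<Sum>l<K. p j l * (mass (\<xi> j) * R l)))"
    using p_nonneg R(1) by (intro sum.cong refl sum_ennreal) (auto simp: mass_def)
  also have "\<dots> = ennreal (\<Sum>j<K. \<Sum>l<K. p j l * (mass (\<xi> j) * R l))"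
    using p_nonneg R(1) by (intro sum_ennreal) (auto simp: mass_def intro!: sum_nonneg)
  also have "(\<Sum>j<K. \<Sum>l<K. p j l * (mass (\<xi> j) * R l)) = (\<Sum>k<K. mass (\<xi> k) * (\<Sum>j<K. p k j * R j))"
    by (simp add: sum_distrib_left mult_ac)
  finally have eq: "(\<integral>\<^sup>+u. ennreal (drive \<xi> u) \<partial>lborel) = ennreal (\<Sum>k<K. integral\<^sup>L (\<xi> k) (\<lambda>x. x)) + ennreal (\<Sum>k<K. mass (\<xi> k) * (\<Sum>j<K. p k j * R j))" .
  have nn1: "0 \<le> (\<Sum>k<K. integral\<^sup>L (\<xi> k) (\<lambda>x. x))" using mean by (auto intro!: sum_nonneg)
  have PR: "0 \<le> (\<Sum>j<K. p k j * R j)" if "k < K" for k using p_nonneg R(1) that by (auto intro!: sum_nonneg)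
  have nn2: "0 \<le> (\<Sum>k<K. mass (\<xi> k) * (\<Sum>j<K. p k j * R j))"
    using PR by (auto intro!: sum_nonneg simp: mass_def)
  show "(\<integral>\<^sup>+u. ennreal (drive \<xi> u) \<partial>lborel)
    = ennreal ((\<Sum>k<K. integral\<^sup>L (\<xi> k) (\<lambda>x. x)) + (\<Sum>k<K. mass (\<xi> k) * (\<Sum>j<K. p k j * R j)))"
    unfolding eq using nn1 nn2 by (rule ennreal_plus[symmetric])
  show "0 \<le> (\<Sum>k<K. integral\<^sup>L (\<xi> k) (\<lambda>x. x)) + (\<Sum>k<K. mass (\<xi> k) * (\<Sum>j<K. p k j * R j))"
    using nn1 nn2 by simp
  have "(\<Sum>k<K. integral\<^sup>L (\<xi> k) (\<lambda>x. x)) \<le> (\<Sum>k<K. N)" using mean by (intro sum_mono) auto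
  moreover have "(\<Sum>k<K. mass (\<xi> k) * (\<Sum>j<K. p k j * R j)) \<le> (\<Sum>k<K. N * (\<Sum>j<K. p k j * R j))"
    using PR m(2) by (intro sum_mono mult_right_mono) auto
  ultimately show "(\<Sum>k<K. integral\<^sup>L (\<xi> k) (\<lambda>x. x)) + (\<Sum>k<K. mass (\<xi> k) * (\<Sum>j<K. p k j * R j))
      \<le> real K * N + (\<Sum>k<K. N * (\<Sum>j<K. p k j * R j))" by simp
qed

text \<open>For the routed part the first moments \<open>X\<close> of the resolvents take over the
  role of pointwise decay in \<open>drive_small\<close>; the initial tails need the moment of order
  1 + q.\<close>

lemma drive_tail_small:
  assumes N: "0 \<le> N" and q: "0 < q" and e: "0 < e"
  shows "\<exists>T. \<forall>\<xi>. moment_bounded q N \<xi> \<longrightarrow> (\<forall>u\<ge>T. (\<integral>\<^sup>+v\<in>{u<..}. ennreal (drive \<xi> v) \<partial>lborel) \<le> ennreal e)"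
proof -
  obtain R where R: "\<And>l. l < K \<Longrightarrow> 0 \<le> R l" "\<And>l. l < K \<Longrightarrow> (\<integral>\<^sup>+x. res svc_tail l x \<partial>lborel) = ennreal (R l)"
    "\<And>l. l < K \<Longrightarrow> R l = \<beta> l + (\<Sum>j<K. p l j * R j)" by (rule res_svc_mass) (rule that)
  obtain X where X: "\<And>l. l < K \<Longrightarrow> 0 \<le> X l" "\<And>l. l < K \<Longrightarrow> (\<integral>\<^sup>+x. ennreal x * res svc_tail l x \<partial>lborel) = ennreal (X l)"
    "\<And>l. l < K \<Longrightarrow> X l = (m2 l / 2 + \<beta> l * (\<Sum>j<K. p l j * R j)) + (\<Sum>j<K. p l j * X j)"
    by (rule res_svc_moment[OF R(1,2)], assumption, assumption, rule that)
  define E where "E = (\<Sum>j<K. \<Sum>l<K. p j l * (2 * X l * N + 2 * R l * N))"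
  have E: "0 \<le> E" unfolding E_def using p_nonneg R(1) X(1) N by (auto intro!: sum_nonneg)
  have le: "(\<integral>\<^sup>+v\<in>{u<..}. ennreal (drive \<xi> v) \<partial>lborel) \<le> ennreal (real K * (N * u powr (- q)) + E / u)"
    if \<xi>: "moment_bounded q N \<xi>" and u: "0 < u" for \<xi> u
  proof -
    have m: "is_meas (\<xi> k)" "mass (\<xi> k) \<le> N" "(\<integral>\<^sup>+y. ennreal y \<partial>\<xi> k) \<le> ennreal N"
      "(\<integral>\<^sup>+y. ennreal (y powr (1 + q)) \<partial>\<xi> k) \<le> ennreal N" if "k < K" for k
      using \<xi> that by (auto simp: moment_bounded_def)
    have ind: "indicator {u<..} v * indicator {0<..} v = (indicator {u<..} v :: ennreal)" for v
      using u by (auto split: split_indicator)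
    have "(\<integral>\<^sup>+v\<in>{u<..}. ennreal (drive \<xi> v) \<partial>lborel) = (\<integral>\<^sup>+v. ennreal (drive \<xi> v) * (indicator {u<..} v * indicator {0<..} v) \<partial>lborel)"
      unfolding ind ..
    also have "\<dots> = (\<Sum>k<K. \<integral>\<^sup>+v. indicator {u<..} v * indicator {0<..} v * ennreal (measure (\<xi> k) {v..}) \<partial>lborel)
       + (\<Sum>j<K. \<Sum>l<K. ennreal (p j l) * (\<integral>\<^sup>+y. (\<integral>\<^sup>+v. indicator {u<..} v * indicator {0<..} v * res svc_tail l (v - y) \<partial>lborel) \<partial>\<xi> j))"
      by (rule nn_integral_drive[OF \<xi> N]) simp
    also have "\<dots> \<le> ennreal (real K * (N * u powr (- q))) + ennreal (E / u)"
    proof (rule add_mono)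
      have "(\<Sum>k<K. \<integral>\<^sup>+v. indicator {u<..} v * indicator {0<..} v * ennreal (measure (\<xi> k) {v..}) \<partial>lborel)
          \<le> (\<Sum>k<K. ennreal (N * u powr (- q)))"
        unfolding ind using tail_integral_le_power[OF m(1,4) u q N] by (intro sum_mono) (simp add: mult.commute)
      also have "\<dots> = ennreal (\<Sum>k<K. N * u powr (- q))" using N by (intro sum_ennreal) auto
      finally show "(\<Sum>k<K. \<integral>\<^sup>+v. indicator {u<..} v * indicator {0<..} v * ennreal (measure (\<xi> k) {v..}) \<partial>lborel)
          \<le> ennreal (real K * (N * u powr (- q)))" by simp
      have "(\<Sum>j<K. \<Sum>l<K. ennreal (p j l) * (\<integral>\<^sup>+y. (\<integral>\<^sup>+v. indicator {u<..} v * indicator {0<..} v * res svc_tail l (v - y) \<partial>lborel) \<partial>\<xi> j))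
          \<le> ennreal (\<Sum>j<K. \<Sum>l<K. p j l * ((2 * X l * N + 2 * R l * N) / u))"
        unfolding ind
      proof (rule forcing_sum_le)
        fix j l assume j: "j < K" and l: "l < K"
        have [measurable]: "res svc_tail l \<in> borel_measurable borel" using res_meas[of svc_tail l] svc_tail_meas l by blast
        have shift: "(\<integral>\<^sup>+v. indicator {u<..} v * res svc_tail l (v - y) \<partial>lborel) = (\<integral>\<^sup>+x. indicator {u - y<..} x * res svc_tail l x \<partial>lborel)" for y
        proof -
          have "(\<integral>\<^sup>+v. indicator {u<..} v * res svc_tail l (v - y) \<partial>lborel) = (\<integral>\<^sup>+v. indicator {u - y<..} (v - y) * res svc_tail l (v - y) \<partial>lborel)"
            by (intro nn_integral_cong) (auto split: split_indicator)
          also have "\<dots> = (\<integral>\<^sup>+x. indicator {u - y<..} x * res svc_tail l x \<partial>lborel)"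
            by (rule nn_integral_lborel_shift[of "\<lambda>x. indicator {u - y<..} x * res svc_tail l x"]) measurable
          finally show ?thesis .
        qed
        show "(\<integral>\<^sup>+y. (\<integral>\<^sup>+v. indicator {u<..} v * res svc_tail l (v - y) \<partial>lborel) \<partial>\<xi> j) \<le> ennreal ((2 * X l * N + 2 * R l * N) / u)"
        proof (rule nn_integral_split_half[OF m(1-3)[OF j] N u _ R(1)[OF l]])
          fix y assume y: "0 \<le> y" "y < u / 2"
          have "ennreal (u / 2) * (\<integral>\<^sup>+x. indicator {u - y<..} x * res svc_tail l x \<partial>lborel)
              = (\<integral>\<^sup>+x. ennreal (u / 2) * (indicator {u - y<..} x * res svc_tail l x) \<partial>lborel)"
            by (rule nn_integral_cmult[symmetric]) measurable
          also have "\<dots> \<le> (\<integral>\<^sup>+x. ennreal x * res svc_tail l x \<partial>lborel)"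
            using y by (intro nn_integral_mono) (auto split: split_indicator intro!: mult_right_mono ennreal_leI)
          finally have "(\<integral>\<^sup>+x. indicator {u - y<..} x * res svc_tail l x \<partial>lborel) \<le> ennreal (X l / (u / 2))"
            using u X(1)[OF l] unfolding X(2)[OF l] by (intro ennreal_le_of_mult_le) auto
          then show "(\<integral>\<^sup>+v. indicator {u<..} v * res svc_tail l (v - y) \<partial>lborel) \<le> ennreal (2 * X l / u)"
            unfolding shift by (simp add: mult.commute)
        next
          fix y
          have "(\<integral>\<^sup>+x. indicator {u - y<..} x * res svc_tail l x \<partial>lborel) \<le> (\<integral>\<^sup>+x. res svc_tail l x \<partial>lborel)"
            by (intro nn_integral_mono) (auto split: split_indicator)
          then show "(\<integral>\<^sup>+v. indicator {u<..} v * res svc_tail l (v - y) \<partial>lborel) \<le> ennreal (R l)"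
            unfolding shift R(2)[OF l] .
        qed (use X(1)[OF l] in simp)
      qed (use R(1) X(1) N u in auto)
      also have "(\<Sum>j<K. \<Sum>l<K. p j l * ((2 * X l * N + 2 * R l * N) / u)) = E / u"
        by (simp add: E_def sum_divide_distrib)
      finally show "(\<Sum>j<K. \<Sum>l<K. ennreal (p j l) * (\<integral>\<^sup>+y. (\<integral>\<^sup>+v. indicator {u<..} v * indicator {0<..} v * res svc_tail l (v - y) \<partial>lborel) \<partial>\<xi> j)) \<le> ennreal (E / u)" .
    qed
    also have "\<dots> = ennreal (real K * (N * u powr (- q)) + E / u)"
      using N E u by (intro ennreal_plus[symmetric]) auto
    finally show ?thesis .
  qed
  have "((\<lambda>u. real K * (N * u powr (- q)) + E / u) \<longlongrightarrow> real K * (N * 0) + 0) at_top"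
    using q by (intro tendsto_intros tendsto_neg_powr tendsto_divide_0[OF tendsto_const] filterlim_ident
        filterlim_at_top_imp_at_infinity) auto
  then have "\<forall>\<^sub>F u in at_top. real K * (N * u powr (- q)) + E / u < e"
    using e by (intro order_tendstoD(2)) auto
  then obtain T where T: "\<And>u. T \<le> u \<Longrightarrow> real K * (N * u powr (- q)) + E / u < e"
    by (auto simp: eventually_at_top_linorder)
  have "(\<integral>\<^sup>+v\<in>{u<..}. ennreal (drive \<xi> v) \<partial>lborel) \<le> ennreal e" if \<xi>: "moment_bounded q N \<xi>" and u: "max T 1 \<le> u" for \<xi> u
  proof -
    have "(\<integral>\<^sup>+v\<in>{u<..}. ennreal (drive \<xi> v) \<partial>lborel) \<le> ennreal (real K * (N * u powr (- q)) + E / u)"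
      using u by (intro le[OF \<xi>]) auto
    also have "\<dots> \<le> ennreal e" using T[of u] u by (intro ennreal_leI) auto
    finally show ?thesis .
  qed
  then show ?thesis by blast
qed

end

section \<open>Uniform limit and the Levy-Prokhorov distance\<close>

context renewal_kernel
begin

text \<open>Since \<open>hk \<le> h\<close>, a lag \<open>R\<close> that makes the tail of
  \<open>h\<close> small serves every dominated kernel. Recent lags contribute at most \<epsilon>
  because \<open>Z\<close> is near \<open>a\<close>, remote ones because \<open>Z\<close> and
  \<open>a\<close> both lie in [0, B].\<close>

lemma convolution_limit:
  assumes hk[measurable]: "hk \<in> borel_measurable borel" and hk_b: "\<And>x. 0 \<le> hk x" "\<And>x. hk x \<le> h x"
    and q0: "(\<integral>\<^sup>+x. ennreal (hk x) \<partial>lborel) = ennreal q0" "0 \<le> q0"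
    and Z[measurable]: "Z \<in> borel_measurable borel" and Z_b: "\<And>v. 0 \<le> Z v" "\<And>v. Z v \<le> B" and a: "0 \<le> a" "a \<le> B"
    and close: "\<And>v. T \<le> v \<Longrightarrow> \<bar>Z v - a\<bar> \<le> \<epsilon>" and \<epsilon>: "0 \<le> \<epsilon>"
    and R: "B * (LINT x|lborel. h x * indicator {R<..} x) \<le> \<epsilon>" and u: "T + R \<le> u"
  shows "\<bar>enn2real (\<integral>\<^sup>+v. ennreal (hk (u - v)) * ennreal (Z v) \<partial>lborel) - a * q0\<bar> \<le> 2 * \<epsilon>"
proof -
  have hk_int: "integrable lborel hk" and hk_mass: "(LINT x|lborel. hk x) = q0"
  proof -
    show "integrable lborel hk"
      using q0 hk_b by (intro integrableI_nn_integral_finite[where x=q0]) auto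
    show "(LINT x|lborel. hk x) = q0" by (subst integral_eq_nn_integral) (auto simp: q0 hk_b)
  qed
  have int: "integrable lborel (\<lambda>x. hk x * Z (u - x))"
  proof (rule Bochner_Integration.integrable_bound[of lborel "\<lambda>x. B * hk x"])
    show "AE x in lborel. norm (hk x * Z (u - x)) \<le> norm (B * hk x)"
    proof (rule AE_I2)
      fix x
      have "hk x * Z (u - x) \<le> hk x * B" using hk_b Z_b by (intro mult_left_mono) auto
      moreover have "0 \<le> hk x * Z (u - x)" using hk_b Z_b by simp
      ultimately show "norm (hk x * Z (u - x)) \<le> norm (B * hk x)" by (simp add: mult.commute)
    qed
  qed (use hk_int in auto)
  have "(\<integral>\<^sup>+v. ennreal (hk (u - v)) * ennreal (Z v) \<partial>lborel) = (\<integral>\<^sup>+v. ennreal (hk (u - v) * Z (u - (u - v))) \<partial>lborel)"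
    using hk_b Z_b by (intro nn_integral_cong) (simp add: ennreal_mult)
  also have "\<dots> = (\<integral>\<^sup>+x. ennreal (hk x * Z (u - x)) \<partial>lborel)"
    by (rule nn_integral_lborel_reflect[of "\<lambda>x. ennreal (hk x * Z (u - x))"]) measurable
  also have "\<dots> = ennreal (LINT x|lborel. hk x * Z (u - x))"
    using int hk_b Z_b by (intro nn_integral_eq_integral) auto
  finally have "enn2real (\<integral>\<^sup>+v. ennreal (hk (u - v)) * ennreal (Z v) \<partial>lborel) = (LINT x|lborel. hk x * Z (u - x))"
    using hk_b Z_b by (simp add: integral_nonneg_AE)
  also have "\<dots> - a * q0 = (LINT x|lborel. hk x * Z (u - x) - a * hk x)"
    using int hk_int by (simp add: hk_mass)
  finally have eq: "enn2real (\<integral>\<^sup>+v. ennreal (hk (u - v)) * ennreal (Z v) \<partial>lborel) - a * q0 = (LINT x|lborel. hk x * Z (u - x) - a * hk x)" .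
  have intT: "integrable lborel (\<lambda>x. h x * indicator {R<..} x)"
    by (rule Bochner_Integration.integrable_bound[OF h_integrable]) (auto split: split_indicator)
  have B: "0 \<le> B" using a by simp
  have "\<bar>LINT x|lborel. hk x * Z (u - x) - a * hk x\<bar> \<le> (LINT x|lborel. \<bar>hk x * Z (u - x) - a * hk x\<bar>)"
    by (rule integral_abs_bound)
  also have "\<dots> \<le> (LINT x|lborel. \<epsilon> * h x + B * (h x * indicator {R<..} x))"
  proof (rule integral_mono)
    fix x
    have eq: "\<bar>hk x * Z (u - x) - a * hk x\<bar> = hk x * \<bar>Z (u - x) - a\<bar>"
    proof -
      have "hk x * Z (u - x) - a * hk x = hk x * (Z (u - x) - a)" by (simp add: algebra_simps)
      then show ?thesis using hk_b(1)[of x] by (simp add: abs_mult)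
    qed
    show "\<bar>hk x * Z (u - x) - a * hk x\<bar> \<le> \<epsilon> * h x + B * (h x * indicator {R<..} x)"
    proof (cases "x \<le> R")
      case True
      have "hk x * \<bar>Z (u - x) - a\<bar> \<le> h x * \<epsilon>"
        using hk_b close[of "u - x"] True u h_nonneg by (intro mult_mono) auto
      with True show ?thesis unfolding eq by (simp add: mult.commute)
    next
      case False
      have "\<bar>Z (u - x) - a\<bar> \<le> B" using Z_b(1)[of "u - x"] Z_b(2)[of "u - x"] a by linarith
      then have "hk x * \<bar>Z (u - x) - a\<bar> \<le> h x * B" using hk_b h_nonneg by (intro mult_mono) auto
      moreover have "0 \<le> \<epsilon> * h x" using \<epsilon> h_nonneg by simp
      ultimately show ?thesis unfolding eq using False by (simp add: mult.commute)
    qed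
  qed (use int hk_int intT h_integrable in auto)
  also have "\<dots> = \<epsilon> + B * (LINT x|lborel. h x * indicator {R<..} x)"
    using intT h_integrable by (simp add: h_integral)
  also have "\<dots> \<le> 2 * \<epsilon>" using R by simp
  finally show ?thesis unfolding eq .
qed

end

section \<open>The Levy-Prokhorov distance from finitely many tails\<close>

lemma nbhd_open: "open (nbhd B e)"
proof -
  have "nbhd B e = (\<Union>x\<in>B. ball x e)" by (auto simp: nbhd_def ball_def)
  then show ?thesis by (auto intro!: open_UN)
qed

text \<open>A grid cell that meets \<open>B\<close> lies in the neighbourhood because its length is
  \<open>d \<le> e\<close>, and its measure is a difference of two tails, hence off by at most
  \<open>2 * \<eta>\<close>. The cells leave out only \<open>{real n * d..}\<close> and the null
  negative half line.\<close>

lemma prokhorov_grid_half: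
  assumes M: "is_meas M" and L: "is_meas L" and d: "0 < d" "d \<le> e"
    and grid: "\<And>i. i \<le> n \<Longrightarrow> \<bar>measure M {real i * d..} - measure L {real i * d..}\<bar> \<le> \<eta>"
    and B: "closed B"
  shows "measure M B \<le> measure L (nbhd B e) + (2 * real n * \<eta> + measure M {real n * d..})"
proof -
  interpret M: finite_measure M by (rule is_meas_split(1)[OF M])
  interpret L: finite_measure L by (rule is_meas_split(1)[OF L])
  have sM: "sets M = sets borel" and sL: "sets L = sets borel" using is_meas_split M L by auto
  have \<eta>: "0 \<le> \<eta>" using grid[of 0] abs_ge_zero order_trans by blast
  define cell where "cell i = {real i * d..<real (Suc i) * d}" for i :: nat
  define J where "J = {i. i < n \<and> cell i \<inter> B \<noteq> {}}"
  have J: "finite J" "J \<subseteq> {..<n}" by (auto simp: J_def)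
  have cell_sets: "cell i \<in> sets borel" for i by (simp add: cell_def)
  have cover: "B \<subseteq> {..<0} \<union> (\<Union>i\<in>J. cell i) \<union> {real n * d..}"
  proof
    fix x assume x: "x \<in> B"
    show "x \<in> {..<0} \<union> (\<Union>i\<in>J. cell i) \<union> {real n * d..}"
    proof (cases "x < 0 \<or> real n * d \<le> x")
      case False
      define i where "i = nat \<lfloor>x / d\<rfloor>"
      have "0 \<le> x / d" using False d by simp
      then have "real i \<le> x / d" "x / d < real i + 1" unfolding i_def by linarith+
      then have ix: "real i * d \<le> x" "x < real (Suc i) * d" using d by (simp_all add: field_simps)
      have "real i * d < real n * d" using ix False by linarith
      then have "i < n" using d by simp
      then have "i \<in> J" using ix x by (auto simp: J_def cell_def)
      then show ?thesis using ix by (auto simp: cell_def)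
    qed auto
  qed
  have cellM: "measure M' (cell i) = measure M' {real i * d..} - measure M' {real (Suc i) * d..}"
    if "finite_measure M'" "sets M' = sets borel" for M' :: "real measure" and i
  proof -
    have "cell i = {real i * d..} - {real (Suc i) * d..}" unfolding cell_def by auto
    moreover have "{real (Suc i) * d..} \<subseteq> {real i * d..}" using d by (auto simp: algebra_simps)
    ultimately show ?thesis using finite_measure.finite_measure_Diff[OF that(1), of "{real i * d..}" "{real (Suc i) * d..}"] that(2) by simp
  qed
  have cell_le: "measure M (cell i) \<le> measure L (cell i) + 2 * \<eta>" if "i \<in> J" for i
  proof -
    have "i < n" using that by (auto simp: J_def)
    then show ?thesis
      using grid[of i] grid[of "Suc i"] cellM[OF M.finite_measure_axioms sM, of i] cellM[OF L.finite_measure_axioms sL, of i]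
      by linarith
  qed
  have disj: "disjoint_family_on cell J"
    unfolding disjoint_family_on_def
  proof (intro ballI impI)
    fix i j :: nat assume "i \<noteq> j"
    then consider "Suc i \<le> j" | "Suc j \<le> i" by linarith
    then show "cell i \<inter> cell j = {}"
    proof cases
      case 1
      then have "real (Suc i) * d \<le> real j * d" using d by (intro mult_right_mono) auto
      then show ?thesis by (auto simp: cell_def)
    next
      case 2
      then have "real (Suc j) * d \<le> real i * d" using d by (intro mult_right_mono) auto
      then show ?thesis by (auto simp: cell_def)
    qed
  qed
  have "(\<Union>i\<in>J. cell i) \<subseteq> nbhd B e"
  proof
    fix x assume "x \<in> (\<Union>i\<in>J. cell i)"
    then obtain i where i: "i \<in> J" "x \<in> cell i" by auto
    then obtain y where y: "y \<in> cell i" "y \<in> B" by (auto simp: J_def)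
    have "dist y x < d" using i y by (auto simp: cell_def dist_real_def algebra_simps)
    then show "x \<in> nbhd B e" using y d by (auto simp: nbhd_def intro!: bexI[of _ y])
  qed
  then have nb: "measure L (\<Union>i\<in>J. cell i) \<le> measure L (nbhd B e)"
    using nbhd_open[of B e] sL by (intro L.finite_measure_mono) auto
  have "measure M B \<le> measure M ({..<0} \<union> (\<Union>i\<in>J. cell i) \<union> {real n * d..})"
    using cover sM B J by (intro M.finite_measure_mono) (auto simp: cell_def)
  also have "\<dots> \<le> measure M ({..<0} \<union> (\<Union>i\<in>J. cell i)) + measure M {real n * d..}"
    using sM J by (intro measure_Un_le) (auto simp: cell_def)
  also have "measure M ({..<0} \<union> (\<Union>i\<in>J. cell i)) \<le> measure M {..<0} + measure M (\<Union>i\<in>J. cell i)"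
    using sM J by (intro measure_Un_le) (auto simp: cell_def)
  also have "measure M {..<0} = 0" using is_meas_split(6)[OF M] by simp
  also have "measure M (\<Union>i\<in>J. cell i) = (\<Sum>i\<in>J. measure M (cell i))"
    using sM J disj cell_sets by (intro M.finite_measure_finite_Union) auto
  also have "\<dots> \<le> (\<Sum>i\<in>J. measure L (cell i) + 2 * \<eta>)" by (intro sum_mono cell_le)
  also have "\<dots> = measure L (\<Union>i\<in>J. cell i) + real (card J) * (2 * \<eta>)"
    using sL J disj cell_sets by (subst L.finite_measure_finite_Union) (auto simp: sum.distrib)
  also have "real (card J) * (2 * \<eta>) \<le> real n * (2 * \<eta>)"
    using card_mono[OF _ J(2)] \<eta> by (intro mult_right_mono) auto
  finally show ?thesis using nb by simp
qed

text \<open>Smallness is asked of the tail of \<open>L\<close>, the limit; the tail of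
  \<open>M\<close> follows from the last grid point, which accounts for the extra \<eta> beside
  \<open>2 * real n * \<eta>\<close>.\<close>

lemma levy_prokhorov_le:
  assumes M: "is_meas M" and L: "is_meas L" and d: "0 < d" "d \<le> e"
    and grid: "\<And>i. i \<le> n \<Longrightarrow> \<bar>measure M {real i * d..} - measure L {real i * d..}\<bar> \<le> \<eta>"
    and tail: "measure L {real n * d..} + (2 * real n + 1) * \<eta> \<le> e"
  shows "levy_prokhorov M L \<le> e" "0 \<le> levy_prokhorov M L"
proof -
  let ?E = "{e. e > 0 \<and> (\<forall>B. closed B \<longrightarrow>
      measure M B \<le> measure L (nbhd B e) + e \<and> measure L B \<le> measure M (nbhd B e) + e)}"
  have \<eta>: "0 \<le> \<eta>" using grid[of 0] abs_ge_zero order_trans by blast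
  have grid': "\<And>i. i \<le> n \<Longrightarrow> \<bar>measure L {real i * d..} - measure M {real i * d..}\<bar> \<le> \<eta>"
    using grid by (simp add: abs_minus_commute)
  have mem: "e \<in> ?E"
  proof (intro CollectI conjI allI impI)
    show "0 < e" using d by simp
    fix B :: "real set" assume B: "closed B"
    have t: "measure M {real n * d..} \<le> measure L {real n * d..} + \<eta>" using grid[of n] by linarith
    have ring: "(2 * real n + 1) * \<eta> = 2 * real n * \<eta> + \<eta>" by (simp add: algebra_simps)
    show "measure M B \<le> measure L (nbhd B e) + e"
      using prokhorov_grid_half[where n=n, OF M L d grid B] t tail ring by linarith
    show "measure L B \<le> measure M (nbhd B e) + e"
      using prokhorov_grid_half[where n=n, OF L M d grid' B] tail ring \<eta> by linarith
  qed
  show "levy_prokhorov M L \<le> e" unfolding levy_prokhorov_def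
  proof (rule cInf_lower[OF mem])
    show "bdd_below ?E" by (rule bdd_belowI[of _ 0]) simp
  qed
  show "0 \<le> levy_prokhorov M L" unfolding levy_prokhorov_def
    using mem by (intro cInf_greatest) auto
qed

context network
begin

lemma forcing_at_le: "0 \<le> x0 \<Longrightarrow> forcing \<xi> (svc_tail_at k x0) u \<le> forcing \<xi> svc_tail u"
  unfolding forcing_def
  by (intro sum_mono mult_left_mono nn_integral_mono res_mono) (auto intro: svc_tail_at_le)

text \<open>In clock time the tail of class k is a convolution of the total mass with a kernel of
  integral \<open>lam' k * resid k x0\<close>, plus initial terms dominated by \<open>drive\<close>.
  The estimates depend on the state only through \<open>N\<close>, so one time serves all of
  \<open>I\<close>.\<close>

lemma uniform_class_limit:
  fixes A D :: "(nat \<Rightarrow> real measure) \<Rightarrow> real \<Rightarrow> nat \<Rightarrow> real"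
    and \<mu> :: "(nat \<Rightarrow> real measure) \<Rightarrow> real \<Rightarrow> nat \<Rightarrow> real measure"
  assumes path: "\<And>\<xi>. \<xi> \<in> I \<Longrightarrow> fluid_path K p \<nu> w \<alpha> \<xi> (A \<xi>) (D \<xi>) (\<mu> \<xi>)"
    and moment_bounded: "\<And>\<xi>. \<xi> \<in> I \<Longrightarrow> moment_bounded q N \<xi>" and N: "0 \<le> N" and q: "0 < q"
    and R: "\<And>l. l < K \<Longrightarrow> 0 \<le> R l" "\<And>l. l < K \<Longrightarrow> (\<integral>\<^sup>+x. res svc_tail l x \<partial>lborel) = ennreal (R l)"
    and m_def: "m = (\<Sum>l<K. lam' l * (m2 l / 2 + \<beta> l * (\<Sum>j<K. p l j * R j)))"
    and W_def: "\<And>\<xi>. W \<xi> = (\<Sum>k<K. integral\<^sup>L (\<xi> k) (\<lambda>x. x)) + (\<Sum>k<K. mass (\<xi> k) * (\<Sum>j<K. p k j * R j))"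
    and k: "k < K" and x0: "0 \<le> x0" and e: "0 < e"
  shows "0 < m" "\<exists>T. \<forall>\<xi>\<in>I. \<forall>t\<ge>T. \<bar>measure (\<mu> \<xi> t k) {x0..} - W \<xi> / m * (lam' k * resid k x0)\<bar> \<le> e"
proof -
  obtain c \<delta> where c: "0 < c" and \<delta>: "0 < \<delta>" and lower: "\<And>x. 0 < x \<Longrightarrow> x \<le> \<delta> \<Longrightarrow> c \<le> h x"
    by (rule kernel_lower) (rule that)
  have hz: "h x = 0" if "x \<le> 0" for x
    unfolding h_def using net_kernel_zero[of svc_tail x \<alpha>] svc_tail_meas svc_tail_zero that by simp
  have hu: "h x \<le> hb" for x
    unfolding h_def using net_kernel_svc_le[of x] alpha_nn w_nonneg by (intro enn2real_leI) (auto simp: hb_def intro!: sum_nonneg)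
  interpret rk: renewal_kernel h c \<delta> hb m
    using h_meas hz kernel_mass c \<delta> lower hu kernel_moment[OF R]
    by unfold_locales (auto simp: h_def m_def)
  show m_pos: "0 < m" by (rule rk.m_pos)
  define Wb where "Wb = real K * N + (\<Sum>k<K. N * (\<Sum>j<K. p k j * R j))"
  have mass: "(\<integral>\<^sup>+u. ennreal (drive \<xi> u) \<partial>lborel) = ennreal (W \<xi>)" "0 \<le> W \<xi>" "W \<xi> \<le> Wb" if "\<xi> \<in> I" for \<xi>
    using drive_mass[OF moment_bounded[OF that] N R] unfolding W_def Wb_def by auto
  have Wb0: "0 \<le> Wb" unfolding Wb_def using N p_nonneg R by (auto intro!: sum_nonneg add_nonneg_nonneg mult_nonneg_nonneg)
  obtain Cg where Cg: "0 \<le> Cg" "\<And>\<xi> u. moment_bounded q N \<xi> \<Longrightarrow> drive \<xi> u \<le> Cg" by (rule drive_bounded[OF N]) (rule that)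
  \<comment> \<open>\<open>max 1\<close> keeps the divisor in \<open>t / Cb\<close>
    positive.\<close>
  define Cb where "Cb = max 1 (rk.sol_bound Cg Wb)"
  define Z where "Z \<xi> = fluid_path.Z K (\<mu> \<xi>)" for \<xi>
  \<comment> \<open>The facts rest on each other in this order: positivity, the equation on the
    range of the clock, the bound on \<open>z\<close>, the growth of the clock, its full range, and
    at last the equation everywhere.\<close>
  have facts: "Z \<xi> \<in> borel_measurable borel \<and> drive \<xi> \<in> borel_measurable borel \<and> (\<forall>v. 0 \<le> Z \<xi> v \<and> Z \<xi> v \<le> Cb) \<and> (\<forall>v<0. Z \<xi> v = 0)
      \<and> (\<forall>v. ennreal (Z \<xi> v) = ennreal (drive \<xi> v) + (\<integral>\<^sup>+x. ennreal (h (v - x) * Z \<xi> x) \<partial>lborel))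
      \<and> (\<forall>t\<ge>0. t / Cb \<le> Sbar K (\<mu> \<xi>) t)
      \<and> (\<forall>t\<ge>0. ennreal (measure (\<mu> \<xi> t k) {x0..}) = ennreal (measure (\<xi> k) {x0 + Sbar K (\<mu> \<xi>) t..})
        + ((\<integral>\<^sup>+v. net_kernel \<alpha> (svc_tail_at k x0) (Sbar K (\<mu> \<xi>) t - v) * ennreal (Z \<xi> v) \<partial>lborel)
        + forcing \<xi> (svc_tail_at k x0) (Sbar K (\<mu> \<xi>) t)))"
    if \<xi>: "\<xi> \<in> I" for \<xi>
  proof -
    interpret fp: fluid_path K p \<nu> w \<alpha> \<xi> "A \<xi>" "D \<xi>" "\<mu> \<xi>" by (rule path[OF \<xi>])
    have pos: "0 < fp.z t" if "0 \<le> t" for t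
      by (rule fp.z_pos[OF c \<delta> _ that]) (use lower in \<open>auto simp: ennreal_h[symmetric] intro!: ennreal_leI\<close>)
    have Z_eq: "Z \<xi> = fp.Z" by (simp add: Z_def)
    have Zm: "fp.Z \<in> borel_measurable borel" by (rule fp.Z_meas) (rule pos)
    have em: "drive \<xi> \<in> borel_measurable borel" by (rule drive_meas) (rule fp.xi_meas)
    have drive_eq: "fp.total_forcing = drive \<xi>" by (rule ext) (simp add: fp.total_forcing_def drive_def)
    have conv: "net_kernel \<alpha> svc_tail (u - v) * ennreal (fp.Z v) = ennreal (h (u - v) * fp.Z v)" for u v
      unfolding ennreal_h[symmetric] by (rule ennreal_mult[symmetric]) (auto simp: h_def fp.Z_nonneg)
    have eq: "ennreal (fp.Z u) = ennreal (drive \<xi> u) + (\<integral>\<^sup>+v. ennreal (h (u - v) * fp.Z v) \<partial>lborel)"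
      if "u \<in> fp.S ` {0..} \<or> u < 0" for u
      using fp.Z_renewal[OF pos that] unfolding conv drive_eq by simp
    have z_le: "fp.z t \<le> Cb" if t: "0 \<le> t" for t
    proof -
      \<comment> \<open>A bound on [0, t] that depends on the path; it makes
        \<open>solution_le_sol_bound\<close> applicable, whose conclusion no longer depends on
        \<open>t\<close>.\<close>
      obtain B where B: "0 < B" "\<And>r. r \<in> {0..t} \<Longrightarrow> fp.z r \<le> B" using fp.z_bdd[of t] by blast
      have ZB: "fp.Z v \<le> B" if "v \<le> fp.S t" for v
      proof (cases "v \<in> fp.S ` {0..}")
        case True
        then obtain s where s: "0 \<le> s" "v = fp.S s" by auto
        have "s \<le> t"
        proof (rule ccontr)
          assume "\<not> s \<le> t"
          then have "fp.S t < fp.S s" using pos t by (intro fp.S_strict[of s]) auto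
          then show False using that s by simp
        qed
        then show ?thesis using B s fp.Z_S[OF pos, of s] by simp
      next
        case False
        then show ?thesis using B by (simp add: fp.Z_def)
      qed
      have "fp.Z (fp.S t) \<le> rk.sol_bound Cg Wb"
      proof (rule rk.solution_le_sol_bound[OF Zm em fp.Z_nonneg fp.Z_neg ZB _ _ Wb0 Cg(2)[OF moment_bounded[OF \<xi>]] Cg(1) order.refl])
        show "(\<integral>\<^sup>+v. ennreal (drive \<xi> v) \<partial>lborel) \<le> ennreal Wb" using mass[OF \<xi>] by (simp add: ennreal_leI)
        fix v assume v: "v \<le> fp.S t"
        have "v \<in> fp.S ` {0..} \<or> v < 0" using fp.range_S_downward[of "fp.S t" v] v t by force
        then show "ennreal (fp.Z v) = ennreal (drive \<xi> v) + (\<integral>\<^sup>+x. ennreal (h (v - x) * fp.Z x) \<partial>lborel)" by (rule eq)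
      qed
      then show ?thesis using fp.Z_S[OF pos t] by (simp add: Cb_def)
    qed
    have S_ge: "t / Cb \<le> fp.S t" if t: "0 \<le> t" for t
      using fp.S_diff_ge[of t Cb 0] pos z_le t fp.S_neg[of 0] by (simp add: Cb_def)
    \<comment> \<open>With mass at most \<open>Cb\<close> the clock runs at rate at least
      \<open>1 / Cb\<close>, so it has reached \<open>v\<close> by time
      \<open>v * Cb\<close>.\<close>
    have range: "v \<in> fp.S ` {0..}" if v: "0 \<le> v" for v
    proof -
      have "v \<le> fp.S (v * Cb)" using S_ge[of "v * Cb"] v by (simp add: Cb_def)
      then show ?thesis using v by (intro fp.range_S_downward[of "fp.S (v * Cb)" v]) (auto simp: Cb_def)
    qed
    have Z_le: "fp.Z v \<le> Cb" for v
    proof (cases "0 \<le> v")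
      case True
      then obtain s where "0 \<le> s" "v = fp.S s" using range by blast
      then show ?thesis using z_le fp.Z_S[OF pos] by simp
    next
      case False
      then show ?thesis by (simp add: fp.Z_neg Cb_def)
    qed
    have "ennreal (fp.Z v) = ennreal (drive \<xi> v) + (\<integral>\<^sup>+x. ennreal (h (v - x) * fp.Z x) \<partial>lborel)" for v
      using range[of v] by (intro eq) force
    then show ?thesis
      unfolding Z_eq using Zm em fp.Z_nonneg Z_le fp.Z_neg S_ge fp.class_renewal[OF pos _ k x0] by simp
  qed
  have dev: "\<exists>T. \<forall>\<xi>\<in>I. \<forall>u\<ge>T. \<sigma> * (Z \<xi> u - W \<xi> / m) \<le> e'" if "\<bar>\<sigma>\<bar> = 1" "0 < e'" for \<sigma> e'
  proof (rule rk.deviation_eventually_le[where g=drive and B=Cb and Wb=Wb])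
    show "\<exists>T. \<forall>i\<in>I. \<forall>u\<ge>T. drive i u \<le> e''" if "0 < e''" for e''
      using drive_small[OF N that, of q] moment_bounded by blast
    show "\<exists>T. \<forall>i\<in>I. \<forall>u\<ge>T. (\<integral>\<^sup>+v\<in>{u<..}. ennreal (drive i v) \<partial>lborel) \<le> ennreal e''" if "0 < e''" for e''
      using drive_tail_small[OF N q that] moment_bounded by blast
  qed (use facts mass drive_nonneg that in auto)
  define a where "a \<xi> = W \<xi> / m" for \<xi>
  \<comment> \<open>Bounds \<open>Z\<close> and the limit \<open>a\<close>, and therefore their
    difference.\<close>
  define B where "B = Cb + Wb / m"
  define q0 where "q0 = lam' k * resid k x0"
  have Cb1: "1 \<le> Cb" by (simp add: Cb_def)
  have B0: "0 < B" using Cb1 Wb0 m_pos by (simp add: B_def add_pos_nonneg)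
  \<comment> \<open>Two parts go to the convolution, one to the initial terms.\<close>
  define \<epsilon> where "\<epsilon> = e / 3"
  have \<epsilon>: "0 < \<epsilon>" using e by (simp add: \<epsilon>_def)
  obtain T1 where T1: "\<And>\<xi> u. \<xi> \<in> I \<Longrightarrow> T1 \<le> u \<Longrightarrow> Z \<xi> u - a \<xi> \<le> \<epsilon>" using dev[of 1 \<epsilon>] \<epsilon> by (auto simp: a_def)
  obtain T2 where T2: "\<And>\<xi> u. \<xi> \<in> I \<Longrightarrow> T2 \<le> u \<Longrightarrow> a \<xi> - Z \<xi> u \<le> \<epsilon>" using dev[of "-1" \<epsilon>] \<epsilon> by (auto simp: a_def)
  obtain T3 where T3: "\<And>\<xi> u. \<xi> \<in> I \<Longrightarrow> T3 \<le> u \<Longrightarrow> drive \<xi> u \<le> \<epsilon>" using drive_small[OF N \<epsilon>, of q] moment_bounded by blast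
  obtain Rt where Rt: "0 \<le> Rt" "\<And>R'. Rt \<le> R' \<Longrightarrow> \<bar>LINT x|lborel. h x * indicator {R'<..} x\<bar> \<le> \<epsilon> / B"
    using integrable_tail_small[OF rk.h_integrable, of "\<epsilon> / B"] \<epsilon> B0 by auto
  define hk where "hk x = enn2real (net_kernel \<alpha> (svc_tail_at k x0) x)" for x
  have nk_le: "net_kernel \<alpha> (svc_tail_at k x0) x \<le> ennreal (h x)" for x
    unfolding ennreal_h by (rule net_kernel_le) (auto simp: svc_tail_at_meas intro: svc_tail_at_le x0)
  have hk: "ennreal (hk x) = net_kernel \<alpha> (svc_tail_at k x0) x" for x
    unfolding hk_def by (rule ennreal_enn2real) (rule le_less_trans[OF nk_le], simp)
  have hk_le: "hk x \<le> h x" for x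
    unfolding hk_def using nk_le by (intro enn2real_leI) (auto simp: h_def)
  have hk_m: "hk \<in> borel_measurable borel"
  proof -
    have [measurable]: "net_kernel \<alpha> (svc_tail_at k x0) \<in> borel_measurable borel"
      by (rule net_kernel_meas) (rule svc_tail_at_meas)
    show ?thesis unfolding hk_def by measurable
  qed
  \<comment> \<open>\<open>G\<close> is a clock value; \<open>Cb * G\<close> is a time by which
    every clock of the family has reached it.\<close>
  define G where "G = max (max T1 T2 + Rt) (max 0 T3)"
  define T where "T = max 0 (Cb * G)"
  have "\<bar>measure (\<mu> \<xi> t k) {x0..} - W \<xi> / m * (lam' k * resid k x0)\<bar> \<le> e" if \<xi>: "\<xi> \<in> I" and t: "T \<le> t" for \<xi> t
  proof -
    note F = facts[OF \<xi>]
    define u where "u = Sbar K (\<mu> \<xi>) t"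
    have t0: "0 \<le> t" using t by (simp add: T_def)
    have "G \<le> t / Cb"
      using t Cb1 by (simp add: T_def pos_le_divide_eq mult.commute)
    also have "\<dots> \<le> u" using F t0 by (simp add: u_def)
    finally have u: "max T1 T2 + Rt \<le> u" "0 \<le> u" "T3 \<le> u" by (auto simp: G_def)
    define cv where "cv = (\<integral>\<^sup>+v. ennreal (hk (u - v)) * ennreal (Z \<xi> v) \<partial>lborel)"
    have aB: "0 \<le> a \<xi>" "a \<xi> \<le> B"
    proof -
      show "0 \<le> a \<xi>" using mass(2)[OF \<xi>] m_pos by (simp add: a_def)
      have "a \<xi> \<le> Wb / m" using mass(3)[OF \<xi>] m_pos by (simp add: a_def divide_right_mono)
      then show "a \<xi> \<le> B" using Cb1 by (simp add: B_def)
    qed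
    have lim: "\<bar>enn2real cv - a \<xi> * q0\<bar> \<le> 2 * \<epsilon>"
      unfolding cv_def
    proof (rule rk.convolution_limit[OF hk_m _ hk_le _ _ _ _ _ aB])
      show "(\<integral>\<^sup>+x. ennreal (hk x) \<partial>lborel) = ennreal q0" "0 \<le> q0"
        unfolding hk q0_def using net_kernel_at_mass[OF k x0] by auto
      show "Z \<xi> v \<le> B" for v using F Wb0 m_pos by (simp add: B_def add_increasing2)
      show "\<bar>Z \<xi> v - a \<xi>\<bar> \<le> \<epsilon>" if "max T1 T2 \<le> v" for v using T1[OF \<xi>, of v] T2[OF \<xi>, of v] that by simp
      show "B * (LINT x|lborel. h x * indicator {Rt<..} x) \<le> \<epsilon>"
        by (rule mult_le_of_abs_le_divide[OF B0 Rt(2)]) simp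
    qed (use F \<epsilon> u in \<open>auto simp: hk_def\<close>)
    have ms: "ennreal (measure (\<mu> \<xi> t k) {x0..}) = ennreal (measure (\<xi> k) {x0 + u..}) + (cv + forcing \<xi> (svc_tail_at k x0) u)"
      using F t0 unfolding cv_def hk u_def by blast
    have "cv \<le> ennreal (measure (\<mu> \<xi> t k) {x0..})" unfolding ms by (intro add_increasing add_increasing2) auto
    then have "cv < \<infinity>" by (rule le_less_trans) simp
    then have cv: "cv = ennreal (enn2real cv)" by simp
    \<comment> \<open>The initial jobs of class k and the routed initial jobs are together bounded
      by \<open>drive \<xi> u\<close>.\<close>
    define y where "y = ennreal (measure (\<xi> k) {x0 + u..}) + forcing \<xi> (svc_tail_at k x0) u"
    have "y \<le> ennreal (drive \<xi> u)"
    proof -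
      have gm: "is_meas (\<xi> k)" using moment_bounded[OF \<xi>] k by (auto simp: moment_bounded_def)
      have "measure (\<xi> k) {x0 + u..} \<le> measure (\<xi> k) {u..}"
        using x0 is_meas_split(2)[OF gm] by (intro finite_measure.finite_measure_mono[OF is_meas_split(1)[OF gm]]) auto
      also have "\<dots> \<le> (\<Sum>k<K. measure (\<xi> k) {u..})" using k by (intro member_le_sum[of k "{..<K}" "\<lambda>k. measure (\<xi> k) {u..}"]) auto
      finally have "ennreal (measure (\<xi> k) {x0 + u..}) \<le> (\<Sum>k<K. ennreal (measure (\<xi> k) {u..}))"
        by (simp add: ennreal_leI)
      then show ?thesis unfolding y_def ennreal_drive[OF moment_bounded[OF \<xi>] N u(2)]
        by (intro add_mono forcing_at_le x0)
    qed
    also have "\<dots> \<le> ennreal \<epsilon>" using T3[OF \<xi> u(3)] by (rule ennreal_leI)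
    finally have y: "y \<le> ennreal \<epsilon>" .
    then obtain r where r: "0 \<le> r" "y = ennreal r" "r \<le> \<epsilon>"
      using \<epsilon> by (cases y) (auto simp: top_unique)
    have "ennreal (measure (\<mu> \<xi> t k) {x0..}) = ennreal (enn2real cv) + ennreal r"
      unfolding ms r(2)[symmetric] y_def by (subst cv[symmetric]) (simp add: add_ac)
    also have "\<dots> = ennreal (enn2real cv + r)" using r by (intro ennreal_plus[symmetric]) auto
    finally have "measure (\<mu> \<xi> t k) {x0..} = enn2real cv + r" using r by (subst (asm) ennreal_inj) auto
    then show ?thesis using lim r unfolding a_def[symmetric] q0_def[symmetric] \<epsilon>_def by linarith
  qed
  then show "\<exists>T. \<forall>\<xi>\<in>I. \<forall>t\<ge>T. \<bar>measure (\<mu> \<xi> t k) {x0..} - W \<xi> / m * (lam' k * resid k x0)\<bar> \<le> e" by blast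
qed

end

section \<open>The lifting map\<close>

context network
begin

text \<open>On \<open>{x..}\<close> the density of \<open>nu_e\<close> and \<open>svc_tail\<close>
  divided by \<beta> differ at most at one point, which Lebesgue measure ignores.\<close>

lemma nu_e_facts:
  assumes k: "k < K" and b: "beta \<nu> k = \<beta> k" "0 < \<beta> k"
  shows "sets (nu_e \<nu> k) = sets borel" "emeasure (nu_e \<nu> k) {..<0} = 0"
    "\<And>x. 0 \<le> x \<Longrightarrow> emeasure (nu_e \<nu> k) {x..} = ennreal (resid k x / \<beta> k)"
    "finite_measure (nu_e \<nu> k)"
proof -
  note [measurable] = nu_tail_measurable[OF k] svc_tail_meas[OF k]
  let ?f = "\<lambda>y. ennreal (indicator {0..} y * measure (\<nu> k) {y..} / beta \<nu> k)"
  show sets: "sets (nu_e \<nu> k) = sets borel" by (simp add: nu_e_def)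
  have em: "emeasure (nu_e \<nu> k) X = (\<integral>\<^sup>+y. ?f y * indicator X y \<partial>lborel)" if "X \<in> sets borel" for X
    unfolding nu_e_def using that by (intro emeasure_density) auto
  have "emeasure (nu_e \<nu> k) {..<0} = (\<integral>\<^sup>+y. ?f y * indicator {..<0} y \<partial>lborel)" by (rule em) simp
  also have "\<dots> = (\<integral>\<^sup>+y. 0 \<partial>(lborel :: real measure))"
    by (intro nn_integral_cong) (auto split: split_indicator)
  finally show neg: "emeasure (nu_e \<nu> k) {..<0} = 0" by simp
  show pos: "emeasure (nu_e \<nu> k) {x..} = ennreal (resid k x / \<beta> k)" if x: "0 \<le> x" for x
  proof -
    have "emeasure (nu_e \<nu> k) {x..} = (\<integral>\<^sup>+y. ennreal (1 / \<beta> k) * (indicator {x<..} y * svc_tail k y) \<partial>lborel)"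
    proof (subst em, simp, rule nn_integral_cong_AE)
      show "AE y in lborel. ?f y * indicator {x..} y = ennreal (1 / \<beta> k) * (indicator {x<..} y * svc_tail k y)"
        using AE_lborel_singleton[of x]
      proof eventually_elim
        fix y :: real assume "y \<noteq> x"
        then show "?f y * indicator {x..} y = ennreal (1 / \<beta> k) * (indicator {x<..} y * svc_tail k y)"
          using x b by (auto split: split_indicator simp: svc_tail_def simp flip: ennreal_mult)
      qed
    qed
    also have "\<dots> = ennreal (1 / \<beta> k) * ennreal (resid k x)"
      unfolding ennreal_resid[OF k] by (rule nn_integral_cmult) measurable
    also have "\<dots> = ennreal (resid k x / \<beta> k)" using b resid_nonneg by (simp flip: ennreal_mult)
    finally show ?thesis .
  qed
  have "emeasure (nu_e \<nu> k) ({..<0} \<union> {0..}) \<le> emeasure (nu_e \<nu> k) {..<0} + emeasure (nu_e \<nu> k) {0..}"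
    using sets by (intro emeasure_subadditive) auto
  also have "\<dots> < \<infinity>" by (simp add: neg pos)
  also have "{..<0} \<union> {0..} = space (nu_e \<nu> k)" by (auto simp: nu_e_def)
  finally show "finite_measure (nu_e \<nu> k)" by (intro finite_measureI) auto
qed

text \<open>The factor is written as \<open>r * \<beta> k\<close> because \<beta> is the
  normalisation inside \<open>nu_e\<close>; it cancels and leaves \<open>resid\<close>.\<close>

lemma scaled_nu_e:
  assumes k: "k < K" and b: "beta \<nu> k = \<beta> k" "0 < \<beta> k" and r: "0 \<le> r"
  shows "is_meas (scale_measure (ennreal (r * \<beta> k)) (nu_e \<nu> k))"
    "0 \<le> x \<Longrightarrow> measure (scale_measure (ennreal (r * \<beta> k)) (nu_e \<nu> k)) {x..} = r * resid k x"
proof -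
  note f = nu_e_facts[OF k b]
  have fin: "finite_measure (scale_measure (ennreal (r * \<beta> k)) (nu_e \<nu> k))"
  proof (rule finite_measureI)
    show "emeasure (scale_measure (ennreal (r * \<beta> k)) (nu_e \<nu> k)) (space (scale_measure (ennreal (r * \<beta> k)) (nu_e \<nu> k))) \<noteq> \<infinity>"
      using finite_measure.emeasure_finite[OF f(4), of "space (nu_e \<nu> k)"]
      by (simp add: space_scale_measure ennreal_mult_eq_top_iff)
  qed
  then show "is_meas (scale_measure (ennreal (r * \<beta> k)) (nu_e \<nu> k))"
    using f(1,2) by (simp add: is_meas_def)
  assume x: "0 \<le> x"
  have "emeasure (scale_measure (ennreal (r * \<beta> k)) (nu_e \<nu> k)) {x..} = ennreal (r * \<beta> k) * ennreal (resid k x / \<beta> k)"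
    using f(3)[OF x] by simp
  also have "\<dots> = ennreal (r * \<beta> k * (resid k x / \<beta> k))"
    using r b resid_nonneg by (intro ennreal_mult[symmetric]) auto
  also have "r * \<beta> k * (resid k x / \<beta> k) = r * resid k x" using b by simp
  finally show "measure (scale_measure (ennreal (r * \<beta> k)) (nu_e \<nu> k)) {x..} = r * resid k x"
    using r resid_nonneg by (simp add: measure_def)
qed

end

section \<open>The zero state, and the theorem\<close>

lemma is_meas_mass_zero:
  assumes "is_meas M" "mass M = 0"
  shows "M = null_measure borel"
proof (rule measure_eqI)
  note s = is_meas_split[OF assms(1)]
  show "sets M = sets (null_measure borel)" using s by simp
  fix X assume "X \<in> sets M"
  have "emeasure M (space M) = 0" using assms(2) s by (simp add: mass_def finite_measure.emeasure_eq_measure)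
  then have "emeasure M X = 0" using emeasure_space[of M X] by simp
  then show "emeasure M X = emeasure (null_measure borel) X" by simp
qed

lemma null_measure_facts:
  "is_meas (null_measure borel)" "mass (null_measure borel) = 0" "integral\<^sup>L (null_measure borel) f = (0 :: real)"
  by (auto simp: is_meas_def mass_def measure_def intro!: finite_measureI)

theorem mainTheorem10:
  fixes K :: nat and \<alpha> :: "real vec" and P :: "real mat" and \<nu> :: "nat \<Rightarrow> real measure"
    and p N :: real
    and A D :: "(nat \<Rightarrow> real measure) \<Rightarrow> real \<Rightarrow> nat \<Rightarrow> real"
    and \<mu> :: "(nat \<Rightarrow> real measure) \<Rightarrow> real \<Rightarrow> nat \<Rightarrow> real measure"
  assumes alpha: "\<alpha> \<in> carrier_vec K" "\<forall>k<K. \<alpha> $ k \<ge> 0"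
    and nu: "\<forall>k<K. is_meas (\<nu> k) \<and> emeasure (\<nu> k) (space (\<nu> k)) = 1 \<and> emeasure (\<nu> k) {0} = 0"
    and P: "P \<in> carrier_mat K K" "\<forall>i<K. \<forall>j<K. P $$ (i, j) \<ge> 0"
      "spectral_radius (map_mat complex_of_real P) < 1"
    and critical: "(\<Sum>k<K. beta \<nu> k * lam K \<alpha> P $ k) = 1"
    and second_moment: "\<forall>k<K. (\<integral>\<^sup>+ x. ennreal (x ^ 2) \<partial>\<nu> k) < \<infinity>"
    and pN: "p > 0" "N > 0"
    and fluid: "\<forall>xi\<in>Bpn K p N. fluid_solution K \<alpha> P \<nu> xi (A xi) (D xi) (\<mu> xi)"
  shows "((\<lambda>t. SUP xi\<in>Bpn K p N.
            ereal (dmeas K (\<mu> xi t) (lift K \<alpha> P \<nu> (W0 K P \<nu> xi)))) \<longlongrightarrow> 0) at_top"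
proof -
  \<comment> \<open>Criticality excludes an empty network, so the \<open>Max\<close> in
    \<open>dmeas\<close> is over a nonempty set.\<close>
  have K0: "0 < K" using critical by (cases K) auto
  obtain w where w: "\<And>l. l < K \<Longrightarrow> 0 \<le> w l" "\<And>l. l < K \<Longrightarrow> (\<Sum>j<K. P $$ (l, j) * w j) + 1 = w l"
    using exists_supersolution[OF P] by blast
  note Q = Qmat_right_inverse[OF P(1,2) w]
  define r where "r l j = P $$ (l, j)" for l j
  have meas: "is_meas (\<nu> k)" if "k < K" for k using nu that by blast
  have pos: "AE y in \<nu> k. 0 < y" if k: "k < K" for k
  proof (rule AE_I[of _ _ "{..<0} \<union> {0}"])
    have s: "sets (\<nu> k) = sets borel" using is_meas_split(2)[OF meas[OF k]] .
    have "emeasure (\<nu> k) ({..<0} \<union> {0}) \<le> emeasure (\<nu> k) {..<0} + emeasure (\<nu> k) {0}"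
      using s by (intro emeasure_subadditive) auto
    also have "\<dots> = 0" using nu k meas[OF k] by (simp add: is_meas_def)
    finally show "emeasure (\<nu> k) ({..<0} \<union> {0}) = 0" by simp
    show "{..<0} \<union> {0} \<in> sets (\<nu> k)" using s by simp
  qed (auto simp: not_less)
  have prob: "prob_space (\<nu> k)" if "k < K" for k using nu that by (intro prob_spaceI) blast
  have sets_nu: "sets (\<nu> k) = sets borel" if "k < K" for k using is_meas_split(2)[OF meas[OF that]] .
  have m2: "(\<integral>\<^sup>+y. ennreal (y\<^sup>2) \<partial>\<nu> k) = ennreal (mom2 \<nu> k)" "0 \<le> mom2 \<nu> k" if k: "k < K" for k
  proof -
    note [measurable_cong] = sets_nu[OF k]
    have "integrable (\<nu> k) (\<lambda>y. y\<^sup>2)" using second_moment k by (intro integrableI_nonneg) auto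
    then show "(\<integral>\<^sup>+y. ennreal (y\<^sup>2) \<partial>\<nu> k) = ennreal (mom2 \<nu> k)"
      unfolding mom2_def by (intro nn_integral_eq_integral) auto
    show "0 \<le> mom2 \<nu> k" unfolding mom2_def by (intro integral_nonneg_AE) auto
  qed
  have b: "(\<integral>\<^sup>+y. ennreal y \<partial>\<nu> k) = ennreal (beta \<nu> k)" "0 < beta \<nu> k" if k: "k < K" for k
  proof -
    note [measurable_cong] = sets_nu[OF k]
    interpret prob_space "\<nu> k" by (rule prob[OF k])
    have nn: "AE y in \<nu> k. 0 \<le> y" using pos[OF k] by (auto elim: eventually_mono)
    \<comment> \<open>A finite second moment gives a finite mean through y \<le> 1 + y^2.\<close>
    have "(\<integral>\<^sup>+y. ennreal y \<partial>\<nu> k) \<le> (\<integral>\<^sup>+y. 1 + ennreal (y\<^sup>2) \<partial>\<nu> k)"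
    proof (intro nn_integral_mono)
      fix y :: real
      have "y \<le> 1 + y\<^sup>2" using zero_le_power2[of "y - 1"] by (simp add: power2_diff) (smt (verit) zero_le_power2)
      then have "ennreal y \<le> ennreal (1 + y\<^sup>2)" by (rule ennreal_leI)
      also have "\<dots> = ennreal 1 + ennreal (y\<^sup>2)" by (rule ennreal_plus) auto
      finally show "ennreal y \<le> 1 + ennreal (y\<^sup>2)" by simp
    qed
    also have "\<dots> = 1 + (\<integral>\<^sup>+y. ennreal (y\<^sup>2) \<partial>\<nu> k)"
      by (subst nn_integral_add) (auto simp: emeasure_space_1)
    also have "\<dots> < \<infinity>" using second_moment k by simp
    finally have "integrable (\<nu> k) (\<lambda>y. y)" using nn by (intro integrableI_nonneg) auto
    then show eq: "(\<integral>\<^sup>+y. ennreal y \<partial>\<nu> k) = ennreal (beta \<nu> k)"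
      unfolding beta_def using nn by (intro nn_integral_eq_integral)
    have "\<not> (AE y in \<nu> k. ennreal y = 0)"
    proof
      assume "AE y in \<nu> k. ennreal y = 0"
      then have "AE y in \<nu> k. False" using pos[OF k] by eventually_elim (simp add: ennreal_eq_0_iff)
      then show False by (simp add: AE_False)
    qed
    then have "(\<integral>\<^sup>+y. ennreal y \<partial>\<nu> k) \<noteq> 0" by (subst nn_integral_0_iff_AE) auto
    then show "0 < beta \<nu> k" unfolding eq by (simp add: ennreal_eq_0_iff not_le)
  qed
  interpret nw: network K r \<nu> w "beta \<nu>" "mom2 \<nu>" "\<lambda>k. \<alpha> $ k" "\<lambda>k. lam K \<alpha> P $ k"
  proof (intro network.intro feedback.intro network_axioms.intro)
    show "0 \<le> w l" if "l < K" for l by (rule w(1)[OF that])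
    show "prob_space (\<nu> l)" if "l < K" for l by (rule prob[OF that])
    show "sets (\<nu> l) = sets borel" if "l < K" for l by (rule sets_nu[OF that])
    show "AE y in \<nu> l. 0 < y" if "l < K" for l by (rule pos[OF that])
    show "0 \<le> mom2 \<nu> l" if "l < K" for l by (rule m2(2)[OF that])
    show "(\<integral>\<^sup>+y. ennreal y \<partial>\<nu> l) = ennreal (beta \<nu> l)" if "l < K" for l by (rule b(1)[OF that])
    show "(\<integral>\<^sup>+y. ennreal (y\<^sup>2) \<partial>\<nu> l) = ennreal (mom2 \<nu> l)" if "l < K" for l by (rule m2(1)[OF that])
    show "lam K \<alpha> P $ k = \<alpha> $ k + (\<Sum>j<K. r j k * lam K \<alpha> P $ j)" if "k < K" for k
      unfolding r_def by (rule lam_eq[OF P(1) Q alpha(1) that])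
    show "0 \<le> r l j" if "l < K" "j < K" for l j using P(2) that by (simp add: r_def)
    show "(\<Sum>j<K. r l j * w j) + 1 = w l" if "l < K" for l unfolding r_def by (rule w(2)[OF that])
    show "0 \<le> beta \<nu> l" if "l < K" for l using b(2)[OF that] by simp
    show "0 \<le> \<alpha> $ l" if "l < K" for l using alpha(2) that by simp
    show "(\<Sum>k<K. beta \<nu> k * lam K \<alpha> P $ k) = 1" by (rule critical)
  qed
  obtain R where R: "\<And>l. l < K \<Longrightarrow> 0 \<le> R l" "\<And>l. l < K \<Longrightarrow> (\<integral>\<^sup>+x. nw.res nw.svc_tail l x \<partial>lborel) = ennreal (R l)"
    and R_eq: "\<And>l. l < K \<Longrightarrow> R l = beta \<nu> l + (\<Sum>j<K. r l j * R j)" by (rule nw.res_svc_mass) (rule that)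
  have R_eq': "R l = beta \<nu> l + (\<Sum>j<K. P $$ (l, j) * R j)" if "l < K" for l using R_eq[OF that] by (simp add: r_def)
  note duality = transpose_Qmat_duality[OF P(1) Q _ R_eq']
  define PR where "PR k = (\<Sum>j<K. r k j * R j)" for k
  \<comment> \<open>The lifting constant and the mean of the kernel agree after P' Q is moved across
    the pairing, applied to the vector with entries \<beta> \<lambda>.\<close>
  have lift_const: "lift_const K \<alpha> P \<nu> = (\<Sum>l<K. lam K \<alpha> P $ l * (mom2 \<nu> l / 2 + beta \<nu> l * PR l))"
  proof -
    let ?v = "vec K (\<lambda>j. beta \<nu> j * lam K \<alpha> P $ j)"
    have "(\<Sum>j<K. (transpose_mat P * Qmat K P) $$ (k, j) * beta \<nu> j * lam K \<alpha> P $ j) = ((transpose_mat P * Qmat K P) *\<^sub>v ?v) $ k"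
      if "k < K" for k
    proof -
      have row: "(M *\<^sub>v vec K f) $ k = (\<Sum>j<K. M $$ (k, j) * f j)" if "M \<in> carrier_mat K K" for M and f :: "nat \<Rightarrow> real"
        using that \<open>k < K\<close> by (auto simp: scalar_prod_def atLeast0LessThan intro!: sum.cong)
      have "transpose_mat P * Qmat K P \<in> carrier_mat K K" using P(1) Q(1) by simp
      then show ?thesis unfolding row[OF \<open>transpose_mat P * Qmat K P \<in> carrier_mat K K\<close>] by (simp only: mult.assoc)
    qed
    then have "lift_const K \<alpha> P \<nu> = (\<Sum>k<K. mom2 \<nu> k / 2 * lam K \<alpha> P $ k)
        + (\<Sum>k<K. beta \<nu> k * ((transpose_mat P * Qmat K P) *\<^sub>v ?v) $ k)"
      unfolding lift_const_def sum.distrib by simp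
    also have "(\<Sum>k<K. beta \<nu> k * ((transpose_mat P * Qmat K P) *\<^sub>v ?v) $ k) = (\<Sum>k<K. ?v $ k * PR k)"
      unfolding PR_def r_def by (rule duality) auto
    also have "\<dots> = (\<Sum>k<K. beta \<nu> k * lam K \<alpha> P $ k * PR k)" by simp
    finally show ?thesis by (simp add: sum.distrib algebra_simps)
  qed
  define m where "m = lift_const K \<alpha> P \<nu>"
  define W where "W \<xi> = (\<Sum>k<K. integral\<^sup>L (\<xi> k) (\<lambda>x. x)) + (\<Sum>k<K. mass (\<xi> k) * PR k)" for \<xi>
  have W0: "W0 K P \<nu> \<xi> = W \<xi>" for \<xi>
  proof -
    have "(\<Sum>k<K. beta \<nu> k * ((transpose_mat P * Qmat K P) *\<^sub>v vec K (\<lambda>j. mass (\<xi> j))) $ k)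
        = (\<Sum>k<K. vec K (\<lambda>j. mass (\<xi> j)) $ k * PR k)"
      unfolding PR_def r_def by (rule duality) auto
    then show ?thesis by (simp add: W0_def W_def)
  qed
  let ?B = "Bpn K p N"
  have moment_bounded: "nw.moment_bounded p N \<xi>" if "\<xi> \<in> ?B" for \<xi>
    using that unfolding nw.moment_bounded_def Bpn_def is_cmeas_def by (auto dest: abs_le_D1)
  \<comment> \<open>The zero state falls under a separate clause of \<open>fluid_solution\<close>
    and does not give a \<open>fluid_path\<close>; it is treated directly.\<close>
  define I where "I = {\<xi> \<in> ?B. \<not> (\<forall>k<K. \<xi> k = null_measure borel)}"
  have path: "fluid_path K r \<nu> w (\<lambda>k. \<alpha> $ k) \<xi> (A \<xi>) (D \<xi>) (\<mu> \<xi>)" if \<xi>: "\<xi> \<in> I" for \<xi>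
  proof -
    have nz: "\<not> (\<forall>k<K. \<xi> k = null_measure borel)" and fs: "fluid_solution K \<alpha> P \<nu> \<xi> (A \<xi>) (D \<xi>) (\<mu> \<xi>)"
      using \<xi> fluid by (auto simp: I_def)
    have xm: "is_meas (\<xi> k)" if "k < K" for k using moment_bounded[of \<xi>] \<xi> that by (auto simp: nw.moment_bounded_def I_def)
    note fs' = fs[unfolded fluid_solution_def if_not_P[OF nz]]
    note f = fs'[THEN conjunct1] fs'[THEN conjunct2, THEN conjunct1] fs'[THEN conjunct2, THEN conjunct2, THEN conjunct1]
      fs'[THEN conjunct2, THEN conjunct2, THEN conjunct2, THEN conjunct1]
      fs'[THEN conjunct2, THEN conjunct2, THEN conjunct2, THEN conjunct2, THEN conjunct1]
      fs'[THEN conjunct2, THEN conjunct2, THEN conjunct2, THEN conjunct2, THEN conjunct2, THEN conjunct1]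
      fs'[THEN conjunct2, THEN conjunct2, THEN conjunct2, THEN conjunct2, THEN conjunct2, THEN conjunct2, THEN conjunct1]
      fs'[THEN conjunct2, THEN conjunct2, THEN conjunct2, THEN conjunct2, THEN conjunct2, THEN conjunct2, THEN conjunct2]
    have pos_mass: "0 < (\<Sum>k<K. mass (\<xi> k))"
    proof -
      obtain k where k: "k < K" "\<xi> k \<noteq> null_measure borel" using nz by blast
      then have "mass (\<xi> k) \<noteq> 0" using is_meas_mass_zero[OF xm] by blast
      then have "0 < mass (\<xi> k)" by (simp add: mass_def zero_less_measure_iff)
      then show ?thesis using k by (intro sum_pos2[of _ k]) (auto simp: mass_def)
    qed
    show ?thesis
    proof (intro fluid_path.intro fluid_path_axioms.intro)
      show "feedback K r \<nu> w" by (rule nw.feedback_axioms)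
      show "A \<xi> t k = \<alpha> $ k * t + (\<Sum>j<K. r j k * D \<xi> t j)" if "0 \<le> t" "k < K" for t k
        using f(5) that unfolding r_def by blast
      show "measure (\<mu> \<xi> t k) {x..} = measure (\<xi> k) {x + Sbar K (\<mu> \<xi>) t..}
          + (LINT s:{0..t}|interval_measure (\<lambda>s. A \<xi> (max 0 s) k).
               measure (\<nu> k) {x + (Sbar K (\<mu> \<xi>) t - Sbar K (\<mu> \<xi>) s)..})" if "0 \<le> t" "0 \<le> x" "k < K" for t x k
        using f(8) that by blast
      show "0 \<le> \<alpha> $ k" "is_meas (\<nu> k)" "is_meas (\<xi> k)" if "k < K" for k using alpha(2) meas xm that by auto
      show "is_meas (\<mu> \<xi> t k)" if "0 \<le> t" "k < K" for t k using f(2) that by blast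
      show "continuous_on {0..} (\<lambda>t. A \<xi> t k)" "continuous_on {0..} (\<lambda>t. D \<xi> t k)"
        "mono_on {0..} (\<lambda>t. A \<xi> t k)" "mono_on {0..} (\<lambda>t. D \<xi> t k)" if "k < K" for k
        using f(1) that by blast+
      show "\<mu> \<xi> 0 k = \<xi> k" if "k < K" for k using f(4) that by blast
      show "mass (\<mu> \<xi> t k) = mass (\<xi> k) + A \<xi> t k - D \<xi> t k" if "0 \<le> t" "k < K" for t k using f(6) that by blast
      show "Sint K (\<mu> \<xi>) t < \<infinity>" if "0 \<le> t" for t using f(7) that by blast
      show "0 < (\<Sum>k<K. mass (\<xi> k))" by (rule pos_mass)
    qed
  qed
  have lim: "0 < m" "\<exists>T. \<forall>\<xi>\<in>I. \<forall>t\<ge>T. \<bar>measure (\<mu> \<xi> t k) {x0..} - W \<xi> / m * (lam K \<alpha> P $ k * nw.resid k x0)\<bar> \<le> e"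
    if "k < K" "0 \<le> x0" "0 < e" for k x0 e
  proof -
    have gI: "nw.moment_bounded p N \<xi>" if "\<xi> \<in> I" for \<xi> using moment_bounded that by (auto simp: I_def)
    have N0: "0 \<le> N" using pN by simp
    have me: "m = (\<Sum>l<K. lam K \<alpha> P $ l * (mom2 \<nu> l / 2 + beta \<nu> l * (\<Sum>j<K. r l j * R j)))"
      unfolding m_def lift_const PR_def ..
    have We: "W \<xi> = (\<Sum>k<K. integral\<^sup>L (\<xi> k) (\<lambda>x. x)) + (\<Sum>k<K. mass (\<xi> k) * (\<Sum>j<K. r k j * R j))" for \<xi>
      unfolding W_def PR_def ..
    note U = nw.uniform_class_limit[OF path gI N0 pN(1) R me We that]
    show "0 < m" by (rule U(1))
    show "\<exists>T. \<forall>\<xi>\<in>I. \<forall>t\<ge>T. \<bar>measure (\<mu> \<xi> t k) {x0..} - W \<xi> / m * (lam K \<alpha> P $ k * nw.resid k x0)\<bar> \<le> e"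
      by (rule U(2))
  qed
  have m_pos: "0 < m" using lim(1)[OF K0, of 0 1] by simp
  \<comment> \<open>\<lambda> \<beta> is the integral of a nonnegative kernel, taken at
    \<open>x0 = 0\<close>, and \<beta> is positive.\<close>
  have lam_nonneg: "0 \<le> lam K \<alpha> P $ k" if k: "k < K" for k
  proof -
    have "0 \<le> lam K \<alpha> P $ k * beta \<nu> k" using nw.net_kernel_at_mass(2)[OF k, of 0] nw.resid_0[OF k] by simp
    then show ?thesis using b(2)[OF k] by (simp add: zero_le_mult_iff)
  qed
  define Wb where "Wb = real K * N + (\<Sum>k<K. N * PR k)"
  have W_bounds: "0 \<le> W \<xi>" "W \<xi> \<le> Wb" if "\<xi> \<in> ?B" for \<xi>
    using nw.drive_mass(2,3)[OF moment_bounded[OF that] _ R] pN unfolding W_def Wb_def PR_def by auto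
  have lift_meas: "is_meas (lift K \<alpha> P \<nu> (W \<xi>) k)"
    "\<And>x. 0 \<le> x \<Longrightarrow> measure (lift K \<alpha> P \<nu> (W \<xi>) k) {x..} = W \<xi> / m * (lam K \<alpha> P $ k * nw.resid k x)"
    if \<xi>: "\<xi> \<in> ?B" and k: "k < K" for \<xi> k
  proof -
    let ?r = "W \<xi> / m * lam K \<alpha> P $ k"
    have r0: "0 \<le> ?r" using W_bounds[OF \<xi>] m_pos lam_nonneg[OF k] by simp
    have eq: "lift K \<alpha> P \<nu> (W \<xi>) k = scale_measure (ennreal (?r * beta \<nu> k)) (nu_e \<nu> k)"
      unfolding lift_def m_def by (simp add: mult_ac)
    show "is_meas (lift K \<alpha> P \<nu> (W \<xi>) k)"
      unfolding eq by (rule nw.scaled_nu_e(1)[OF k refl b(2)[OF k] r0])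
    show "measure (lift K \<alpha> P \<nu> (W \<xi>) k) {x..} = W \<xi> / m * (lam K \<alpha> P $ k * nw.resid k x)" if "0 \<le> x" for x
      unfolding eq using nw.scaled_nu_e(2)[OF k refl b(2)[OF k] r0 that] by simp
  qed
  have uniform: "\<exists>T. \<forall>\<xi>\<in>?B. \<forall>t\<ge>T. 0 \<le> dmeas K (\<mu> \<xi> t) (lift K \<alpha> P \<nu> (W0 K P \<nu> \<xi>)) \<and> dmeas K (\<mu> \<xi> t) (lift K \<alpha> P \<nu> (W0 K P \<nu> \<xi>)) \<le> e"
    if e: "0 < e" for e
  proof -
    \<comment> \<open>\<open>q k / x\<close> bounds the mass of the limit measure of class k beyond
      x > 0, by Markov for \<open>resid\<close> and \<open>W \<xi> \<le> Wb\<close>.\<close>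
    define q where "q k = Wb / m * (lam K \<alpha> P $ k * (mom2 \<nu> k / 2))" for k
    have Wb0: "0 \<le> Wb"
      unfolding Wb_def PR_def using pN R(1) P(2) by (auto intro!: sum_nonneg add_nonneg_nonneg mult_nonneg_nonneg simp: r_def)
    have q0: "0 \<le> q k" if "k < K" for k
      unfolding q_def using Wb0 m_pos lam_nonneg[OF that] m2(2)[OF that] by simp
    define Qs where "Qs = (\<Sum>k<K. q k)"
    have qQ: "q k \<le> Qs" if "k < K" for k unfolding Qs_def using that q0 by (intro member_le_sum) auto
    have Qs0: "0 \<le> Qs" unfolding Qs_def using q0 by (auto intro!: sum_nonneg)
    define d where "d = e / 2"
    have d: "0 < d" "d \<le> e" using e by (auto simp: d_def)
    \<comment> \<open>Makes the limit measures beyond \<open>real n * d\<close> at most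
      \<open>e / 2\<close>; the successor keeps the end of the grid positive even if
      \<open>Qs = 0\<close>.\<close>
    obtain n0 :: nat where n0: "Qs / (d * (e / 2)) \<le> real n0" using real_arch_simple by blast
    define n where "n = Suc n0"
    have n: "0 < real n * d" "Qs / (real n * d) \<le> e / 2"
    proof -
      show nd: "0 < real n * d" using d by (simp add: n_def)
      have "Qs / (d * (e / 2)) \<le> real n" using n0 by (simp add: n_def)
      then have "Qs \<le> real n * (d * (e / 2))" using d e by (simp add: pos_divide_le_eq)
      then have "Qs \<le> e / 2 * (real n * d)" by (simp add: mult_ac)
      then show "Qs / (real n * d) \<le> e / 2" using nd by (simp add: pos_divide_le_eq)
    qed
    \<comment> \<open>Leaves the other half of \<open>e\<close> to the \<open>2 * real n + 1\<close>
      grid errors.\<close>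
    define \<eta> where "\<eta> = e / (2 * (2 * real n + 1))"
    have \<eta>: "0 < \<eta>" "(2 * real n + 1) * \<eta> = e / 2" using e by (auto simp: \<eta>_def field_simps)
    have "\<forall>x\<in>{..<K} \<times> {..n}. \<exists>T. \<forall>\<xi>\<in>I. \<forall>t\<ge>T.
        \<bar>measure (\<mu> \<xi> t (fst x)) {real (snd x) * d..} - W \<xi> / m * (lam K \<alpha> P $ fst x * nw.resid (fst x) (real (snd x) * d))\<bar> \<le> \<eta>"
    proof
      fix x assume "x \<in> {..<K} \<times> {..n}"
      then show "\<exists>T. \<forall>\<xi>\<in>I. \<forall>t\<ge>T.
        \<bar>measure (\<mu> \<xi> t (fst x)) {real (snd x) * d..} - W \<xi> / m * (lam K \<alpha> P $ fst x * nw.resid (fst x) (real (snd x) * d))\<bar> \<le> \<eta>"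
        using d \<eta>(1) by (intro lim(2)) auto
    qed
    then obtain Tf where Tf: "\<And>x \<xi> t. x \<in> {..<K} \<times> {..n} \<Longrightarrow> \<xi> \<in> I \<Longrightarrow> Tf x \<le> t \<Longrightarrow>
        \<bar>measure (\<mu> \<xi> t (fst x)) {real (snd x) * d..} - W \<xi> / m * (lam K \<alpha> P $ fst x * nw.resid (fst x) (real (snd x) * d))\<bar> \<le> \<eta>"
      using bchoice[of "{..<K} \<times> {..n}"] by meson
    \<comment> \<open>There are finitely many classes and grid points, so one time serves
      all.\<close>
    define T where "T = Max (insert 0 (Tf ` ({..<K} \<times> {..n})))"
    have TT: "0 \<le> T" "\<And>x. x \<in> {..<K} \<times> {..n} \<Longrightarrow> Tf x \<le> T" unfolding T_def by (auto intro!: Max_ge)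
    have lp: "levy_prokhorov (\<mu> \<xi> t k) (lift K \<alpha> P \<nu> (W \<xi>) k) \<le> e \<and> 0 \<le> levy_prokhorov (\<mu> \<xi> t k) (lift K \<alpha> P \<nu> (W \<xi>) k)"
      if \<xi>: "\<xi> \<in> ?B" and t: "T \<le> t" and k: "k < K" for \<xi> t k
    proof -
      have t0: "0 \<le> t" using t TT by simp
      have mum: "is_meas (\<mu> \<xi> t k)" using fluid \<xi> t0 k unfolding fluid_solution_def by blast
      have grid: "\<bar>measure (\<mu> \<xi> t k) {real i * d..} - measure (lift K \<alpha> P \<nu> (W \<xi>) k) {real i * d..}\<bar> \<le> \<eta>" if i: "i \<le> n" for i
      proof (cases "\<xi> \<in> I")
        case True
        have "(k, i) \<in> {..<K} \<times> {..n}" using k i by simp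
        then have "\<bar>measure (\<mu> \<xi> t k) {real i * d..} - W \<xi> / m * (lam K \<alpha> P $ k * nw.resid k (real i * d))\<bar> \<le> \<eta>"
          using Tf[of "(k, i)" \<xi> t] True TT(2)[of "(k, i)"] t by simp
        then show ?thesis using lift_meas(2)[OF \<xi> k, of "real i * d"] d by simp
      next
        case False
        \<comment> \<open>From the zero state the path stays at zero and \<open>W\<close> is 0, so
          neither measure has mass on the ray.\<close>
        then have null: "\<forall>k<K. \<xi> k = null_measure borel" using \<xi> by (simp add: I_def)
        have "\<mu> \<xi> t k = null_measure borel"
          using fluid \<xi> t0 k null unfolding fluid_solution_def by auto
        moreover have "W \<xi> = 0" unfolding W_def using null by (simp add: null_measure_facts)
        ultimately show ?thesis using lift_meas(2)[OF \<xi> k, of "real i * d"] d \<eta>(1) by (simp add: measure_def)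
      qed
      have "measure (lift K \<alpha> P \<nu> (W \<xi>) k) {real n * d..} \<le> e / 2"
      proof -
        have "real n * d * nw.resid k (real n * d) \<le> mom2 \<nu> k / 2" using n by (intro nw.resid_markov k) simp
        then have "nw.resid k (real n * d) \<le> mom2 \<nu> k / 2 / (real n * d)" using n(1) by (metis mult.commute pos_le_divide_eq)
        then have "W \<xi> / m * (lam K \<alpha> P $ k * nw.resid k (real n * d)) \<le> Wb / m * (lam K \<alpha> P $ k * (mom2 \<nu> k / 2 / (real n * d)))"
          using W_bounds[OF \<xi>] m_pos lam_nonneg[OF k] nw.resid_nonneg
          by (intro mult_mono divide_right_mono mult_left_mono mult_nonneg_nonneg) (auto simp: Wb0)
        also have "\<dots> = q k / (real n * d)" by (simp add: q_def)
        also have "\<dots> \<le> Qs / (real n * d)" using qQ[OF k] n(1) by (intro divide_right_mono) auto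
        also have "\<dots> \<le> e / 2" by (rule n(2))
        finally show ?thesis using lift_meas(2)[OF \<xi> k, of "real n * d"] n by simp
      qed
      then have "measure (lift K \<alpha> P \<nu> (W \<xi>) k) {real n * d..} + (2 * real n + 1) * \<eta> \<le> e" using \<eta>(2) by simp
      then show ?thesis using levy_prokhorov_le[where n=n, OF mum lift_meas(1)[OF \<xi> k] d grid] by blast
    qed
    have "0 \<le> dmeas K (\<mu> \<xi> t) (lift K \<alpha> P \<nu> (W0 K P \<nu> \<xi>)) \<and> dmeas K (\<mu> \<xi> t) (lift K \<alpha> P \<nu> (W0 K P \<nu> \<xi>)) \<le> e"
      if \<xi>: "\<xi> \<in> ?B" and t: "T \<le> t" for \<xi> t
    proof
      have ne: "(\<lambda>k. levy_prokhorov (\<mu> \<xi> t k) (lift K \<alpha> P \<nu> (W \<xi>) k)) ` {..<K} \<noteq> {}" using K0 by auto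
      show "dmeas K (\<mu> \<xi> t) (lift K \<alpha> P \<nu> (W0 K P \<nu> \<xi>)) \<le> e"
        unfolding dmeas_def W0 using lp[OF \<xi> t] ne by (subst Max_le_iff) auto
      show "0 \<le> dmeas K (\<mu> \<xi> t) (lift K \<alpha> P \<nu> (W0 K P \<nu> \<xi>))"
        unfolding dmeas_def W0 using lp[OF \<xi> t K0] K0 by (subst Max_ge_iff) auto
    qed
    then show ?thesis by blast
  qed
  \<comment> \<open>The supremum of the empty set in \<open>ereal\<close> is -\<infinity>; the zero
    state shows that the set is not empty and supplies the lower bound 0.\<close>
  have null_in: "(\<lambda>_. null_measure borel) \<in> ?B"
    using pN null_measure_facts by (simp add: Bpn_def is_cmeas_def nn_integral_null_measure)
  show ?thesis
  proof (rule order_tendstoI)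
    fix a :: ereal assume a: "a < 0"
    obtain T where T: "\<And>\<xi> t. \<xi> \<in> ?B \<Longrightarrow> T \<le> t \<Longrightarrow> 0 \<le> dmeas K (\<mu> \<xi> t) (lift K \<alpha> P \<nu> (W0 K P \<nu> \<xi>))"
      using uniform[of 1] by auto
    show "\<forall>\<^sub>F t in at_top. a < (SUP \<xi>\<in>?B. ereal (dmeas K (\<mu> \<xi> t) (lift K \<alpha> P \<nu> (W0 K P \<nu> \<xi>))))"
    proof (rule eventually_mono[OF eventually_ge_at_top[of T]])
      fix t assume "T \<le> t"
      then have "0 \<le> ereal (dmeas K (\<mu> (\<lambda>_. null_measure borel) t) (lift K \<alpha> P \<nu> (W0 K P \<nu> (\<lambda>_. null_measure borel))))"
        using T[OF null_in] by simp
      also have "\<dots> \<le> (SUP \<xi>\<in>?B. ereal (dmeas K (\<mu> \<xi> t) (lift K \<alpha> P \<nu> (W0 K P \<nu> \<xi>))))"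
        by (rule SUP_upper[OF null_in])
      finally show "a < (SUP \<xi>\<in>?B. ereal (dmeas K (\<mu> \<xi> t) (lift K \<alpha> P \<nu> (W0 K P \<nu> \<xi>))))" using a by order
    qed
  next
    fix a :: ereal assume "0 < a"
    then obtain e where e: "0 < e" "ereal e < a" using ereal_dense2[of 0 a] by auto
    obtain T where T: "\<And>\<xi> t. \<xi> \<in> ?B \<Longrightarrow> T \<le> t \<Longrightarrow> dmeas K (\<mu> \<xi> t) (lift K \<alpha> P \<nu> (W0 K P \<nu> \<xi>)) \<le> e"
      using uniform[OF e(1)] by auto
    show "\<forall>\<^sub>F t in at_top. (SUP \<xi>\<in>?B. ereal (dmeas K (\<mu> \<xi> t) (lift K \<alpha> P \<nu> (W0 K P \<nu> \<xi>)))) < a"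
    proof (rule eventually_mono[OF eventually_ge_at_top[of T]])
      fix t assume "T \<le> t"
      then have "(SUP \<xi>\<in>?B. ereal (dmeas K (\<mu> \<xi> t) (lift K \<alpha> P \<nu> (W0 K P \<nu> \<xi>)))) \<le> ereal e"
        using T by (intro SUP_least) simp
      then show "(SUP \<xi>\<in>?B. ereal (dmeas K (\<mu> \<xi> t) (lift K \<alpha> P \<nu> (W0 K P \<nu> \<xi>)))) < a" using e by order
    qed
  qed
qed

end
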